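(* Let $V$ be a finite-dimensional $F$-vector space with an $F$-linear action of $\mathrm{GL}_3(F)$. The restriction map $$\phi:\mathrm{C}_{\mathrm{har}}(\Gamma(t),V)\to\mathrm{C}_{\mathrm{har}}(\mathrm{St}_0,V),\quad c\mapsto c|_{\mathrm{St}_0}$$ is an isomorphism of $F[\mathrm{GL}_3(\mathbb{F}_q)]$-modules, and $\dim_F\mathrm{C}_{\mathrm{har}}(\Gamma(t),V)=q^3\dim_F V$.
   Context: Let $q$ be a prime power, $A=\mathbb{F}_q[t]$, $F=\mathbb{F}_q(t)$, $F_\infty=\mathbb{F}_q((1/t))$, $\pi=1/t$, $\mathcal{O}_\infty=\mathbb{F}_q[[\pi]]$. $\mathcal{B}$ is the Bruhat–Tits building of $\mathrm{PGL}_3(F_\infty)$: vertices are homothety classes of $\mathcal{O}_\infty$-lattices in $F_\infty^3$, simplices are sets $\{v_0,\dots,v_k\}$ with representatives $L_0\supsetneq\cdots\supsetneq L_k\supsetneq\pi L_0$; $\mathrm{GL}_3(F_\infty)$ acts by $g[L]=[gL]$. $\Gamma(t)$ is the kernel of reduction mod $t$, $\mathrm{GL}_3(A)\to\mathrm{GL}_3(\mathbb{F}_q)$. $\mathrm{St}_0$ is the set of simplices of $\mathcal{B}$ containing the vertex $[0,0]$ (class of the standard lattice $\mathcal{O}_\infty^3$). A harmonic cocycle with values in $V$ is a map $c$ from chambers of $\mathcal{B}$ to $V$ with $\sum_{s\supset e}c(s)=0$ for every edge $e$; $\mathrm{GL}_3(F)$ acts by $(c|\gamma)(s)=\gamma^{-1}c(\gamma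 s)$; $\mathrm{C}_{\mathrm{har}}(\Gamma,V)$ denotes the $\Gamma$-invariant harmonic cocycles. $\mathrm{C}_{\mathrm{har}}(\mathrm{St}_0,V)$ is the $F$-space of maps $c$ from chambers in $\mathrm{St}_0$ to $V$ such that for every edge $e\in\mathrm{St}_0$, $\sum c(s)=0$ over chambers $s\in\mathrm{St}_0$ containing $e$. The group $\mathrm{GL}_3(\mathbb{F}_q)\subset\mathrm{GL}_3(A)$ fixes $[0,0]$ and acts on both spaces by the same formula $(c|\gamma)(s)=\gamma^{-1}c(\gamma s)$ (on $\mathrm{C}_{\mathrm{har}}(\Gamma(t),V)$ this is well defined since $\Gamma(t)$ is normal in $\mathrm{GL}_3(A)$). *)

theory Defs
  imports "HOL-Analysis.Analysis" "HOL-Computational_Algebra.Computational_Algebra"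
    "HOL-Library.Function_Algebras"
begin

no_notation fps_nth (infixl \<open>$\<close> 75)

text \<open>Conventions. 'k is the finite field F_q.
  F = F_q(t) is the type 'k poly fract, A = F_q[t] is embedded via Fract p 1.
  F_infinity = F_q((pi)) with pi = 1/t is the type 'k fls (Laurent series in pi);
  t corresponds to fls_X_inv.\<close>

type_synonym 'k Fld = "'k poly fract"
type_synonym 'k Finf = "'k fls"
type_synonym 'k bt_lattice = "('k Finf ^ 3) set"
type_synonym 'k bt_vertex = "'k bt_lattice set"
type_synonym 'k bt_simplex = "'k bt_vertex set"

definition A_of :: "'k::field poly \<Rightarrow> 'k Fld" where
  "A_of p = Fract p 1"

definition ev_inf :: "'k::field poly \<Rightarrow> 'k Finf" where
  "ev_inf p = poly (map_poly fls_const p) fls_X_inv"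

definition emb :: "'k::field Fld \<Rightarrow> 'k Finf" where
  "emb x = (THE y. \<forall>a b. b \<noteq> 0 \<longrightarrow> x = Fract a b \<longrightarrow> y = ev_inf a / ev_inf b)"

definition emb_mat :: "'k::field Fld ^ 3 ^ 3 \<Rightarrow> 'k Finf ^ 3 ^ 3" where
  "emb_mat g = (\<chi> i j. emb (g $ i $ j))"

definition Oinf :: "'k::field Finf set" where
  "Oinf = {a. 0 \<le> fls_subdegree a}"

definition std_lattice :: "'k::field bt_lattice" where
  "std_lattice = {x. \<forall>i. x $ i \<in> Oinf}"

text \<open>O_infinity-lattices in F_infinity^3: images of O_infinity^3 under GL_3(F_infinity)
  (i.e. free O_infinity-modules with an O_infinity-basis that is an F_infinity-basis).\<close>
definition is_lattice :: "'k::field bt_lattice \<Rightarrow> bool" where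
  "is_lattice L \<longleftrightarrow> (\<exists>g::'k Finf ^ 3 ^ 3. invertible g \<and> L = (\<lambda>x. g *v x) ` std_lattice)"

definition scale_lat :: "'k::field Finf \<Rightarrow> 'k bt_lattice \<Rightarrow> 'k bt_lattice" where
  "scale_lat c L = (\<lambda>x. c *s x) ` L"

definition hcls :: "'k::field bt_lattice \<Rightarrow> 'k bt_vertex" where
  "hcls L = {scale_lat c L | c. c \<noteq> 0}"

definition is_vertex :: "'k::field bt_vertex \<Rightarrow> bool" where
  "is_vertex v \<longleftrightarrow> (\<exists>L. is_lattice L \<and> v = hcls L)"

definition v0 :: "'k::field bt_vertex" where
  "v0 = hcls std_lattice"

definition is_edge :: "'k::field bt_simplex \<Rightarrow> bool" where
  "is_edge e \<longleftrightarrow> (\<exists>L0 L1. is_lattice L0 \<and> is_lattice L1 \<and>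
      L0 \<supset> L1 \<and> L1 \<supset> scale_lat fls_X L0 \<and> e = {hcls L0, hcls L1})"

definition is_chamber :: "'k::field bt_simplex \<Rightarrow> bool" where
  "is_chamber s \<longleftrightarrow> (\<exists>L0 L1 L2. is_lattice L0 \<and> is_lattice L1 \<and> is_lattice L2 \<and>
      L0 \<supset> L1 \<and> L1 \<supset> L2 \<and> L2 \<supset> scale_lat fls_X L0 \<and> s = {hcls L0, hcls L1, hcls L2})"

definition act_vertex :: "'k::field Fld ^ 3 ^ 3 \<Rightarrow> 'k bt_vertex \<Rightarrow> 'k bt_vertex" where
  "act_vertex g v = (\<lambda>L. (\<lambda>x. emb_mat g *v x) ` L) ` v"

definition act_simplex :: "'k::field Fld ^ 3 ^ 3 \<Rightarrow> 'k bt_simplex \<Rightarrow> 'k bt_simplex" where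
  "act_simplex g s = act_vertex g ` s"

definition slash :: "('k::field Fld ^ 3 ^ 3 \<Rightarrow> 'v \<Rightarrow> 'v) \<Rightarrow> ('k bt_simplex \<Rightarrow> 'v)
     \<Rightarrow> 'k Fld ^ 3 ^ 3 \<Rightarrow> ('k bt_simplex \<Rightarrow> 'v)" where
  "slash rho c g = (\<lambda>s. rho (matrix_inv g) (c (act_simplex g s)))"

text \<open>Harmonic cocycles on the whole building (functions on chambers; extended by 0).\<close>
definition harmonic :: "('k::field bt_simplex \<Rightarrow> 'v::ab_group_add) \<Rightarrow> bool" where
  "harmonic c \<longleftrightarrow> (\<forall>s. \<not> is_chamber s \<longrightarrow> c s = 0) \<and>
     (\<forall>e. is_edge e \<longrightarrow> (\<Sum>s\<in>{s. is_chamber s \<and> e \<subseteq> s}. c s) = 0)"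

definition GL3A :: "('k::field Fld ^ 3 ^ 3) set" where
  "GL3A = {g. invertible g \<and> (\<forall>i j. g $ i $ j \<in> range A_of)
               \<and> (\<forall>i j. matrix_inv g $ i $ j \<in> range A_of)}"

text \<open>Gamma(t): kernel of reduction mod t, GL_3(A) -> GL_3(F_q).\<close>
definition Gamma_t :: "('k::field Fld ^ 3 ^ 3) set" where
  "Gamma_t = {g \<in> GL3A. \<forall>i j. \<exists>p. g $ i $ j = A_of p \<and>
                 poly p 0 = (if i = j then 1 else 0)}"

definition GL3Fq :: "('k::field Fld ^ 3 ^ 3) set" where
  "GL3Fq = {g. invertible g \<and> (\<forall>i j. \<exists>a. g $ i $ j = A_of [:a:])}"

definition Char_Gamma :: "('k::field Fld ^ 3 ^ 3 \<Rightarrow> 'v \<Rightarrow> 'v) \<Rightarrow> ('k Fld ^ 3 ^ 3) set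
     \<Rightarrow> ('k bt_simplex \<Rightarrow> 'v::ab_group_add) set" where
  "Char_Gamma rho G = {c. harmonic c \<and> (\<forall>g\<in>G. slash rho c g = c)}"

text \<open>Chambers of St_0 (chambers containing v0), and harmonic cocycles on St_0
  (functions on chambers of St_0, extended by 0 elsewhere).\<close>
definition St0_chamber :: "'k::field bt_simplex \<Rightarrow> bool" where
  "St0_chamber s \<longleftrightarrow> is_chamber s \<and> v0 \<in> s"

definition Char_St0 :: "('k::field bt_simplex \<Rightarrow> 'v::ab_group_add) set" where
  "Char_St0 = {c. (\<forall>s. \<not> St0_chamber s \<longrightarrow> c s = 0) \<and>
     (\<forall>e. is_edge e \<and> v0 \<in> e \<longrightarrow> (\<Sum>s\<in>{s. St0_chamber s \<and> e \<subseteq> s}. c s) = 0)}"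

definition restr_St0 :: "('k::field bt_simplex \<Rightarrow> 'v::ab_group_add) \<Rightarrow> ('k bt_simplex \<Rightarrow> 'v)" where
  "restr_St0 c = (\<lambda>s. if St0_chamber s then c s else 0)"

definition fun_scale :: "('a \<Rightarrow> 'v \<Rightarrow> 'v) \<Rightarrow> 'a \<Rightarrow> ('s \<Rightarrow> 'v) \<Rightarrow> ('s \<Rightarrow> 'v)" where
  "fun_scale sc a f = (\<lambda>x. sc a (f x))"

end

theory Submission
  imports Defs
begin

text \<open>
  A chain \<open>L\<^sub>0 \<supset> L\<^sub>1 \<supset> L\<^sub>2 \<supset> \<pi>L\<^sub>0\<close> has a basis of \<open>A\<^sup>3\<close> adapted to all its members, so it has a type
  \<open>(a, b, c)\<close> of exponents, well defined and invariant under \<open>GL\<^sub>3(A)\<close>. Passing from \<open>L\<^sub>0\<close> to \<open>L\<^sub>1\<close> turns the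
  type into \<open>(b, c, a + 1)\<close>. The level of a chamber is the number of affine inversions of its type.
  On an edge omitting \<open>L\<^sub>1\<close> with \<open>a > b\<close>, the chamber of type \<open>(a, b, c)\<close> is the only one of its level and
  all others, of type \<open>(b, a, c)\<close>, lie lower; if \<open>a = b\<close> all chambers on the edge have the same type.
  The chambers of level 0 are the \<open>\<Gamma>(t)\<close>-translates of those of \<open>St\<^sub>0\<close>.
  Hence harmonicity determines a cocycle from level 0 upwards. Conversely, define an extension by
  recursion on the level, using one descending edge of every chamber. Among all edges at a vertex \<open>v\<close>,
  the harmonicity conditions satisfy one linear relation, obtained by summing over all chambers
  containing \<open>v\<close> in two ways. Choosing \<open>v\<close> suitably, this relation yields the condition at an arbitrary
  edge from conditions already known. Invariance under \<open>\<Gamma>(t)\<close> follows from uniqueness. The same relation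
  at the standard vertex shows that a harmonic function on \<open>St\<^sub>0\<close> is freely determined by its values on
  the \<open>q\<^sup>3\<close> flags opposite to a fixed one.
\<close>

section \<open>Laurent series and lattices\<close>

notation fls_nth (infixl \<open>$$\<close> 75)

text \<open>Within one level, edges with a peak have to be settled before edges without one. A
  chamber with two descending edges has strictly decreasing exponents when its chain starts at their
  common vertex; it is then alone at its level in the star of that vertex, so every further edge
  there is lower. An edge without a peak (\<open>a = b\<close>) has an end at which all chambers of
  top level contain this edge, so every other edge there is lower or has a peak itself. No
  fundamental domain for Gamma(t) is computed. The initial conditions are controlled by three facts:
  Gamma(t) acts freely on the orbit of the standard vertex, no chamber contains two vertices of this
  orbit, and an edge lying only on chambers of level 0 has an end in it. The number q^3 is the size
  of the open cell of the flag variety of F_q^3.\<close>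

text \<open>Valuation bounds are phrased through coefficients because \<open>fls_subdegree 0 = 0\<close>.\<close>
definition vge :: "int \<Rightarrow> 'k::field fls \<Rightarrow> bool" where
  "vge n x \<longleftrightarrow> (\<forall>k<n. x $$ k = 0)"

text \<open>The power pi^n for any integer n. Written as a shift, it turns multiplication into a
  translation of coefficients.\<close>

definition pw :: "int \<Rightarrow> 'k::field fls" where
  "pw n = fls_shift (- n) 1"

lemma pw_nonzero [simp]: "pw n \<noteq> 0"
  by (simp add: pw_def)

lemma subdegree_pw [simp]: "fls_subdegree (pw n) = n"
  by (simp add: pw_def)

lemma vge_0 [simp]: "vge n 0"
  by (simp add: vge_def)

lemma vge_mono: "vge n x \<Longrightarrow> m \<le> n \<Longrightarrow> vge m x"
  by (simp add: vge_def)

lemma vge_add: "vge n x \<Longrightarrow> vge n y \<Longrightarrow> vge n (x + y)"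
  by (simp add: vge_def)

lemma vge_uminus [simp]: "vge n (- x) \<longleftrightarrow> vge n x"
  by (simp add: vge_def)

lemma vge_diff: "vge n x \<Longrightarrow> vge n y \<Longrightarrow> vge n (x - y)"
  by (simp add: vge_def)

lemma vge_sum: "(\<And>i. i \<in> S \<Longrightarrow> vge n (f i)) \<Longrightarrow> vge n (sum f S)"
  by (induction S rule: infinite_finite_induct) (auto intro: vge_add)

lemma vge_Suc: "vge (n + 1) y \<longleftrightarrow> vge n y \<and> y $$ n = 0"
proof
  assume *: "vge n y \<and> y $$ n = 0"
  have "y $$ k = 0" if "k < n + 1" for k
    using * that by (cases "k = n") (auto simp: vge_def)
  then show "vge (n + 1) y" by (simp add: vge_def)
qed (simp add: vge_def)

lemma vge_iff_subdegree: "vge n x \<longleftrightarrow> x = 0 \<or> n \<le> fls_subdegree x"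
  by (auto simp: vge_def intro: fls_subdegree_geI)

lemma vge_mult: "vge a x \<Longrightarrow> vge b y \<Longrightarrow> vge (a + b) (x * y)"
  by (cases "x = 0 \<or> y = 0") (auto simp: vge_iff_subdegree)

lemma vge_mult0: "vge 0 x \<Longrightarrow> vge n y \<Longrightarrow> vge n (x * y)"
  using vge_mult[of 0 x n y] by simp

lemma vge_const [simp]: "vge 0 (fls_const a)"
  by (simp add: vge_def)

lemma vge_one [simp]: "vge 0 1"
  by (simp add: vge_iff_subdegree)

lemma pw_mult_nth [simp]: "(pw a * x) $$ k = x $$ (k - a)"
  by (simp add: pw_def fls_X_intpow_times_conv_shift(1))

lemma vge_pw_mult [simp]: "vge n (pw a * x) \<longleftrightarrow> vge (n - a) x"
proof -
  have "(\<forall>k<n. x $$ (k - a) = 0) \<longleftrightarrow> (\<forall>k<n - a. x $$ k = 0)"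
    by (metis add_diff_cancel_right' diff_add_cancel diff_strict_right_mono less_diff_eq)
  then show ?thesis by (simp add: vge_def)
qed

lemma pw_0 [simp]: "pw 0 = 1"
  by (simp add: pw_def)

lemma pw_mult_pw: "pw a * pw b = pw (a + b)"
  by (simp add: pw_def fls_X_intpow_times_fls_X_intpow)

lemma pw_inverse_mult [simp]: "pw a * (pw (- a) * x) = x"
  by (metis add.right_inverse mult.assoc mult_1 pw_0 pw_mult_pw)

text \<open>Reduction modulo pi is multiplicative on O_inf: \<open>x\<close> minus its constant
  coefficient is divisible by pi, and so is its product with \<open>y\<close>.\<close>

lemma vge0_mult_nth0:
  assumes "vge 0 x" "vge 0 y"
  shows "(x * y) $$ 0 = x $$ 0 * y $$ 0"
proof -
  have "vge 1 (x - fls_const (x $$ 0))" using assms(1) by (auto simp: vge_def)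
  then have "vge 1 (y * (x - fls_const (x $$ 0)))" using assms(2) by (intro vge_mult0)
  then have "(y * (x - fls_const (x $$ 0))) $$ 0 = 0" by (simp add: vge_def)
  then show ?thesis by (simp add: algebra_simps)
qed

lemma Oinf_iff: "a \<in> Oinf \<longleftrightarrow> vge 0 a"
  by (auto simp: Oinf_def vge_iff_subdegree)

abbreviation app :: "'k::field fls ^ 3 ^ 3 \<Rightarrow> ('k fls ^ 3) set \<Rightarrow> ('k fls ^ 3) set" where
  "app g L \<equiv> (\<lambda>x. g *v x) ` L"

definition box :: "(3 \<Rightarrow> int) \<Rightarrow> ('k::field fls ^ 3) set" where
  "box m = {x. \<forall>i. vge (m i) (x $ i)}"

lemma std_eq_box: "std_lattice = box (\<lambda>_. 0)"
  by (simp add: std_lattice_def box_def Oinf_iff)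

lemma app_app: "app g (app h L) = app (g ** h) L"
  by (simp add: image_image matrix_vector_mul_assoc)

lemma app_one [simp]: "app (mat 1) L = L"
  by simp

lemma invertible_inv: "invertible g \<Longrightarrow> g ** matrix_inv g = mat 1 \<and> matrix_inv g ** g = mat 1"
  unfolding invertible_def matrix_inv_def by (rule someI_ex)

lemma app_inv:
  assumes "invertible g"
  shows "app (matrix_inv g) (app g L) = L" "app g (app (matrix_inv g) L) = L"
  using assms by (simp_all add: app_app invertible_inv)

lemma invertible_matrix_inv: "invertible g \<Longrightarrow> invertible (matrix_inv g)"
  using invertible_inv unfolding invertible_def by blast

lemma matrix_inv_unique:
  fixes g :: "'a::field ^ 'n ^ 'n"
  assumes "g ** h = mat 1"
  shows "matrix_inv g = h"
proof -
  have "invertible g" using assms invertible_right_inverse by blast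
  then show ?thesis
    by (metis assms invertible_inv matrix_mul_assoc matrix_mul_lid matrix_mul_rid)
qed

lemma app_mono_iff: "invertible g \<Longrightarrow> app g L \<subseteq> app g M \<longleftrightarrow> L \<subseteq> M"
  by (metis app_inv(1) image_mono)

lemma app_eq_iff: "invertible g \<Longrightarrow> app g L = app g M \<longleftrightarrow> L = M"
  by (metis app_inv(1))

section \<open>Determinant valuation and colength of a lattice\<close>

definition vdet :: "'k::field fls ^ 3 ^ 3 \<Rightarrow> int" where
  "vdet g = fls_subdegree (det g)"

lemma vdet_mult: "invertible g \<Longrightarrow> invertible h \<Longrightarrow> vdet (g ** h) = vdet g + vdet h"
  by (simp add: vdet_def det_mul invertible_det_nz)

lemma vdet_one [simp]: "vdet (mat 1) = 0"
  by (simp add: vdet_def)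

lemma vdet_inv: "invertible g \<Longrightarrow> vdet (matrix_inv g) = - vdet g"
  using vdet_mult[of g "matrix_inv g"] by (simp add: invertible_matrix_inv invertible_inv)

definition imat :: "'k::field fls ^ 3 ^ 3 \<Rightarrow> bool" where
  "imat k \<longleftrightarrow> (\<forall>i j. vge 0 (k $ i $ j))"

lemma imat_app: "imat k \<Longrightarrow> x \<in> std_lattice \<Longrightarrow> k *v x \<in> std_lattice"
  by (auto simp: imat_def std_eq_box box_def matrix_vector_mult_def intro!: vge_sum vge_mult0)

lemma matrix_axis: "(k *v axis j x) $ i = k $ i $ j * (x::'a::comm_ring_1)"
  by (simp add: matrix_vector_mult_def axis_def if_distrib cong: if_cong)

lemma imat_iff: "imat k \<longleftrightarrow> app k std_lattice \<subseteq> std_lattice"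
proof
  assume *: "app k std_lattice \<subseteq> std_lattice"
  have "k *v axis j 1 \<in> std_lattice" for j
  proof -
    have "(axis j 1 :: 'a fls ^ 3) \<in> std_lattice" by (auto simp: std_eq_box box_def axis_def)
    then show ?thesis using * by blast
  qed
  then show "imat k" by (auto simp: std_eq_box box_def imat_def matrix_axis)
qed (use imat_app in blast)

lemma vge_det: "imat k \<Longrightarrow> vge 0 (det k)"
  by (auto simp: det_3 imat_def intro!: vge_add vge_diff vge_mult0)

text \<open>By Cramer's rule the numerators are determinants of integral matrices and the
  denominator is a unit, so an integral right-hand side has an integral solution.\<close>

lemma imat_vdet_0:
  assumes "imat k" "invertible k" "vdet k = 0"
  shows "app k std_lattice = std_lattice"
proof
  show "app k std_lattice \<subseteq> std_lattice" using assms imat_iff by blast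
  show "std_lattice \<subseteq> app k std_lattice"
  proof
    fix b assume b: "b \<in> (std_lattice :: ('a fls ^ 3) set)"
    define x where "x = (\<chi> l. det(\<chi> i j. if j=l then b$i else k$i$j) / det k)"
    have d: "det k \<noteq> 0" using assms(2) invertible_det_nz by blast
    have kx: "k *v x = b" using cramer[OF d, of x b] x_def by simp
    have "vge 0 (x $ l)" for l
    proof -
      have v: "vge 0 (det(\<chi> i j. if j=l then b$i else k$i$j))"
        by (rule vge_det) (use assms(1) b in \<open>auto simp: imat_def std_eq_box box_def\<close>)
      have "vge 0 (inverse (det k))"
        using assms(3) d by (simp add: vge_iff_subdegree vdet_def)
      then show ?thesis using v by (simp add: x_def divide_inverse vge_mult0)
    qed
    then show "b \<in> app k std_lattice"
      using kx by (auto simp: std_eq_box box_def intro!: image_eqI[of _ _ x])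
  qed
qed

text \<open>All three claims are read off from the transition matrix of the two bases: the inclusion
  makes it integral, its determinant then has valuation at least 0, and valuation 0 forces
  equality.\<close>

lemma std_incl:
  assumes g: "invertible g" and h: "invertible h"
    and sub: "app g std_lattice \<subseteq> app h std_lattice"
  shows "imat (matrix_inv h ** g)" "vdet h \<le> vdet g"
    "vdet g = vdet h \<Longrightarrow> app g std_lattice = app h std_lattice"
proof -
  let ?k = "matrix_inv h ** g"
  have k: "invertible ?k" using g h by (simp add: invertible_matrix_inv invertible_mult)
  have hk: "h ** ?k = g" using h by (simp add: matrix_mul_assoc invertible_inv)
  have "app ?k std_lattice \<subseteq> std_lattice"
    using sub app_mono_iff[OF h, of "app ?k std_lattice" std_lattice] hk by (simp add: app_app)
  then show im: "imat ?k" using imat_iff by blast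
  have vk: "vdet ?k = vdet g - vdet h" using g h by (simp add: vdet_mult vdet_inv invertible_matrix_inv)
  have "vdet ?k \<ge> 0" using vge_det[OF im] k invertible_det_nz[of ?k]
    by (auto simp: vge_iff_subdegree vdet_def)
  then show "vdet h \<le> vdet g" using vk by simp
  show "app g std_lattice = app h std_lattice" if "vdet g = vdet h"
    using imat_vdet_0[OF im k] that vk hk by (metis app_app diff_self)
qed

text \<open>Colength relative to the standard lattice; it grows as the lattice shrinks. The chosen
  basis is immaterial, since two bases of one lattice are compared by \<open>std_incl\<close> in
  both directions.\<close>

definition dg :: "'k::field bt_lattice \<Rightarrow> int" where
  "dg L = vdet (SOME g. invertible g \<and> L = app g std_lattice)"

lemma dg_app_std: "invertible g \<Longrightarrow> dg (app g std_lattice) = vdet g"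
proof -
  assume g: "invertible g"
  define h where "h = (SOME h. invertible h \<and> app g std_lattice = app h std_lattice)"
  have "invertible h \<and> app g std_lattice = app h std_lattice"
    unfolding h_def by (rule someI[of _ g]) (use g in simp)
  then have "vdet h = vdet g" using std_incl(2) g by (metis order_antisym order_refl)
  then show ?thesis by (simp add: dg_def h_def)
qed

lemma dg_mono: "is_lattice L \<Longrightarrow> is_lattice M \<Longrightarrow> L \<subseteq> M \<Longrightarrow> dg M \<le> dg L"
  by (auto simp: is_lattice_def dg_app_std intro: std_incl(2))

lemma dg_eqD: "is_lattice L \<Longrightarrow> is_lattice M \<Longrightarrow> L \<subseteq> M \<Longrightarrow> dg L = dg M \<Longrightarrow> L = M"
  unfolding is_lattice_def by (metis dg_app_std std_incl(3))

lemma dg_strict: "is_lattice L \<Longrightarrow> is_lattice M \<Longrightarrow> L \<subset> M \<Longrightarrow> dg M < dg L"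
  using dg_mono[of L M] dg_eqD[of L M] by fastforce

lemma is_lattice_app: "invertible g \<Longrightarrow> is_lattice L \<Longrightarrow> is_lattice (app g L)"
  unfolding is_lattice_def by (metis app_app invertible_mult)

lemma dg_app: "invertible g \<Longrightarrow> is_lattice L \<Longrightarrow> dg (app g L) = vdet g + dg L"
  unfolding is_lattice_def by (metis app_app invertible_mult dg_app_std vdet_mult)

section \<open>Diagonal lattices, shifts and homothety classes\<close>

definition dmat :: "(3 \<Rightarrow> int) \<Rightarrow> 'k::field fls ^ 3 ^ 3" where
  "dmat m = (\<chi> i j. if i = j then pw (m i) else 0)"

lemma dmat_mult: "dmat m *v x = (\<chi> i. pw (m i) * x $ i)"
  by (simp add: dmat_def matrix_vector_mult_def vec_eq_iff if_distrib [of "\<lambda>z. z * _"] cong: if_cong)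

lemma det_dmat: "det (dmat m :: 'k::field fls ^ 3 ^ 3) = pw (m 1 + m 2 + m 3)"
  by (simp add: det_3 dmat_def pw_mult_pw)

lemma invertible_dmat: "invertible (dmat m)"
  by (simp add: invertible_det_nz det_dmat)

lemma vdet_dmat: "vdet (dmat m) = m 1 + m 2 + m 3"
  by (simp add: vdet_def det_dmat)

lemma box_eq_dmat: "app (dmat n) (box m) = box (\<lambda>i. m i + n i)"
proof (intro equalityI subsetI)
  fix x assume x: "x \<in> box (\<lambda>i. m i + n i)"
  have "x = dmat n *v (\<chi> i. pw (- n i) * x $ i)" by (simp add: dmat_mult vec_eq_iff)
  moreover have "(\<chi> i. pw (- n i) * x $ i) \<in> box m" using x by (simp add: box_def)
  ultimately show "x \<in> app (dmat n) (box m)" by blast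
qed (auto simp: box_def dmat_mult)

lemma box_eq_std: "box m = app (dmat m) std_lattice"
  by (simp add: std_eq_box box_eq_dmat)

lemma is_lattice_box: "is_lattice (box m)"
  unfolding is_lattice_def using box_eq_std invertible_dmat by blast

lemma dg_box: "dg (box m :: 'k::field bt_lattice) = m 1 + m 2 + m 3"
  by (metis box_eq_std invertible_dmat dg_app_std vdet_dmat)

definition shl :: "int \<Rightarrow> 'k::field bt_lattice \<Rightarrow> 'k bt_lattice" where
  "shl k L = scale_lat (pw k) L"

lemma shl_conv_app: "shl k L = app (dmat (\<lambda>_. k)) L"
proof -
  have "(pw k *s x) = dmat (\<lambda>_. k) *v x" for x :: "'a fls ^ 3"
    by (simp add: dmat_mult vec_eq_iff)
  then show ?thesis by (simp add: shl_def scale_lat_def)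
qed

lemma scale_X: "scale_lat fls_X L = shl 1 L"
  by (simp add: shl_def pw_def fls_X_conv_shift_1)

lemma shl_app: "shl k (app g L) = app g (shl k L)"
  by (simp add: shl_def scale_lat_def image_image matrix_vector_mult_scaleR vector_scalar_commute)

lemma shl_shl: "shl a (shl b L) = shl (a + b) L"
  by (simp add: shl_def scale_lat_def image_image vector_smult_assoc pw_mult_pw)

lemma shl_0 [simp]: "shl 0 L = L"
  by (simp add: shl_def scale_lat_def)

lemma shl_box: "shl k (box m) = box (\<lambda>i. m i + k)"
  by (simp add: shl_conv_app box_eq_dmat)

lemma is_lattice_shl: "is_lattice L \<Longrightarrow> is_lattice (shl k L)"
  by (simp add: shl_conv_app is_lattice_app invertible_dmat)

lemma dg_shl: "is_lattice L \<Longrightarrow> dg (shl k L) = dg L + 3 * k"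
  by (simp add: shl_conv_app dg_app invertible_dmat vdet_dmat)

lemma shl_mono_iff: "shl k L \<subseteq> shl k M \<longleftrightarrow> L \<subseteq> M"
  by (simp add: shl_conv_app app_mono_iff invertible_dmat)

lemma shl_eq_iff: "shl k L = shl k M \<longleftrightarrow> L = M"
  by (simp add: shl_conv_app app_eq_iff invertible_dmat)

lemma shl_psubset_iff: "shl k L \<subset> shl k M \<longleftrightarrow> L \<subset> M"
  by (simp add: psubset_eq shl_mono_iff shl_eq_iff)

lemma lattice_scale: "is_lattice L \<Longrightarrow> vge 0 a \<Longrightarrow> x \<in> L \<Longrightarrow> a *s x \<in> L"
  unfolding is_lattice_def
  by (auto simp: vector_scalar_commute[symmetric] std_eq_box box_def intro!: imageI vge_mult0)

lemma lattice_add: "is_lattice L \<Longrightarrow> x \<in> L \<Longrightarrow> y \<in> L \<Longrightarrow> x + y \<in> L"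
  unfolding is_lattice_def
  by (auto simp: matrix_vector_right_distrib[symmetric] std_eq_box box_def intro!: imageI vge_add)

text \<open>A nonzero scalar is a power of pi times a unit of O_inf, and units preserve every
  lattice. A homothety class is therefore a single orbit of integer shifts.\<close>

lemma scale_lat_shl:
  assumes L: "is_lattice L" and c: "c \<noteq> 0"
  shows "scale_lat c L = shl (fls_subdegree c) L"
proof -
  let ?d = "fls_subdegree c"
  define u where "u = pw (- ?d) * c"
  have u0: "u \<noteq> 0" using c by (simp add: u_def)
  have cu: "c = pw ?d * u" by (simp add: u_def)
  have sd: "fls_subdegree u = 0"
    using c by (simp add: u_def pw_nonzero)
  have v: "vge 0 u" "vge 0 (inverse u)"
    using sd by (auto simp: vge_iff_subdegree)
  have "scale_lat u L = L"
  proof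
    show "scale_lat u L \<subseteq> L" using lattice_scale[OF L v(1)] by (auto simp: scale_lat_def)
    show "L \<subseteq> scale_lat u L"
    proof
      fix x assume "x \<in> L"
      then have "inverse u *s x \<in> L" using lattice_scale[OF L v(2)] by blast
      moreover have "x = u *s (inverse u *s x)" using u0 by (simp add: vector_smult_assoc)
      ultimately show "x \<in> scale_lat u L" unfolding scale_lat_def by (metis image_eqI)
    qed
  qed
  moreover have "scale_lat c L = shl ?d (scale_lat u L)"
    by (subst cu) (simp add: shl_def scale_lat_def image_image vector_smult_assoc)
  ultimately show ?thesis by simp
qed

lemma hcls_eq: 
  assumes "is_lattice L" shows "hcls L = range (\<lambda>k. shl k L)"
proof -
  have "shl k L \<in> hcls L" for k by (auto simp: hcls_def shl_def intro!: exI[of _ "pw k"])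
  then show ?thesis using scale_lat_shl[OF assms] by (auto simp: hcls_def)
qed

lemma hcls_eq_iff:
  assumes "is_lattice L" "is_lattice M"
  shows "hcls L = hcls M \<longleftrightarrow> (\<exists>k. M = shl k L)"
proof
  assume "hcls L = hcls M"
  moreover have "M \<in> hcls M" using hcls_eq[OF assms(2)] by (metis rangeI shl_0)
  ultimately show "\<exists>k. M = shl k L" using hcls_eq[OF assms(1)] by (metis rangeE)
next
  assume "\<exists>k. M = shl k L"
  then obtain k where k: "M = shl k L" by blast
  have "range (\<lambda>j. shl j M) = range (\<lambda>j. shl j L)"
  proof -
    have "shl j M = shl (j + k) L" for j using k by (simp add: shl_shl)
    moreover have "shl j L = shl (j - k) M" for j using k by (simp add: shl_shl)
    ultimately show ?thesis by (metis (no_types, lifting) image_cong rangeI image_subset_iff subset_antisym)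
  qed
  then show "hcls L = hcls M" using hcls_eq assms by metis
qed

lemma hcls_shl: "is_lattice L \<Longrightarrow> hcls (shl k L) = hcls L"
  using hcls_eq_iff[of L "shl k L"] is_lattice_shl by metis

section \<open>Bases adapted to chains of lattices\<close>

text \<open>As \<open>t = \<pi>\<^sup>-\<^sup>1\<close> and a Laurent series has finitely many negative exponents, this is the image of
  \<open>F\<^sub>q[t]\<close>.\<close>
definition AA :: "'k::field fls set" where
  "AA = {x. \<forall>k>0. x $$ k = 0}"

lemma AA_add: "x \<in> AA \<Longrightarrow> y \<in> AA \<Longrightarrow> x + y \<in> AA"
  by (simp add: AA_def)

lemma AA_diff: "x \<in> AA \<Longrightarrow> y \<in> AA \<Longrightarrow> x - y \<in> AA"
  by (simp add: AA_def)

lemma AA_0 [simp]: "0 \<in> AA" and AA_1 [simp]: "1 \<in> AA"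
  by (simp_all add: AA_def)

lemma AA_mult:
  assumes "x \<in> AA" "y \<in> AA"
  shows "x * y \<in> AA"
proof -
  have "(x * y) $$ k = 0" if "k > 0" for k
  proof -
    have "x $$ i * y $$ (k - i) = 0" for i
      using assms that by (cases "i > 0") (auto simp: AA_def)
    then show ?thesis by (subst fls_times_nth(2)) (rule sum.neutral, blast)
  qed
  then show ?thesis by (simp add: AA_def)
qed

lemma AA_sum: "(\<And>i. i \<in> S \<Longrightarrow> f i \<in> AA) \<Longrightarrow> sum f S \<in> AA"
  by (induction S rule: infinite_finite_induct) (auto intro: AA_add)

text \<open>A polynomial in t has no term of positive exponent in pi, so it meets the maximal ideal
  of O_inf only in 0. Both \<open>AA_subdegree\<close> and the triangularity in
  \<open>lat_dominant_increment\<close> rest on this.\<close>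

lemma AA_vge: "x \<in> AA \<Longrightarrow> vge 1 x \<Longrightarrow> x = 0"
proof (rule fls_eqI)
  fix k assume "x \<in> AA" "vge 1 x"
  then show "x $$ k = 0 $$ k" by (cases "k > 0") (auto simp: AA_def vge_def)
qed

lemma AA_subdegree: "x \<in> AA \<Longrightarrow> x \<noteq> 0 \<Longrightarrow> fls_subdegree x \<le> 0"
  using AA_vge[of x] by (force simp: vge_iff_subdegree)

lemma AA_monom: "n \<le> 0 \<Longrightarrow> fls_const a * pw n \<in> AA"
  by (auto simp: AA_def pw_def)

definition GA :: "('k::field fls ^ 3 ^ 3) set" where
  "GA = {g. invertible g \<and> (\<forall>i j. g $ i $ j \<in> AA) \<and> (\<forall>i j. matrix_inv g $ i $ j \<in> AA)}"

lemma GA_invertible: "g \<in> GA \<Longrightarrow> invertible g"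
  by (simp add: GA_def)

lemma GA_I:
  assumes "g ** h = mat 1" "\<And>i j. g $ i $ j \<in> AA" "\<And>i j. h $ i $ j \<in> AA"
  shows "g \<in> GA"
  unfolding GA_def using assms matrix_inv_unique[OF assms(1)] invertible_right_inverse[of g] by blast

lemma AA_matmul: "(\<And>i j. g $ i $ j \<in> AA) \<Longrightarrow> (\<And>i j. h $ i $ j \<in> AA) \<Longrightarrow> (g ** h) $ i $ j \<in> AA"
  by (auto simp: matrix_matrix_mult_def intro!: AA_sum AA_mult)

lemma GA_one: "mat 1 \<in> GA"
  by (rule GA_I[of _ "mat 1"], simp) (auto simp: mat_def)

lemma GA_inv: "g \<in> GA \<Longrightarrow> matrix_inv g \<in> GA"
  by (rule GA_I[of _ g]) (auto simp: GA_def invertible_inv)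

lemma GA_mult:
  assumes "g \<in> GA" "h \<in> GA"
  shows "g ** h \<in> GA"
proof (rule GA_I)
  have "(g ** h) ** (matrix_inv h ** matrix_inv g) = g ** (h ** matrix_inv h) ** matrix_inv g"
    by (simp add: matrix_mul_assoc)
  then show "(g ** h) ** (matrix_inv h ** matrix_inv g) = mat 1"
    using assms by (simp add: GA_invertible invertible_inv)
qed (use assms in \<open>auto simp: GA_def intro!: AA_matmul\<close>)

text \<open>The determinants of a matrix and of its inverse are nonzero polynomials in t, so both
  valuations are at most 0, while their sum is 0. Hence \<open>GA\<close> preserves
  colengths.\<close>

lemma GA_vdet: assumes "g \<in> GA" shows "vdet g = 0"
proof -
  have *: "vdet h \<le> 0" if "h \<in> GA" for h :: "'a fls ^ 3 ^ 3"
  proof -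
    have "det h \<in> AA" using that by (auto simp: det_3 GA_def intro!: AA_add AA_diff AA_mult)
    then show ?thesis using AA_subdegree GA_invertible[OF that] by (auto simp: vdet_def invertible_det_nz)
  qed
  from *[OF assms] *[OF GA_inv[OF assms]] show ?thesis
    using vdet_inv[OF GA_invertible[OF assms]] by simp
qed

text \<open>The lattice spanned by the columns of \<open>g\<close>, a basis of A^3, scaled by the
  powers pi^(m i). It corresponds to a split vector bundle on the projective line, and
  \<open>m\<close> to its splitting type.\<close>

definition lat :: "'k::field fls ^ 3 ^ 3 \<Rightarrow> (3 \<Rightarrow> int) \<Rightarrow> 'k bt_lattice" where
  "lat g m = app g (box m)"

lemma is_lattice_lat: "g \<in> GA \<Longrightarrow> is_lattice (lat g m)"
  by (simp add: lat_def is_lattice_app is_lattice_box GA_invertible)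

lemma dg_lat: "g \<in> GA \<Longrightarrow> dg (lat g m) = m 1 + m 2 + m 3"
  by (simp add: lat_def dg_app is_lattice_box GA_invertible GA_vdet dg_box)

lemma shl_lat: "shl k (lat g m) = lat g (\<lambda>i. m i + k)"
  by (simp add: lat_def shl_app shl_box)

lemma sum_fun_upd_3: "(m(p := m p + 1)) 1 + (m(p := m p + 1)) 2 + (m(p := m p + 1)) (3::3) = m 1 + m 2 + m 3 + (1::int)"
  using exhaust_3[of p] by auto

lemma dg_lat_upd: "g \<in> GA \<Longrightarrow> dg (lat g (m(p := m p + 1))) = dg (lat g m) + 1"
  using sum_fun_upd_3[of m p] by (simp add: dg_lat)

section \<open>Elementary base changes and sublattices of colength one\<close>

definition elem :: "3 \<Rightarrow> (3 \<Rightarrow> 'k::field fls) \<Rightarrow> 'k fls ^ 3 ^ 3" where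
  "elem p c = (\<chi> i j. if i = j then 1 else if i = p then c j else 0)"

lemma elem_mult: "elem p c *v x = (\<chi> i. if i = p then x $ p + (\<Sum>j\<in>UNIV - {p}. c j * x $ j) else x $ i)"
proof -
  have "(elem p c *v x) $ i = (if i = p then x $ p + (\<Sum>j\<in>UNIV - {p}. c j * x $ j) else x $ i)" for i
  proof (cases "i = p")
    case True
    have "(elem p c *v x) $ i = (\<Sum>j\<in>UNIV. (if p = j then 1 else c j) * x $ j)"
      unfolding True elem_def matrix_vector_mult_def by (auto intro!: sum.cong)
    also have "\<dots> = x $ p + (\<Sum>j\<in>UNIV - {p}. (if p = j then 1 else c j) * x $ j)"
      by (subst sum.remove[of _ p]) auto
    also have "(\<Sum>j\<in>UNIV - {p}. (if p = j then 1 else c j) * x $ j) = (\<Sum>j\<in>UNIV - {p}. c j * x $ j)"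
      by (rule sum.cong) auto
    finally show ?thesis using True by simp
  next
    case False
    have "(elem p c *v x) $ i = (\<Sum>j\<in>UNIV. (if i = j then 1 else 0) * x $ j)"
      using False unfolding elem_def matrix_vector_mult_def by (auto intro!: sum.cong)
    then show ?thesis using False by (simp add: if_distrib[of "\<lambda>z. z * _"] cong: if_cong)
  qed
  then show ?thesis by (simp add: vec_eq_iff)
qed

lemma elem_inverse: "elem p c ** elem p (\<lambda>j. - c j) = mat 1"
proof -
  have "elem p c *v (elem p (\<lambda>j. - c j) *v x) = x" for x
    unfolding elem_mult by (simp add: vec_eq_iff sum_negf)
  then show ?thesis by (simp add: matrix_eq matrix_vector_mul_assoc)
qed

lemma elem_inverse': "elem p (\<lambda>j. - c j) ** elem p c = mat 1"
  using elem_inverse[of p "\<lambda>j. - c j"] by simp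

lemma AA_uminus: "- x \<in> AA \<longleftrightarrow> x \<in> AA"
  by (simp add: AA_def)

lemma elem_GA: "(\<And>j. c j \<in> AA) \<Longrightarrow> elem p c \<in> GA"
  by (rule GA_I[OF elem_inverse]) (auto simp: elem_def AA_uminus)

lemma elem_box:
  assumes "\<And>j. j \<noteq> p \<Longrightarrow> vge (m p - m j) (c j)"
  shows "app (elem p c) (box m) = box m"
proof -
  have sub: "app (elem p c) (box m) \<subseteq> box m" if c: "\<And>j. j \<noteq> p \<Longrightarrow> vge (m p - m j) (c j)" for c :: "3 \<Rightarrow> 'a fls"
  proof (clarsimp simp: box_def elem_mult)
    fix x :: "'a fls ^ 3" assume x: "\<forall>i. vge (m i) (x $ i)"
    have "vge (m p) (c j * x $ j)" if "j \<noteq> p" for j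
      using vge_mult[OF c[OF that] x[rule_format, of j]] by simp
    then show "vge (m p) (x $ p + (\<Sum>j\<in>UNIV - {p}. c j * x $ j))"
      using x by (auto intro!: vge_add vge_sum)
  qed
  have "app (elem p (\<lambda>j. - c j)) (box m) \<subseteq> box m" using assms by (intro sub) simp
  then have "app (elem p c) (app (elem p (\<lambda>j. - c j)) (box m)) \<subseteq> app (elem p c) (box m)" by blast
  then show ?thesis using sub[OF assms] by (simp add: app_app elem_inverse)
qed

text \<open>Preimage of the hyperplane with normal vector \<open>a\<close> under reduction of
  \<open>box m\<close> modulo pi; the coefficient of exponent \<open>m j\<close> is the class of
  coordinate j.\<close>

definition hyp :: "(3 \<Rightarrow> int) \<Rightarrow> 'k::field ^ 3 \<Rightarrow> ('k fls ^ 3) set" where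
  "hyp m a = {x \<in> box m. (\<Sum>j\<in>UNIV. a $ j * (x $ j $$ m j)) = 0}"

lemma dmat_hyp: "app (dmat m) (hyp (\<lambda>_. 0) a) = hyp m a"
proof (intro equalityI subsetI)
  fix x assume x: "x \<in> hyp m a"
  have "x = dmat m *v (\<chi> i. pw (- m i) * x $ i)" by (simp add: dmat_mult vec_eq_iff)
  moreover have "(\<chi> i. pw (- m i) * x $ i) \<in> hyp (\<lambda>_. 0) a" using x by (simp add: hyp_def box_def)
  ultimately show "x \<in> app (dmat m) (hyp (\<lambda>_. 0) a)" by blast
qed (auto simp: hyp_def box_def dmat_mult)

lemma det_nth0:
  assumes "imat k"
  shows "det (\<chi> i j. k $ i $ j $$ 0) = det k $$ 0"
proof -
  have v: "vge 0 (k $ i $ j)" for i j using assms by (simp add: imat_def)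
  have v2: "vge 0 (k $ i $ j * k $ i' $ j')" for i j i' j' using v by (simp add: vge_mult0)
  show ?thesis by (simp add: det_3 vge0_mult_nth0 v v2)
qed

lemma nth_sum: "(sum f S :: 'k::field fls) $$ n = (\<Sum>i\<in>S. f i $$ n)"
  by (induction S rule: infinite_finite_induct) auto

text \<open>The transition matrix of a proper sublattice has determinant divisible by pi, so its
  reduction is singular. A kernel vector of the transposed reduction is a linear form that kills the
  image modulo pi.\<close>

lemma proper_sublattice_std_hyp:
  fixes N :: "'k::field bt_lattice"
  assumes N: "is_lattice N" and sub: "N \<subset> std_lattice"
  shows "\<exists>a. a \<noteq> 0 \<and> N \<subseteq> hyp (\<lambda>_. 0) a"
proof -
  obtain k :: "'k fls ^ 3 ^ 3" where k: "invertible k" "N = app k std_lattice" using N is_lattice_def by blast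
  have im: "imat k" using sub k imat_iff by blast
  have "dg N > 0" using dg_strict[OF N _ sub] is_lattice_box[of "\<lambda>_. 0"] dg_box[of "\<lambda>_. 0", where 'k = 'k]
    by (simp add: std_eq_box)
  then have "vdet k > 0" using dg_app_std k by metis
  then have "det k $$ 0 = 0" by (simp add: vdet_def)
  define k0 where "k0 = (\<chi> i j. k $ i $ j $$ 0)"
  have "det (transpose k0) = 0" using det_nth0[OF im] \<open>det k $$ 0 = 0\<close> det_transpose[of k0] unfolding k0_def by simp
  then have "\<not> invertible (transpose k0)" using invertible_det_nz by blast
  then obtain a where a: "transpose k0 *v a = 0" "a \<noteq> 0"
    using matrix_left_invertible_ker invertible_left_inverse by blast
  have "(\<Sum>i\<in>UNIV. a $ i * ((k *v y) $ i $$ 0)) = 0" if y: "y \<in> std_lattice" for y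
  proof -
    have v: "vge 0 (y $ j)" "vge 0 (k $ i $ j)" for i j
      using y im by (auto simp: std_eq_box box_def imat_def)
    have "(\<Sum>i\<in>UNIV. a $ i * ((k *v y) $ i $$ 0)) = (\<Sum>i\<in>UNIV. \<Sum>j\<in>UNIV. a $ i * (k0 $ i $ j * (y $ j $$ 0)))"
      unfolding matrix_vector_mult_def k0_def by (simp add: nth_sum vge0_mult_nth0 v sum_distrib_left)
    also have "\<dots> = (\<Sum>j\<in>UNIV. \<Sum>i\<in>UNIV. a $ i * (k0 $ i $ j * (y $ j $$ 0)))"
      by (rule sum.swap)
    also have "\<dots> = (\<Sum>j\<in>UNIV. (\<Sum>i\<in>UNIV. k0 $ i $ j * a $ i) * (y $ j $$ 0))"
      unfolding sum_distrib_right by (intro sum.cong refl) (simp only: ac_simps)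
    also have "\<dots> = 0"
    proof -
      have "(\<Sum>i\<in>UNIV. k0 $ i $ j * a $ i) = (transpose k0 *v a) $ j" for j
        unfolding matrix_vector_mult_def transpose_def by simp
      then show ?thesis using a(1) by simp
    qed
    finally show ?thesis .
  qed
  moreover have "k *v y \<in> box (\<lambda>_. 0)" if "y \<in> std_lattice" for y
    using imat_app[OF im that] by (simp add: std_eq_box)
  ultimately have "N \<subseteq> hyp (\<lambda>_. 0) a" using k(2) by (auto simp: hyp_def)
  then show ?thesis using a(2) by blast
qed

lemma proper_sublattice_hyp:
  fixes g :: "'k::field fls ^ 3 ^ 3"
  assumes g: "g \<in> GA" and N: "is_lattice N" and sub: "N \<subset> lat g m"
  shows "\<exists>a. a \<noteq> 0 \<and> N \<subseteq> app g (hyp m a)"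
proof -
  let ?G = "g ** dmat m"
  have G: "invertible ?G" using g by (simp add: GA_invertible invertible_mult invertible_dmat)
  have l: "lat g m = app ?G std_lattice" unfolding lat_def box_eq_std[of m] app_app ..
  define N' where "N' = app (matrix_inv ?G) N"
  have N': "app ?G N' = N" unfolding N'_def by (rule app_inv(2)[OF G])
  have "N' \<subset> std_lattice"
    using sub unfolding l N'[symmetric] psubset_eq app_mono_iff[OF G] app_eq_iff[OF G] .
  moreover have "is_lattice N'" unfolding N'_def by (rule is_lattice_app[OF invertible_matrix_inv[OF G] N])
  ultimately obtain a where a: "a \<noteq> 0" "N' \<subseteq> hyp (\<lambda>_. 0) a"
    using proper_sublattice_std_hyp by blast
  have "N \<subseteq> app ?G (hyp (\<lambda>_. 0) a)" using a(2) unfolding N'[symmetric] app_mono_iff[OF G] .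
  moreover have "app ?G (hyp (\<lambda>_. 0) a) = app g (hyp m a)" using app_app[of g "dmat m"] dmat_hyp by metis
  ultimately show ?thesis using a(1) by blast
qed

text \<open>Taking for the pivot \<open>p\<close> an index with \<open>m p\<close> minimal makes the elementary change of basis
  \<open>e\<^sub>j \<mapsto> e\<^sub>j - (a\<^sub>j / a\<^sub>p) t^(m j - m p) e\<^sub>p\<close> polynomial in \<open>t\<close>.\<close>
lemma hyp_adapted_basis:
  fixes g :: "'k::field fls ^ 3 ^ 3"
  assumes g: "g \<in> GA" and a: "a $ p \<noteq> 0" and p: "\<forall>j. a $ j \<noteq> 0 \<longrightarrow> m p \<le> m j"
  shows "\<exists>g'\<in>GA. app g (hyp m a) = lat g' (m(p := m p + 1)) \<and>
    (\<forall>n. (\<forall>j. j \<noteq> p \<longrightarrow> a $ j \<noteq> 0 \<longrightarrow> n j - n p \<ge> m j - m p) \<longrightarrow> lat g' n = lat g n)"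
proof -
  define c :: "3 \<Rightarrow> 'k fls" where "c j = fls_const (a $ j / a $ p) * pw (m p - m j)" for j
  have cA: "c j \<in> AA" for j
    using p[rule_format, of j] by (cases "a $ j = 0") (auto simp: c_def intro!: AA_monom)
  let ?E = "elem p (\<lambda>j. - c j)"
  have EG: "?E \<in> GA" using cA by (intro elem_GA) (simp add: AA_uminus)
  have v: "vge (n p - n j) (c j)" if "j \<noteq> p" "a $ j \<noteq> 0 \<Longrightarrow> n j - n p \<ge> m j - m p" for n j
  proof (cases "a $ j = 0")
    case False
    then have "vge (n p - n j - (m p - m j)) (fls_const (a $ j / a $ p))"
      using that by (intro vge_mono[OF vge_const]) simp
    then show ?thesis by (simp add: c_def mult.commute[of _ "pw _"])
  qed (simp add: c_def)
  let ?m = "m(p := m p + 1)"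
  have "x \<in> hyp m a \<longleftrightarrow> elem p c *v x \<in> box ?m" for x
  proof -
    have cn: "(c j * x $ j) $$ m p = a $ j / a $ p * (x $ j $$ m j)" for j
      by (simp add: c_def mult.assoc)
    \<comment> \<open>Up to the factor \<open>a $ p\<close>, the linear form becomes the leading
      coefficient of coordinate p after the base change; its vanishing raises the exponent there by
      one.\<close>
    have eq: "(x $ p + (\<Sum>j\<in>UNIV - {p}. c j * x $ j)) $$ m p = (\<Sum>j\<in>UNIV. a $ j * (x $ j $$ m j)) / a $ p"
    proof -
      have "(\<Sum>j\<in>UNIV. a $ j * (x $ j $$ m j)) = a $ p * (x $ p $$ m p) + (\<Sum>j\<in>UNIV - {p}. a $ j * (x $ j $$ m j))"
        by (subst sum.remove[of _ p]) auto
      then show ?thesis using a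
        by (simp add: nth_sum cn sum_divide_distrib add_divide_distrib)
    qed
    have bx: "x \<in> box m \<longleftrightarrow> elem p c *v x \<in> box m"
    proof -
      have "app (elem p c) (box m) = box m" using v by (intro elem_box) simp
      moreover have "app ?E (box m) = box m" using v by (intro elem_box) simp
      moreover have "?E *v (elem p c *v x) = x" by (simp add: matrix_vector_mul_assoc elem_inverse')
      ultimately show ?thesis by (metis imageI)
    qed
    have "y \<in> box ?m \<longleftrightarrow> y \<in> box m \<and> y $ p $$ m p = 0" for y :: "'k fls ^ 3"
      by (auto simp: box_def vge_Suc)
    then show ?thesis using bx eq a by (auto simp: hyp_def elem_mult)
  qed
  then have "hyp m a = app ?E (box ?m)"
  proof -
    assume *: "\<And>x. x \<in> hyp m a \<longleftrightarrow> elem p c *v x \<in> box ?m"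
    show ?thesis
    proof (intro equalityI subsetI)
      fix x assume "x \<in> hyp m a"
      moreover have "x = ?E *v (elem p c *v x)" by (simp add: matrix_vector_mul_assoc elem_inverse')
      ultimately show "x \<in> app ?E (box ?m)" using * by blast
    next
      fix x assume "x \<in> app ?E (box ?m)"
      then obtain y where y: "y \<in> box ?m" "x = ?E *v y" by blast
      have "elem p c *v x = y" unfolding y(2) matrix_vector_mul_assoc elem_inverse by simp
      then show "x \<in> hyp m a" using * y(1) by simp
    qed
  qed
  then have 1: "app g (hyp m a) = lat (g ** ?E) ?m" by (simp add: lat_def app_app)
  \<comment> \<open>\<open>c j\<close> has valuation \<open>m p - m j\<close> whenever
    \<open>a $ j\<close> is nonzero, so the gap condition on \<open>n\<close> says that the base
    change preserves \<open>box n\<close>. This keeps the lattices already adapted while a further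
    one is being adapted.\<close>
  have 2: "lat (g ** ?E) n = lat g n" if "\<And>j. j \<noteq> p \<Longrightarrow> a $ j \<noteq> 0 \<Longrightarrow> n j - n p \<ge> m j - m p" for n
  proof -
    have "app ?E (box n) = box n" using v that by (intro elem_box) simp
    then show ?thesis by (simp add: lat_def app_app[symmetric])
  qed
  show ?thesis
    by (rule bexI[OF _ GA_mult[OF g EG]]) (simp add: 1 2)
qed

lemma ex_minimal_pivot:
  fixes a :: "'k::field ^ 3" and m :: "3 \<Rightarrow> int"
  assumes "a \<noteq> 0"
  shows "\<exists>p. a $ p \<noteq> 0 \<and> (\<forall>j. a $ j \<noteq> 0 \<longrightarrow> m p \<le> m j)"
proof -
  let ?S = "{j. a $ j \<noteq> 0}"
  have "?S \<noteq> {}" using assms by (auto simp: vec_eq_iff)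
  then have "Min (m ` ?S) \<in> m ` ?S" by (intro Min_in) auto
  then obtain p where p: "p \<in> ?S" "m p = Min (m ` ?S)" by auto
  have "m p \<le> m j" if "a $ j \<noteq> 0" for j
    unfolding p(2) by (rule Min_le) (use that in auto)
  then show ?thesis using p(1) by blast
qed

lemma hyp_lattice:
  fixes g :: "'k::field fls ^ 3 ^ 3"
  assumes "g \<in> GA" "a \<noteq> 0"
  shows "is_lattice (app g (hyp m a))" "dg (app g (hyp m a)) = dg (lat g m) + 1"
proof -
  obtain p where p: "a $ p \<noteq> 0" "\<forall>j. a $ j \<noteq> 0 \<longrightarrow> m p \<le> m j" using ex_minimal_pivot[OF assms(2), of m] by blast
  obtain g' where g': "g' \<in> GA" "app g (hyp m a) = lat g' (m(p := m p + 1))"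
    using hyp_adapted_basis[OF assms(1) p] by blast
  show "is_lattice (app g (hyp m a))" using g' is_lattice_lat by metis
  show "dg (app g (hyp m a)) = dg (lat g m) + 1"
    using g' dg_lat_upd[OF g'(1), of m p] dg_lat[OF g'(1)] dg_lat[OF assms(1)] by metis
qed

lemma lattice_bound:
  fixes L :: "'k::field bt_lattice"
  assumes "is_lattice L"
  shows "\<exists>n. L \<subseteq> box (\<lambda>_. n)"
proof -
  obtain h :: "'k fls ^ 3 ^ 3" where h: "L = app h std_lattice" using assms is_lattice_def by blast
  define n where "n = Min ((\<lambda>(i,j). fls_subdegree (h $ i $ j)) ` UNIV)"
  have "n \<le> fls_subdegree (h $ i $ j)" for i j
    unfolding n_def by (rule Min_le) (auto intro!: image_eqI[of _ _ "(i,j)"])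
  then have v: "vge n (h $ i $ j)" for i j by (simp add: vge_iff_subdegree)
  have "vge n (h $ i $ j * x $ j)" if "x \<in> std_lattice" for x i j
    using vge_mult[OF v, of 0 "x $ j" i j] that by (simp add: std_eq_box box_def)
  then have "h *v x \<in> box (\<lambda>_. n)" if "x \<in> std_lattice" for x
    using that by (auto simp: box_def matrix_vector_mult_def intro!: vge_sum)
  then show ?thesis using h by blast
qed

text \<open>This is the splitting theorem of Birkhoff and Grothendieck in lattice form. From a large
  diagonal lattice containing \<open>L\<close> one descends through hyperplane sublattices that
  still contain \<open>L\<close>; each raises one exponent, until the colengths agree.\<close>

lemma lattice_eq_lat:
  fixes L :: "'k::field bt_lattice"
  assumes L: "is_lattice L"
  shows "\<exists>g\<in>GA. \<exists>m. L = lat g m"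
proof -
  have main: "\<exists>g\<in>GA. \<exists>m. L = lat g m" if "g \<in> GA" "L \<subseteq> lat g m" "nat (dg L - dg (lat g m)) = n" for g m n
    using that
  proof (induction n arbitrary: g m)
    case 0
    then have "dg L = dg (lat g m)" using dg_mono[OF L is_lattice_lat[OF 0(1)] 0(2)] by simp
    then have "L = lat g m" by (rule dg_eqD[OF L is_lattice_lat[OF 0(1)] 0(2)])
    then show ?case using 0(1) by (intro bexI exI)
  next
    case (Suc n)
    then have "L \<noteq> lat g m" by auto
    then have "L \<subset> lat g m" using Suc.prems(2) by blast
    then obtain a where a: "a \<noteq> 0" "L \<subseteq> app g (hyp m a)" using proper_sublattice_hyp[OF Suc.prems(1) L] by metis
    obtain p where p: "a $ p \<noteq> 0" "\<forall>j. a $ j \<noteq> 0 \<longrightarrow> m p \<le> m j" using ex_minimal_pivot[OF a(1), of m] by blast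
    obtain g' where g': "g' \<in> GA" "app g (hyp m a) = lat g' (m(p := m p + 1))"
      using hyp_adapted_basis[OF Suc(2) p] by blast
    have "dg (lat g' (m(p := m p + 1))) = dg (lat g m) + 1" using hyp_lattice(2)[OF Suc(2) a(1)] g' by metis
    then have "nat (dg L - dg (lat g' (m(p := m p + 1)))) = n" using Suc.prems(3) by simp
    moreover have "L \<subseteq> lat g' (m(p := m p + 1))" using a(2) g'(2) by metis
    ultimately show ?case by (intro Suc.IH[OF g'(1)])
  qed
  obtain n where "L \<subseteq> box (\<lambda>_. n)" using lattice_bound[OF L] by blast
  then have "L \<subseteq> lat (mat 1) (\<lambda>_. n)" by (simp add: lat_def)
  then show ?thesis using main[OF GA_one _ refl] by metis
qed

section \<open>Chains, frames and the invariance of types\<close>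

definition chain :: "'k::field bt_lattice \<Rightarrow> 'k bt_lattice \<Rightarrow> 'k bt_lattice \<Rightarrow> bool" where
  "chain L0 L1 L2 \<longleftrightarrow> is_lattice L0 \<and> is_lattice L1 \<and> is_lattice L2 \<and>
     L1 \<subset> L0 \<and> L2 \<subset> L1 \<and> shl 1 L0 \<subset> L2"

text \<open>Three strict inclusions lead from \<open>L0\<close> down to its shift, a total colength
  of 3, so each of them has colength exactly one.\<close>

lemma chain_dg:
  assumes "chain L0 L1 L2"
  shows "dg L1 = dg L0 + 1" "dg L2 = dg L0 + 2"
proof -
  have "dg L0 < dg L1" "dg L1 < dg L2" "dg L2 < dg (shl 1 L0)"
    using assms dg_strict is_lattice_shl by (auto simp: chain_def)
  then show "dg L1 = dg L0 + 1" "dg L2 = dg L0 + 2"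
    using dg_shl[of L0 1] assms by (auto simp: chain_def)
qed

lemma app_axis_mem: "invertible g \<Longrightarrow> g *v x \<in> app g S \<longleftrightarrow> x \<in> S"
  by (metis app_inv(1) image_eqI invertible_inv matrix_vector_mul_assoc matrix_vector_mul_lid)

lemma axis_box: "axis i (pw n) \<in> box m \<longleftrightarrow> m i \<le> n"
  by (auto simp: box_def axis_def vge_iff_subdegree)

lemma axis_hyp:
  assumes "axis i (pw (m i)) \<in> hyp m a" shows "a $ i = 0"
proof -
  have "a $ j * (axis i (pw (m i)) $ j $$ m j) = (if j = i then a $ i else 0)" for j
    by (auto simp: axis_def pw_def)
  then show ?thesis using assms by (simp add: hyp_def)
qed

lemma third_index: "i \<noteq> j \<Longrightarrow> \<exists>k. (UNIV :: 3 set) = {i, j, k}"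
  using exhaust_3[of i] exhaust_3[of j] by (auto simp: UNIV_3)

lemma triple_distinct:
  assumes "(UNIV :: 3 set) = {i, j, k}"
  shows "i \<noteq> j \<and> j \<noteq> k \<and> i \<noteq> k"
proof -
  have "card {i, j, k} = 3" unfolding assms[symmetric] by simp
  moreover have "card {x, y} \<noteq> 3" for x y :: 3 by (simp add: card_insert_if)
  ultimately show ?thesis by (auto simp: insert_commute)
qed

text \<open>An adapted basis of a chain, with the coordinates listed in the order in which their
  exponents are raised along it. The triple \<open>(m i, m j, m k)\<close> is the type of the
  chain.\<close>

definition frame where
  "frame g m i j k L0 L1 L2 \<longleftrightarrow> g \<in> GA \<and> UNIV = {i, j, k} \<and> L0 = lat g m
     \<and> L1 = lat g (m(i := m i + 1)) \<and> L2 = lat g (m(i := m i + 1, j := m j + 1))"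

lemma codim1_hyp:
  assumes g: "g \<in> GA" and M: "is_lattice M" "M \<subset> lat g m" "dg M = dg (lat g m) + 1"
  shows "\<exists>a. a \<noteq> 0 \<and> M = app g (hyp m a)"
proof -
  obtain a where a: "a \<noteq> 0" "M \<subseteq> app g (hyp m a)" using proper_sublattice_hyp[OF g M(1,2)] by blast
  have "M = app g (hyp m a)"
    using dg_eqD[OF M(1) hyp_lattice(1)[OF g a(1)] a(2)] hyp_lattice(2)[OF g a(1)] M(3) by metis
  then show ?thesis using a(1) by blast
qed

lemma finite_codim1:
  fixes L :: "'k::{field,finite} bt_lattice"
  assumes "is_lattice L"
  shows "finite {M. is_lattice M \<and> M \<subset> L \<and> dg M = dg L + 1}"
proof -
  obtain g m where g: "g \<in> GA" "L = lat g m" using lattice_eq_lat[OF assms] by blast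
  have "{M. is_lattice M \<and> M \<subset> L \<and> dg M = dg L + 1} \<subseteq> range (\<lambda>a. app g (hyp m a))"
  proof
    fix M assume "M \<in> {M. is_lattice M \<and> M \<subset> L \<and> dg M = dg L + 1}"
    then obtain a where "M = app g (hyp m a)" using codim1_hyp[OF g(1), of M m] g(2) by auto
    then show "M \<in> range (\<lambda>a. app g (hyp m a))" by (rule range_eqI)
  qed
  then show ?thesis by (rule finite_subset) simp
qed

text \<open>Two hyperplane steps. The second linear form vanishes at coordinate i because the shift
  of \<open>L0\<close> lies in \<open>L2\<close>, so the second base change disturbs neither
  \<open>L0\<close> nor \<open>L1\<close>. The exponents \<open>m\<close> of \<open>L0\<close>
  survive, which allows all chains starting at \<open>L0\<close> to be compared by the order of the
  indices alone.\<close>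

lemma frame_exists:
  fixes g :: "'k::field fls ^ 3 ^ 3"
  assumes g: "g \<in> GA" and ch: "chain (lat g m) L1 L2"
  shows "\<exists>g' i j k. frame g' m i j k (lat g m) L1 L2"
proof -
  note c = ch[unfolded chain_def]
  obtain a where a: "a \<noteq> 0" and L1: "L1 = app g (hyp m a)"
    using codim1_hyp[OF g, of L1 m] c chain_dg[OF ch] by auto
  obtain i where i: "a $ i \<noteq> 0" "\<forall>j. a $ j \<noteq> 0 \<longrightarrow> m i \<le> m j" using ex_minimal_pivot[OF a, of m] by blast
  let ?m1 = "m(i := m i + 1)"
  obtain g1 where g1: "g1 \<in> GA" "app g (hyp m a) = lat g1 ?m1"
    "\<forall>n. (\<forall>j. j \<noteq> i \<longrightarrow> a $ j \<noteq> 0 \<longrightarrow> n j - n i \<ge> m j - m i) \<longrightarrow> lat g1 n = lat g n" using hyp_adapted_basis[OF g i] by blast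
  have L0: "lat g1 m = lat g m" using g1(3) by simp
  obtain b where b: "b \<noteq> 0" and L2: "L2 = app g1 (hyp ?m1 b)"
    using codim1_hyp[OF g1(1), of L2 ?m1] c chain_dg[OF ch] L1 g1(2) by auto
  have "g1 *v axis i (pw (m i + 1)) \<in> shl 1 (lat g m)"
    unfolding L0[symmetric] shl_lat by (simp add: lat_def axis_box)
  then have "g1 *v axis i (pw (m i + 1)) \<in> app g1 (hyp ?m1 b)" using c L2 by blast
  then have "axis i (pw (?m1 i)) \<in> hyp ?m1 b" using app_axis_mem[OF GA_invertible[OF g1(1)]] by simp
  then have bi: "b $ i = 0" by (rule axis_hyp)
  obtain j where j: "b $ j \<noteq> 0" "\<forall>l. b $ l \<noteq> 0 \<longrightarrow> ?m1 j \<le> ?m1 l" using ex_minimal_pivot[OF b, of ?m1] by blast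
  have ij: "i \<noteq> j" using bi j(1) by auto
  obtain g2 where g2: "g2 \<in> GA" "app g1 (hyp ?m1 b) = lat g2 (?m1(j := ?m1 j + 1))"
    "\<forall>n. (\<forall>l. l \<noteq> j \<longrightarrow> b $ l \<noteq> 0 \<longrightarrow> n l - n j \<ge> ?m1 l - ?m1 j) \<longrightarrow> lat g2 n = lat g1 n" using hyp_adapted_basis[OF g1(1) j] by blast
  have "lat g2 ?m1 = lat g1 ?m1" using g2(3) by simp
  moreover have "lat g2 m = lat g1 m" using bi ij by (intro g2(3)[rule_format]) auto
  moreover have "(?m1(j := ?m1 j + 1)) = m(i := m i + 1, j := m j + 1)" using ij by auto
  moreover obtain k where "(UNIV :: 3 set) = {i, j, k}" using third_index[OF ij] by blast
  ultimately show ?thesis unfolding frame_def using g2(1,2) L0 L1 L2 g1(2) by metis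
qed

text \<open>The form \<open>a\<close> cutting out \<open>M\<close> in \<open>L0\<close> vanishes at
  k, as \<open>L2\<close> contains the k-th generator of \<open>L0\<close>. If it vanished at j too,
  \<open>M\<close> would be \<open>L1\<close>. So j can serve as pivot, by
  \<open>m j \<le> m i\<close>, and \<open>M\<close> receives the type with the first two entries
  exchanged.\<close>

lemma frame_neighbour:
  fixes g :: "'k::field fls ^ 3 ^ 3"
  assumes f: "frame g m i j k L0 L1 L2" and M: "chain L0 M L2" "M \<noteq> L1" and le: "m j \<le> m i"
  shows "\<exists>g'. frame g' m j i k L0 M L2"
proof -
  note f' = f[unfolded frame_def] and c = M(1)[unfolded chain_def]
  have g: "g \<in> GA" using f' by blast
  have ne: "i \<noteq> j" "j \<noteq> k" "i \<noteq> k" using triple_distinct f' by blast+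
  obtain a where a: "a \<noteq> 0" and Me: "M = app g (hyp m a)"
    using codim1_hyp[OF g, of M m] c chain_dg[OF M(1)] f' by auto
  have "g *v axis k (pw (m k)) \<in> L2" using f' ne by (auto simp: lat_def axis_box)
  then have "g *v axis k (pw (m k)) \<in> app g (hyp m a)" using c Me by blast
  then have "axis k (pw (m k)) \<in> hyp m a" unfolding app_axis_mem[OF GA_invertible[OF g]] .
  then have ak: "a $ k = 0" by (rule axis_hyp)
  have ex: "l = i \<or> l = j \<or> l = k" for l using f' by blast
  have aj: "a $ j \<noteq> 0"
  proof
    assume aj: "a $ j = 0"
    then have ai: "a $ i \<noteq> 0" using a ak ex by (auto simp: vec_eq_iff) metis
    have o: "a $ l \<noteq> 0 \<Longrightarrow> l = i" for l using ak aj ex by metis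
    have "\<forall>l. a $ l \<noteq> 0 \<longrightarrow> m i \<le> m l" using o by auto
    note st = hyp_adapted_basis[OF g ai this]
    obtain g1 where g1: "g1 \<in> GA" "app g (hyp m a) = lat g1 (m(i := m i + 1))"
      "\<forall>n. (\<forall>j. j \<noteq> i \<longrightarrow> a $ j \<noteq> 0 \<longrightarrow> n j - n i \<ge> m j - m i) \<longrightarrow> lat g1 n = lat g n" using st by blast
    have "lat g1 (m(i := m i + 1)) = lat g (m(i := m i + 1))" using g1(3) o by blast
    then show False using Me M(2) f' g1(2) by simp
  qed
  have "\<forall>l. a $ l \<noteq> 0 \<longrightarrow> m j \<le> m l" using ex ak le by (metis order_refl)
  note st = hyp_adapted_basis[OF g aj this]
  obtain g1 where g1: "g1 \<in> GA" "app g (hyp m a) = lat g1 (m(j := m j + 1))"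
    "\<forall>n. (\<forall>l. l \<noteq> j \<longrightarrow> a $ l \<noteq> 0 \<longrightarrow> n l - n j \<ge> m l - m j) \<longrightarrow> lat g1 n = lat g n" using st by blast
  have "lat g1 m = lat g m" using g1(3) by simp
  moreover have "lat g1 (m(i := m i + 1, j := m j + 1)) = lat g (m(i := m i + 1, j := m j + 1))"
  proof (rule g1(3)[rule_format])
    fix l assume "l \<noteq> j" "a $ l \<noteq> 0"
    then have "l = i" using ex[of l] ak by auto
    then show "(m(i := m i + 1, j := m j + 1)) l - (m(i := m i + 1, j := m j + 1)) j \<ge> m l - m j"
      using ne by simp
  qed
  moreover have "m(i := m i + 1, j := m j + 1) = m(j := m j + 1, i := m i + 1)" using ne by auto
  moreover have "UNIV = {j, i, k}" using f' by (metis insert_commute)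
  ultimately show ?thesis unfolding frame_def using g1(1,2) f' Me by metis
qed

lemma lat_eq_app:
  assumes "g \<in> GA" "g' \<in> GA"
  shows "lat g m = lat g' m' \<longleftrightarrow> app (matrix_inv g' ** g) (box m) = box m'"
proof -
  have "lat g m = app g' (app (matrix_inv g' ** g) (box m))"
    using assms by (simp add: lat_def app_app matrix_mul_assoc GA_invertible invertible_inv)
  then show ?thesis using app_eq_iff[OF GA_invertible[OF assms(2)]] by (metis lat_def)
qed

text \<open>A nonzero entry of a matrix over \<open>F\<^sub>q[t]\<close> has nonpositive valuation; this makes the type of a chain
  an invariant.\<close>
lemma chain_type_ge:
  assumes g: "g \<in> GA" "g' \<in> GA" and eq: "lat g m = lat g' m'"
    and eq1: "lat g (m(i := m i + 1)) = lat g' (m'(i' := m' i' + 1))"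
  shows "m' i' \<le> m i"
proof -
  let ?h = "matrix_inv g' ** g"
  have h: "?h \<in> GA" using g by (simp add: GA_mult GA_inv)
  let ?x = "axis i (pw (m i))"
  have b: "app ?h (box m) = box m'" "app ?h (box (m(i := m i + 1))) = box (m'(i' := m' i' + 1))"
    using eq eq1 lat_eq_app[OF g] by blast+
  have 1: "?h *v ?x \<in> box m'" using b(1) axis_box[of i "m i" m] by blast
  \<comment> \<open>\<open>?x\<close> spans the first quotient of the chain, so its image is nonzero
    in the other description of that quotient, namely in coordinate \<open>i'\<close>.\<close>
  have "?x \<notin> box (m(i := m i + 1))" by (simp add: axis_box)
  then have 2: "?h *v ?x \<notin> box (m'(i' := m' i' + 1))" using b(2) app_axis_mem[OF GA_invertible[OF h]] by metis
  have c1: "vge (m' l) (?h $ l $ i * pw (m i))" for l using 1 unfolding box_def by (simp add: matrix_axis)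
  then have "\<not> vge (m' i' + 1) (?h $ i' $ i * pw (m i))"
    using 2 unfolding box_def by (auto simp: matrix_axis split: if_splits)
  then have nz: "?h $ i' $ i \<noteq> 0" by auto
  have "?h $ i' $ i \<in> AA" using h by (simp add: GA_def)
  then have "fls_subdegree (?h $ i' $ i) \<le> 0" using AA_subdegree nz by blast
  moreover have "m' i' \<le> fls_subdegree (?h $ i' $ i) + m i"
    using c1[of i'] nz by (simp add: vge_iff_subdegree)
  ultimately show ?thesis by simp
qed

lemma chain_type_eq:
  assumes "g \<in> GA" "g' \<in> GA" "lat g m = lat g' m'"
    "lat g (m(i := m i + 1)) = lat g' (m'(i' := m' i' + 1))"
  shows "m i = m' i'"
  using chain_type_ge[OF assms] chain_type_ge[OF assms(2,1) assms(3,4)[symmetric]] by simp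

text \<open>The transition matrix preserves \<open>box m\<close>, so its entry at (i, j) has
  valuation at least \<open>m i - m j\<close>. For i in \<open>S\<close> and j outside this is
  positive, and a polynomial in t with this property is 0. The span of the coordinates outside
  \<open>S\<close> is thus canonical: it is a step of the Harder-Narasimhan filtration of the
  corresponding bundle.\<close>

lemma lat_dominant_increment:
  assumes g: "g \<in> GA" "g' \<in> GA" and eq: "lat g m = lat g' m"
    and S: "\<And>i j. i \<in> S \<Longrightarrow> j \<notin> S \<Longrightarrow> m j < m i"
  shows "lat g (\<lambda>x. m x + (if x \<in> S then 1 else 0)) = lat g' (\<lambda>x. m x + (if x \<in> S then 1 else 0))"
    (is "lat g ?m = lat g' ?m")
proof -
  let ?h = "matrix_inv g' ** g"
  have h: "?h \<in> GA" using g by (simp add: GA_mult GA_inv)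
  have b: "app ?h (box m) = box m" using eq lat_eq_app[OF g] by blast
  have v: "vge (m i - m j) (?h $ i $ j)" for i j
  proof -
    have "?h *v axis j (pw (m j)) \<in> box m" using b axis_box[of j "m j" m] by blast
    then have "vge (m i) (?h $ i $ j * pw (m j))" unfolding box_def by (simp add: matrix_axis)
    then show ?thesis by (simp add: mult.commute[of _ "pw _"])
  qed
  have "?h *v x \<in> box ?m" if x: "x \<in> box ?m" for x
  proof -
    have "vge (?m i) (?h $ i $ j * x $ j)" for i j
    proof (cases "i \<in> S \<and> j \<notin> S")
      case True
      then have "vge 1 (?h $ i $ j)" using v[of i j] S[of i j] by (auto intro: vge_mono)
      then have "?h $ i $ j = 0" using h AA_vge by (auto simp: GA_def)
      then show ?thesis by simp
    next
      case False
      have "vge (?m j) (x $ j)" using x by (simp add: box_def)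
      then have "vge (m i - m j + ?m j) (?h $ i $ j * x $ j)" by (rule vge_mult[OF v[of i j]])
      then show ?thesis using False by (elim vge_mono) auto
    qed
    then have "vge (?m i) ((?h *v x) $ i)" for i
      unfolding matrix_vector_mult_def[of ?h] by (simp only: vec_lambda_beta) (rule vge_sum)
    then show ?thesis unfolding box_def by blast
  qed
  then have "app ?h (box ?m) \<subseteq> box ?m" by blast
  moreover have "dg (app ?h (box ?m) :: 'a bt_lattice) = dg (box ?m :: 'a bt_lattice)"
    using h by (simp add: dg_app is_lattice_box GA_invertible GA_vdet)
  ultimately have "app ?h (box ?m) = box ?m"
    using dg_eqD is_lattice_box is_lattice_app GA_invertible h by blast
  then show ?thesis using lat_eq_app[OF g] by blast
qed

section \<open>Chambers and their levels\<close>

text \<open>The number of pairs \<open>x < y\<close>, with \<open>x\<close> counted modulo 3, for which \<open>n x > n y\<close>, where \<open>n\<close> is the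
  harmonic_extension of \<open>(a, b, c)\<close> with \<open>n (x + 3) = n x + 1\<close>; in this form invariance under rotation is
  clear.\<close>
definition inversions :: "int \<Rightarrow> int \<Rightarrow> int \<Rightarrow> nat" where
  "inversions a b c = nat (a - b) + nat (b - a - 1) + nat (a - c) + nat (c - a - 1) + nat (b - c) + nat (c - b - 1)"

lemma inversions_rot: "inversions b c (a + 1) = inversions a b c"
  by (simp add: inversions_def)

lemma inversions_shift: "inversions (a + k) (b + k) (c + k) = inversions a b c"
  by (simp add: inversions_def)

lemma inversions_swap: "b < a \<Longrightarrow> inversions b a c < inversions a b c"
  by (simp add: inversions_def)

lemma inversions_swap': "c < b \<Longrightarrow> inversions a c b < inversions a b c"
  by (simp add: inversions_def)

text \<open>Up to a common shift the integer solutions are (0,0,0), (0,0,1) and (0,1,1), the three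
  rotations of the type of a chamber at the standard vertex.\<close>

lemma inversions_0: "inversions a b c = 0 \<Longrightarrow> a \<le> b \<and> b \<le> c \<and> c \<le> a + 1"
  by (simp add: inversions_def)

lemma box_subset_iff: "box m' \<subseteq> (box m :: 'k::field bt_lattice) \<longleftrightarrow> (\<forall>i. m i \<le> m' i)"
proof
  assume *: "box m' \<subseteq> (box m :: 'k bt_lattice)"
  show "\<forall>i. m i \<le> m' i"
  proof
    fix i
    have "(axis i (pw (m' i)) :: 'k fls ^ 3) \<in> box m'" by (simp add: axis_box)
    then have "(axis i (pw (m' i)) :: 'k fls ^ 3) \<in> box m" using * by blast
    then show "m i \<le> m' i" by (simp add: axis_box)
  qed
qed (auto simp: box_def intro: vge_mono)

lemma lat_subset_iff: "g \<in> GA \<Longrightarrow> lat g m' \<subseteq> lat g m \<longleftrightarrow> (\<forall>i. m i \<le> m' i)"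
  by (simp add: lat_def app_mono_iff GA_invertible box_subset_iff)

lemma lat_psubset: "g \<in> GA \<Longrightarrow> (\<forall>i. m i \<le> m' i) \<Longrightarrow> m p < m' p \<Longrightarrow> lat g m' \<subset> lat g m"
  using lat_subset_iff[of g m' m] lat_subset_iff[of g m m'] by (metis linorder_not_less psubsetI order_refl)

lemma frame_rot:
  assumes "frame g m i j k L0 L1 L2"
  shows "frame g (m(i := m i + 1)) j k i L1 L2 (shl 1 L0)"
proof -
  have ne: "i \<noteq> j" "j \<noteq> k" "i \<noteq> k" using triple_distinct assms unfolding frame_def by blast+
  have ex: "l = i \<or> l = j \<or> l = k" for l using assms unfolding frame_def by blast
  have "(\<lambda>x. m x + 1) = m(i := m i + 1, j := (m(i := m i + 1)) j + 1, k := (m(i := m i + 1)) k + 1)"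
    using ex ne by (auto simp: fun_eq_iff)
  moreover have "UNIV = {j, k, i}" using assms unfolding frame_def by (metis insert_commute)
  ultimately show ?thesis using assms ne unfolding frame_def by (auto simp: shl_lat)
qed

lemma frame_shl:
  assumes "frame g m i j k L0 L1 L2"
  shows "frame g (\<lambda>x. m x + t) i j k (shl t L0) (shl t L1) (shl t L2)"
proof -
  have "(\<lambda>x. (m(i := m i + 1)) x + t) = (\<lambda>x. m x + t)(i := m i + t + 1)" by (auto simp: fun_eq_iff)
  moreover have "(\<lambda>x. (m(i := m i + 1, j := m j + 1)) x + t) = (\<lambda>x. m x + t)(i := m i + t + 1, j := m j + t + 1)"
    by (auto simp: fun_eq_iff)
  ultimately show ?thesis using assms unfolding frame_def by (simp add: shl_lat)
qed

lemma frame_chain: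
  assumes "frame g m i j k L0 L1 L2"
  shows "chain L0 L1 L2"
proof -
  note f = assms[unfolded frame_def] and r = frame_rot[OF assms]
  have g: "g \<in> GA" using f by blast
  note r1 = r[unfolded frame_def] and r2 = frame_rot[OF r, unfolded frame_def]
  have *: "lat g (n(p := n p + 1)) \<subset> lat g n" for n p
    by (rule lat_psubset[OF g, of _ _ p]) auto
  have "L1 \<subset> L0" "L2 \<subset> L1" "shl 1 L0 \<subset> L2" using f r1 r2 * by metis+
  then show ?thesis unfolding chain_def using f is_lattice_lat by metis
qed

text \<open>\<open>chain_type_eq\<close> compares only the first exponents; rotating the chain
  brings the other two to the front.\<close>

lemma frame_unique:
  assumes f: "frame g m i j k L0 L1 L2" and f': "frame g' m' i' j' k' L0 L1 L2"
  shows "m i = m' i' \<and> m j = m' j' \<and> m k = m' k'"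
proof -
  have *: "n p = n' p'" if "frame g n p q r A B C" "frame g' n' p' q' r' A B C" for n p q r n' p' q' r' A B C
  proof -
    have e: "lat g n = lat g' n'" "lat g (n(p := n p + 1)) = lat g' (n'(p' := n' p' + 1))"
      and "g \<in> GA" "g' \<in> GA" using that unfolding frame_def by simp_all
    then show ?thesis by (intro chain_type_eq[of g g'])
  qed
  have ne: "i \<noteq> j" "j \<noteq> k" "i \<noteq> k" "i' \<noteq> j'" "j' \<noteq> k'" "i' \<noteq> k'"
    using triple_distinct f f' unfolding frame_def by blast+
  note r1 = frame_rot[OF f] and r1' = frame_rot[OF f']
  from *[OF f f'] *[OF r1 r1'] *[OF frame_rot[OF r1] frame_rot[OF r1']] show ?thesis using ne by simp
qed

definition ch :: "'k::field bt_lattice \<Rightarrow> 'k bt_lattice \<Rightarrow> 'k bt_lattice \<Rightarrow> 'k bt_simplex" where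
  "ch L0 L1 L2 = {hcls L0, hcls L1, hcls L2}"

lemma chain_rot: "chain L0 L1 L2 \<Longrightarrow> chain L1 L2 (shl 1 L0)"
  unfolding chain_def by (simp add: shl_psubset_iff is_lattice_shl)

lemma chain_shl: "chain L0 L1 L2 \<Longrightarrow> chain (shl k L0) (shl k L1) (shl k L2)"
proof -
  assume a: "chain L0 L1 L2"
  have "shl 1 (shl k L0) = shl k (shl 1 L0)" by (simp add: shl_shl add.commute)
  then show ?thesis using a unfolding chain_def using shl_psubset_iff is_lattice_shl by metis
qed

lemma ch_rot: "chain L0 L1 L2 \<Longrightarrow> ch L1 L2 (shl 1 L0) = ch L0 L1 L2"
  by (auto simp: ch_def chain_def hcls_shl)

lemma ch_shl: "chain L0 L1 L2 \<Longrightarrow> ch (shl k L0) (shl k L1) (shl k L2) = ch L0 L1 L2"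
  by (simp add: ch_def chain_def hcls_shl)

lemma is_chamber_iff: "is_chamber s \<longleftrightarrow> (\<exists>L0 L1 L2. chain L0 L1 L2 \<and> s = ch L0 L1 L2)"
  unfolding is_chamber_def chain_def ch_def scale_X by blast

text \<open>Any representative of any vertex of a chamber can be made the start of its chain. The
  predicate \<open>P\<close> carries data along that is stable under rotation and shift, such as a
  frame with a given number of inversions.\<close>

lemma rotate_chain_to:
  assumes c: "chain A0 A1 A2" and L: "is_lattice L" "hcls L \<in> ch A0 A1 A2" and P: "P A0 A1 A2"
    and rot: "\<And>A B C. chain A B C \<Longrightarrow> P A B C \<Longrightarrow> P B C (shl 1 A)"
    and sh: "\<And>A B C k. P A B C \<Longrightarrow> P (shl k A) (shl k B) (shl k C)"
  shows "\<exists>M N. chain L M N \<and> ch L M N = ch A0 A1 A2 \<and> P L M N"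
proof -
  have *: "\<exists>M N. chain L M N \<and> ch L M N = ch A B C \<and> P L M N" if h: "chain A B C" "P A B C" "hcls L = hcls A" for A B C
  proof -
    have "is_lattice A" using h(1) chain_def by blast
    then obtain k where k: "L = shl k A" using h(3) hcls_eq_iff[of A L] L(1) by metis
    show ?thesis using chain_shl[OF h(1), of k] ch_shl[OF h(1), of k] sh[OF h(2), of k] k by metis
  qed
  have c1: "chain A1 A2 (shl 1 A0)" "P A1 A2 (shl 1 A0)" "ch A1 A2 (shl 1 A0) = ch A0 A1 A2"
    using chain_rot[OF c] rot[OF c P] ch_rot[OF c] .
  have c2: "chain A2 (shl 1 A0) (shl 1 A1)" "P A2 (shl 1 A0) (shl 1 A1)" "ch A2 (shl 1 A0) (shl 1 A1) = ch A0 A1 A2"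
    using chain_rot[OF c1(1)] rot[OF c1(1,2)] ch_rot[OF c1(1)] c1(3) by simp_all
  from L(2) consider "hcls L = hcls A0" | "hcls L = hcls A1" | "hcls L = hcls A2" by (auto simp: ch_def)
  then show ?thesis
  proof cases
    case 1 then show ?thesis using *[OF c P] by blast
  next
    case 2 then show ?thesis using *[OF c1(1,2)] c1(3) by simp
  next
    case 3 then show ?thesis using *[OF c2(1,2)] c2(3) by simp
  qed
qed

lemma chamber_chain_at:
  assumes "is_chamber s" "is_lattice L" "hcls L \<in> s"
  obtains M N where "chain L M N" "s = ch L M N"
proof -
  obtain A0 A1 A2 where a: "chain A0 A1 A2" "s = ch A0 A1 A2" using assms(1) is_chamber_iff by blast
  show thesis using rotate_chain_to[OF a(1) assms(2), of "\<lambda>_ _ _. True"] assms(3) a(2) that by auto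
qed

text \<open>Shifts change colengths by multiples of 3, and the three lattices of a chain have
  different residues, so the colength identifies the lattice.\<close>

lemma chain_mem:
  assumes c: "chain L0 M N" and A: "is_lattice A" "hcls A \<in> ch L0 M N"
  shows "dg A = dg L0 \<Longrightarrow> A = L0" "dg A = dg L0 + 1 \<Longrightarrow> A = M" "dg A = dg L0 + 2 \<Longrightarrow> A = N"
proof -
  have l: "is_lattice L0" "is_lattice M" "is_lattice N" using c chain_def by blast+
  have "\<exists>k. A = shl k L0 \<or> A = shl k M \<or> A = shl k N"
    using A(2) hcls_eq_iff[OF l(1) A(1)] hcls_eq_iff[OF l(2) A(1)] hcls_eq_iff[OF l(3) A(1)]
    by (auto simp: ch_def)
  then obtain k where k: "A = shl k L0 \<and> dg A = dg L0 + 3 * k \<or> A = shl k M \<and> dg A = dg L0 + 1 + 3 * k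
     \<or> A = shl k N \<and> dg A = dg L0 + 2 + 3 * k"
    using dg_shl l chain_dg[OF c] by metis
  show "dg A = dg L0 \<Longrightarrow> A = L0" using k by (elim disjE conjE) (presburger | simp)+
  show "dg A = dg L0 + 1 \<Longrightarrow> A = M" using k by (elim disjE conjE) (presburger | simp)+
  show "dg A = dg L0 + 2 \<Longrightarrow> A = N" using k by (elim disjE conjE) (presburger | simp)+
qed

lemma ch_inj:
  assumes "chain L0 A B" "chain L0 C D" "ch L0 A B = ch L0 C D"
  shows "A = C \<and> B = D"
proof -
  have "hcls A \<in> ch L0 C D" "hcls B \<in> ch L0 C D" using assms(3)[symmetric] by (auto simp: ch_def)
  moreover have "is_lattice A" "is_lattice B" using assms(1) chain_def by blast+
  ultimately show ?thesis using chain_mem(2,3)[OF assms(2)] chain_dg[OF assms(1)] by metis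
qed

definition level :: "'k::field bt_simplex \<Rightarrow> nat" where
  "level s = (SOME n. \<exists>g m i j k L0 L1 L2. frame g m i j k L0 L1 L2 \<and> s = ch L0 L1 L2 \<and> n = inversions (m i) (m j) (m k))"

text \<open>A second chain of the same chamber can be rotated and shifted to start at
  \<open>L0\<close>; it then is the given chain, and \<open>frame_unique\<close> identifies the
  types. The inversion count survives the rotation and the shift.\<close>

lemma level_eq:
  assumes f: "frame g m i j k L0 L1 L2"
  shows "level (ch L0 L1 L2) = inversions (m i) (m j) (m k)"
proof -
  have "n = inversions (m i) (m j) (m k)"
    if "\<exists>g m i j k A0 A1 A2. frame g m i j k A0 A1 A2 \<and> ch L0 L1 L2 = ch A0 A1 A2 \<and> n = inversions (m i) (m j) (m k)" for n
  proof -
    obtain g' m' i' j' k' A0 A1 A2 where f': "frame g' m' i' j' k' A0 A1 A2"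
      "ch L0 L1 L2 = ch A0 A1 A2" "n = inversions (m' i') (m' j') (m' k')" using \<open>\<exists>g m i j k A0 A1 A2. _ g m i j k A0 A1 A2\<close> by blast
    define P where "P A B C \<longleftrightarrow> (\<exists>g m i j k. frame g m i j k A B C \<and> n = inversions (m i) (m j) (m k))" for A B C :: "'a bt_lattice"
    have "is_lattice L0" using frame_chain[OF f] chain_def by blast
    moreover have "hcls L0 \<in> ch A0 A1 A2" using f'(2)[symmetric] by (simp add: ch_def)
    moreover have "P A0 A1 A2" unfolding P_def using f' by blast
    moreover have "P B C (shl 1 A)" if c: "P A B C" for A B C
    proof -
      obtain g m i j k where r: "frame g m i j k A B C" "n = inversions (m i) (m j) (m k)" using c P_def by blast
      have "i \<noteq> j" "i \<noteq> k" using r(1) triple_distinct unfolding frame_def by blast+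
      then have "n = inversions ((m(i := m i + 1)) j) ((m(i := m i + 1)) k) ((m(i := m i + 1)) i)"
        using r(2) inversions_rot by simp
      then show ?thesis unfolding P_def using frame_rot[OF r(1)] by blast
    qed
    moreover have "P (shl t A) (shl t B) (shl t C)" if c: "P A B C" for A B C t
    proof -
      obtain g m i j k where r: "frame g m i j k A B C" "n = inversions (m i) (m j) (m k)" using c P_def by blast
      have "n = inversions (m i + t) (m j + t) (m k + t)" using r(2) inversions_shift by simp
      then show ?thesis unfolding P_def using frame_shl[OF r(1), of t] by blast
    qed
    ultimately obtain M N where MN: "chain L0 M N" "ch L0 M N = ch A0 A1 A2" "P L0 M N"
      using rotate_chain_to[OF frame_chain[OF f'(1)], of L0 P] by blast
    have "M = L1 \<and> N = L2" using ch_inj[OF MN(1) frame_chain[OF f]] MN(2) f'(2) by simp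
    then obtain g'' m'' i'' j'' k'' where "frame g'' m'' i'' j'' k'' L0 L1 L2" "n = inversions (m'' i'') (m'' j'') (m'' k'')"
      using MN(3) P_def by blast
    then show ?thesis using frame_unique[OF f] by metis
  qed
  then show ?thesis unfolding level_def using f by (intro some_equality) blast+
qed

lemma chain_frame:
  assumes "chain L0 L1 L2"
  obtains g m i j k where "frame g m i j k L0 L1 L2"
proof -
  obtain g m where g: "g \<in> GA" "L0 = lat g m" using lattice_eq_lat assms chain_def by blast
  then show thesis using frame_exists[OF g(1), of m L1 L2] assms that by blast
qed

section \<open>Edges, stars and the linear relation at a vertex\<close>

definition Cs :: "'k::field bt_simplex \<Rightarrow> 'k bt_simplex set" where
  "Cs e = {s. is_chamber s \<and> e \<subseteq> s}"

lemma edge_at: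
  assumes e: "is_edge e" and v: "is_lattice L0" "hcls L0 \<in> e"
  obtains X where "is_lattice X" "X \<subset> L0" "shl 1 L0 \<subset> X" "e = {hcls L0, hcls X}"
proof -
  obtain A B where AB: "is_lattice A" "is_lattice B" "B \<subset> A" "shl 1 A \<subset> B" "e = {hcls A, hcls B}"
    using e unfolding is_edge_def scale_X by blast
  note ** = that
  have *: thesis if h: "is_lattice A" "is_lattice B" "B \<subset> A" "shl 1 A \<subset> B" "e = {hcls A, hcls B}" "hcls L0 = hcls A" for A B
  proof -
    obtain k where k: "L0 = shl k A" using h(1,6) v(1) hcls_eq_iff by metis
    have "shl 1 L0 = shl k (shl 1 A)" using k by (simp add: shl_shl add.commute)
    then have "shl 1 L0 \<subset> shl k B" "shl k B \<subset> L0" using h(3,4) k by (simp_all add: shl_psubset_iff)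
    moreover have "e = {hcls L0, hcls (shl k B)}" using h by (simp add: hcls_shl)
    ultimately show thesis by (intro **[of "shl k B"] is_lattice_shl[OF h(2)])
  qed
  consider "hcls L0 = hcls A" | "hcls L0 = hcls B" using v(2) AB(5) by blast
  then show thesis
  proof cases
    case 1 then show thesis using * AB by blast
  next
    case 2
    show thesis
      by (rule *[of B "shl 1 A"]) (use AB 2 in \<open>auto simp: is_lattice_shl hcls_shl shl_psubset_iff\<close>)
  qed
qed

lemma edge_dg:
  assumes "is_lattice X" "is_lattice L0" "X \<subset> L0" "shl 1 L0 \<subset> X"
  shows "dg X = dg L0 + 1 \<or> dg X = dg L0 + 2"
proof -
  have "dg L0 < dg X" "dg X < dg L0 + 3"
    using dg_strict[OF assms(1,2,3)] dg_strict[OF is_lattice_shl[OF assms(2)] assms(1,4)] dg_shl[OF assms(2), of 1] by simp_all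
  then show ?thesis by linarith
qed

lemma Cs_dg1:
  assumes "is_lattice X" "is_lattice L0" "dg X = dg L0 + 1"
  shows "Cs {hcls L0, hcls X} = (\<lambda>N. ch L0 X N) ` {N. chain L0 X N}"
proof (intro equalityI subsetI)
  fix s assume s: "s \<in> Cs {hcls L0, hcls X}"
  then obtain M N where MN: "chain L0 M N" "s = ch L0 M N" using chamber_chain_at[of s L0] assms(2) by (auto simp: Cs_def)
  then have "X = M" using s chain_mem(2)[OF MN(1) assms(1)] assms(3) by (auto simp: Cs_def)
  then show "s \<in> (\<lambda>N. ch L0 X N) ` {N. chain L0 X N}" using MN by blast
qed (auto simp: Cs_def ch_def is_chamber_iff)

lemma Cs_dg2:
  assumes "is_lattice X" "is_lattice L0" "dg X = dg L0 + 2"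
  shows "Cs {hcls L0, hcls X} = (\<lambda>M. ch L0 M X) ` {M. chain L0 M X}"
proof (intro equalityI subsetI)
  fix s assume s: "s \<in> Cs {hcls L0, hcls X}"
  then obtain M N where MN: "chain L0 M N" "s = ch L0 M N" using chamber_chain_at[of s L0] assms(2) by (auto simp: Cs_def)
  then have "X = N" using s chain_mem(3)[OF MN(1) assms(1)] assms(3) by (auto simp: Cs_def)
  then show "s \<in> (\<lambda>M. ch L0 M X) ` {M. chain L0 M X}" using MN by blast
qed (auto simp: Cs_def ch_def is_chamber_iff)

lemma finite_flags:
  fixes L0 :: "'k::{field,finite} bt_lattice"
  assumes "is_lattice L0"
  shows "finite {(M, N). chain L0 M N}"
proof -
  let ?F = "\<lambda>L :: 'k bt_lattice. {M. is_lattice M \<and> M \<subset> L \<and> dg M = dg L + 1}"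
  have "{(M, N). chain L0 M N} \<subseteq> Sigma (?F L0) ?F"
  proof (rule subrelI)
    fix M N assume "(M, N) \<in> {(M, N). chain L0 M N}"
    then have c: "chain L0 M N" by simp
    then show "(M, N) \<in> Sigma (?F L0) ?F" using chain_dg[OF c] c[unfolded chain_def] by simp
  qed
  moreover have "finite (Sigma (?F L0) ?F)"
  proof (rule finite_SigmaI)
    fix L assume "L \<in> ?F L0"
    then have "is_lattice L" by simp
    then show "finite (?F L)" by (rule finite_codim1)
  qed (rule finite_codim1[OF assms])
  ultimately show ?thesis using finite_subset by blast
qed

lemma finite_star:
  fixes L0 :: "'k::{field,finite} bt_lattice"
  assumes "is_lattice L0"
  shows "finite {s. is_chamber s \<and> hcls L0 \<in> s}"
proof -
  have "{s. is_chamber s \<and> hcls L0 \<in> s} \<subseteq> (\<lambda>(M, N). ch L0 M N) ` {(M, N). chain L0 M N}"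
  proof
    fix s assume "s \<in> {s. is_chamber s \<and> hcls L0 \<in> s}"
    then obtain M N where "chain L0 M N" "s = ch L0 M N" using chamber_chain_at[OF _ assms, of s] by auto
    then show "s \<in> (\<lambda>(M, N). ch L0 M N) ` {(M, N). chain L0 M N}" by (intro image_eqI[of _ _ "(M, N)"]) auto
  qed
  then show ?thesis by (rule finite_subset) (intro finite_imageI finite_flags[OF assms])
qed

lemma finite_Cs:
  fixes e :: "'k::{field,finite} bt_simplex"
  assumes "is_edge e" shows "finite (Cs e)"
proof -
  obtain L0 where "is_lattice L0" "hcls L0 \<in> e" using assms is_edge_def by blast
  then show ?thesis by (intro finite_subset[OF _ finite_star[of L0]]) (auto simp: Cs_def)
qed

text \<open>Every chamber at a vertex contains exactly one edge at that vertex of each of the two kinds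
  (lattices of index \<open>q\<close> and \<open>q\<^sup>2\<close>), so grouping the chambers by either kind gives the same total.\<close>
lemma star_sum:
  fixes c :: "'k::{field,finite} bt_simplex \<Rightarrow> 'v::ab_group_add"
  assumes L0: "is_lattice L0" and e0: "is_edge e0" "hcls L0 \<in> e0"
    and z: "\<And>e. is_edge e \<Longrightarrow> hcls L0 \<in> e \<Longrightarrow> e \<noteq> e0 \<Longrightarrow> sum c (Cs e) = 0"
  shows "sum c (Cs e0) = 0"
proof -
  let ?A = "fst ` {(M, N). chain L0 M N}" and ?B = "snd ` {(M, N). chain L0 M N}"
  have fin: "finite ?A" "finite ?B" using finite_flags[OF L0] by blast+
  have cA: "is_lattice M \<and> M \<subset> L0 \<and> shl 1 L0 \<subset> M \<and> dg M = dg L0 + 1" if "M \<in> ?A" for M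
  proof -
    from \<open>M \<in> ?A\<close> obtain N where c: "chain L0 M N" by auto
    show ?thesis using chain_dg[OF c] c[unfolded chain_def] by (metis psubset_trans)
  qed
  have cB: "is_lattice N \<and> N \<subset> L0 \<and> shl 1 L0 \<subset> N \<and> dg N = dg L0 + 2" if "N \<in> ?B" for N
  proof -
    from \<open>N \<in> ?B\<close> obtain M where c: "chain L0 M N" by auto
    show ?thesis using chain_dg[OF c] c[unfolded chain_def] by (metis psubset_trans)
  qed
  have edge: "is_edge {hcls L0, hcls X}" if "is_lattice X" "X \<subset> L0" "shl 1 L0 \<subset> X" for X
    using that L0 unfolding is_edge_def scale_X by blast
  have SA: "sum c (Cs {hcls L0, hcls M}) = (\<Sum>N\<in>{N \<in> ?B. chain L0 M N}. c (ch L0 M N))" if "M \<in> ?A" for M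
  proof -
    have "{N. chain L0 M N} = {N \<in> ?B. chain L0 M N}" by force
    moreover have "inj_on (ch L0 M) {N. chain L0 M N}" by (rule inj_onI) (metis ch_inj mem_Collect_eq)
    ultimately show ?thesis using Cs_dg1[of M L0] cA[OF that] L0 by (simp add: sum.reindex)
  qed
  have SB: "sum c (Cs {hcls L0, hcls N}) = (\<Sum>M\<in>{M \<in> ?A. chain L0 M N}. c (ch L0 M N))" if "N \<in> ?B" for N
  proof -
    have "{M. chain L0 M N} = {M \<in> ?A. chain L0 M N}" by force
    moreover have "inj_on (\<lambda>M. ch L0 M N) {M. chain L0 M N}" by (rule inj_onI) (metis ch_inj mem_Collect_eq)
    ultimately show ?thesis using Cs_dg2[of N L0] cB[OF that] L0 by (simp add: sum.reindex)
  qed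
  have tot: "(\<Sum>M\<in>?A. sum c (Cs {hcls L0, hcls M})) = (\<Sum>N\<in>?B. sum c (Cs {hcls L0, hcls N}))"
  proof -
    have "(\<Sum>M\<in>?A. sum c (Cs {hcls L0, hcls M})) = (\<Sum>M\<in>?A. \<Sum>N\<in>{N \<in> ?B. chain L0 M N}. c (ch L0 M N))"
      using SA by (intro sum.cong) auto
    also have "\<dots> = (\<Sum>N\<in>?B. \<Sum>M\<in>{M \<in> ?A. chain L0 M N}. c (ch L0 M N))"
      by (rule sum.swap_restrict[OF fin])
    also have "\<dots> = (\<Sum>N\<in>?B. sum c (Cs {hcls L0, hcls N}))"
      using SB by (intro sum.cong) auto
    finally show ?thesis .
  qed
  obtain X where X: "is_lattice X" "X \<subset> L0" "shl 1 L0 \<subset> X" "e0 = {hcls L0, hcls X}" using edge_at[OF e0(1) L0 e0(2)] .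
  let ?F = "\<lambda>Y. sum c (Cs {hcls L0, hcls Y})"
  have z': "?F Y = 0" if Y: "Y \<in> ?A \<union> ?B" "Y \<noteq> X" for Y
  proof -
    have "is_lattice Y \<and> Y \<subset> L0 \<and> shl 1 L0 \<subset> Y" using Y(1) cA[of Y] cB[of Y] by (elim UnE) simp_all
    then have h: "is_lattice Y" "Y \<subset> L0" "shl 1 L0 \<subset> Y" by simp_all
    have "{hcls L0, hcls Y} \<noteq> e0"
    proof
      assume "{hcls L0, hcls Y} = e0"
      then have "hcls X = hcls Y" using X(4) by (metis doubleton_eq_iff)
      then obtain k where k: "X = shl k Y" using hcls_eq_iff[OF h(1) X(1)] by metis
      then have "dg X = dg Y + 3 * k" using dg_shl[OF h(1)] by metis
      then have "k = 0" using edge_dg[OF X(1) L0 X(2,3)] edge_dg[OF h(1) L0 h(2,3)] by presburger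
      then show False using k Y(2) by simp
    qed
    then show ?thesis using z edge[OF h] by blast
  qed
  have one: "sum ?F S = ?F X" if "finite S" "X \<in> S" "S \<subseteq> ?A \<union> ?B" for S
  proof -
    have "sum ?F (S - {X}) = 0" by (rule sum.neutral, rule ballI, rule z') (use that(3) in auto)
    then show ?thesis using sum.remove[OF that(1,2), of ?F] by simp
  qed
  have none: "sum ?F S = 0" if "X \<notin> S" "S \<subseteq> ?A \<union> ?B" for S
    by (rule sum.neutral, rule ballI, rule z') (use that in auto)
  have "\<not> (X \<in> ?A \<and> X \<in> ?B)"
  proof
    assume "X \<in> ?A \<and> X \<in> ?B"
    then have "dg X = dg L0 + 1" "dg X = dg L0 + 2" using cA[of X] cB[of X] by simp_all
    then show False by simp
  qed
  then consider "X \<in> ?A" "X \<notin> ?B" | "X \<in> ?B" "X \<notin> ?A" | "X \<notin> ?A" "X \<notin> ?B" by blast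
  then show ?thesis
  proof cases
    case 1 then show ?thesis using tot one[OF fin(1)] none[of ?B] X(4) by simp
  next
    case 2 then show ?thesis using tot one[OF fin(2)] none[of ?A] X(4) by simp
  next
    \<comment> \<open>If \<open>X\<close> occurs in no flag at \<open>L0\<close>, then no chamber
      contains \<open>e0\<close> and its sum is empty.\<close>
    case 3
    have e: "{N. chain L0 X N} = {}" "{M. chain L0 M X} = {}" using 3 by (force, force)
    show ?thesis using edge_dg[OF X(1) L0 X(2,3)]
    proof
      assume "dg X = dg L0 + 1" then show ?thesis using Cs_dg1[OF X(1) L0] X(4) e(1) by simp
    next
      assume "dg X = dg L0 + 2" then show ?thesis using Cs_dg2[OF X(1) L0] X(4) e(2) by simp
    qed
  qed
qed

section \<open>Harmonic harmonic_extension along levels\<close>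

lemma frame_UNIV: "frame g m i j k L0 L1 L2 \<Longrightarrow> UNIV = {i, j, k}"
  by (simp only: frame_def)

text \<open>The precise form of a descending edge: harmonicity at \<open>e\<close> expresses the
  value at \<open>s\<close> through values at strictly lower levels.\<close>

definition peak :: "'k::field bt_simplex \<Rightarrow> 'k bt_simplex \<Rightarrow> bool" where
  "peak e s \<longleftrightarrow> s \<in> Cs e \<and> (\<forall>s'\<in>Cs e. s' \<noteq> s \<longrightarrow> level s' < level s)"

lemma frame_edge:
  assumes "frame g m i j k L0 L1 L2"
  shows "is_edge {hcls L0, hcls L2}" "is_chamber (ch L0 L1 L2)"
proof -
  note c = frame_chain[OF assms]
  show "is_chamber (ch L0 L1 L2)" using c is_chamber_iff by blast
  show "is_edge {hcls L0, hcls L2}"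
    using c unfolding is_edge_def scale_X chain_def by (metis psubset_trans)
qed

text \<open>The same basis with i and j exchanged: the neighbour across the edge within the
  apartment of the frame.\<close>

lemma frame_swap:
  assumes f: "frame g m i j k L0 L1 L2"
  shows "frame g m j i k L0 (lat g (m(j := m j + 1))) L2" "lat g (m(j := m j + 1)) \<noteq> L1"
proof -
  note f' = f[unfolded frame_def]
  have ne: "i \<noteq> j" using triple_distinct f' by blast
  have g: "g \<in> GA" using f' by blast
  have "UNIV = {j, i, k}" using f' by (metis insert_commute)
  moreover have "m(i := m i + 1, j := m j + 1) = m(j := m j + 1, i := m i + 1)" using ne by auto
  ultimately show "frame g m j i k L0 (lat g (m(j := m j + 1))) L2" unfolding frame_def using f' by simp
  show "lat g (m(j := m j + 1)) \<noteq> L1"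
  proof
    assume "lat g (m(j := m j + 1)) = L1"
    then have "lat g (m(j := m j + 1)) \<subseteq> lat g (m(i := m i + 1))" using f' by simp
    then have "(m(i := m i + 1)) i \<le> (m(j := m j + 1)) i" using lat_subset_iff[OF g] by blast
    then show False using ne by simp
  qed
qed

lemma Cs_frame:
  assumes f: "frame g m i j k L0 L1 L2" and s: "s \<in> Cs {hcls L0, hcls L2}"
  obtains M where "chain L0 M L2" "s = ch L0 M L2"
proof -
  note c = frame_chain[OF f]
  have "Cs {hcls L0, hcls L2} = (\<lambda>M. ch L0 M L2) ` {M. chain L0 M L2}"
    using Cs_dg2[of L2 L0] chain_dg[OF c] c[unfolded chain_def] by simp
  then show thesis using s that by auto
qed

lemma frame_peak:
  assumes f: "frame g m i j k L0 L1 L2" and lt: "m j < m i"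
  shows "peak {hcls L0, hcls L2} (ch L0 L1 L2)"
proof -
  have "level s' < level (ch L0 L1 L2)" if s': "s' \<in> Cs {hcls L0, hcls L2}" "s' \<noteq> ch L0 L1 L2" for s'
  proof -
    obtain M where M: "chain L0 M L2" "s' = ch L0 M L2" using Cs_frame[OF f s'(1)] .
    have "M \<noteq> L1" using M(2) s'(2) by blast
    then obtain g' where "frame g' m j i k L0 M L2" using frame_neighbour[OF f M(1)] lt by auto
    then have "level s' = inversions (m j) (m i) (m k)" using level_eq M(2) by simp
    then show ?thesis using level_eq[OF f] inversions_swap[OF lt] by simp
  qed
  moreover have "ch L0 L1 L2 \<in> Cs {hcls L0, hcls L2}"
    using frame_edge(2)[OF f] by (auto simp: Cs_def ch_def)
  ultimately show ?thesis by (auto simp: peak_def)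
qed

text \<open>If \<open>m i \<le> m j\<close>, the neighbour in the apartment of the frame would not
  have a smaller level.\<close>

lemma peak_frame:
  assumes f: "frame g m i j k L0 L1 L2" and s: "peak {hcls L0, hcls L2} (ch L0 L1 L2)"
  shows "m j < m i"
proof (rule ccontr)
  assume n: "\<not> m j < m i"
  note sw = frame_swap[OF f]
  let ?s = "ch L0 (lat g (m(j := m j + 1))) L2"
  have "?s \<noteq> ch L0 L1 L2" using ch_inj[OF frame_chain[OF sw(1)] frame_chain[OF f]] sw(2) by blast
  moreover have "?s \<in> Cs {hcls L0, hcls L2}" using frame_edge(2)[OF sw(1)] by (auto simp: Cs_def ch_def)
  ultimately have "level ?s < level (ch L0 L1 L2)" using s by (simp add: peak_def)
  then have "inversions (m j) (m i) (m k) < inversions (m i) (m j) (m k)" using level_eq[OF f] level_eq[OF sw(1)] by simp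
  then show False using n inversions_swap[of "m i" "m j" "m k"] by (cases "m i = m j") auto
qed

text \<open>A type that increases as \<open>m i \<le> m j \<le> m k \<le> m i + 1\<close> has no
  inversions. So positive level produces a descent between cyclically consecutive entries, and each
  of the three possible descents belongs to one edge of the chamber.\<close>

lemma ex_peak:
  assumes "is_chamber s" "level s > 0"
  shows "\<exists>e. is_edge e \<and> peak e s"
proof -
  obtain L0 L1 L2 where c: "chain L0 L1 L2" "s = ch L0 L1 L2" using assms(1) is_chamber_iff by blast
  obtain g m i j k where f: "frame g m i j k L0 L1 L2" using chain_frame[OF c(1)] .
  have ne: "i \<noteq> j" "j \<noteq> k" "i \<noteq> k" using triple_distinct[OF frame_UNIV[OF f]] by blast+
  note f1 = frame_rot[OF f] note f2 = frame_rot[OF f1]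
  note c1 = chain_rot[OF c(1)]
  have "inversions (m i) (m j) (m k) > 0" using assms(2) level_eq[OF f] c(2) by simp
  then consider "m j < m i" | "m k < m j" | "m i + 1 < m k" by (force simp: inversions_def)
  then show ?thesis
  proof cases
    case 1 then show ?thesis using frame_peak[OF f] frame_edge(1)[OF f] c(2) by blast
  next
    case 2 then show ?thesis using frame_peak[OF f1] frame_edge(1)[OF f1] c(2) ch_rot[OF c(1)] ne by auto
  next
    case 3 then show ?thesis using frame_peak[OF f2] frame_edge(1)[OF f2] c(2) ch_rot[OF c(1)] ch_rot[OF c1] ne by auto
  qed
qed

text \<open>An edge with second lattice of colength one is re-based at that lattice; the shift of
  the first then has colength two. So the vertex of \<open>s\<close> off \<open>e\<close> can always
  be the middle lattice of the chain.\<close>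

lemma edge_frame:
  assumes e: "is_edge e" and s: "s \<in> Cs e"
  obtains g m i j k L0 L1 L2 where "frame g m i j k L0 L1 L2" "s = ch L0 L1 L2" "e = {hcls L0, hcls L2}"
proof -
  obtain A X where A: "is_lattice A" "is_lattice X" "X \<subset> A" "shl 1 A \<subset> X" "e = {hcls A, hcls X}"
    using e unfolding is_edge_def scale_X by blast
  note ** = that
  have *: thesis if h: "is_lattice A" "is_lattice X" "e = {hcls A, hcls X}" "dg X = dg A + 2" for A X
  proof -
    obtain M where M: "chain A M X" "s = ch A M X" using s Cs_dg2[OF h(2,1,4)] h(3) by auto
    obtain g m i j k where f: "frame g m i j k A M X" using chain_frame[OF M(1)] .
    show thesis by (rule **[OF f M(2) h(3)])
  qed
  consider "dg X = dg A + 1" | "dg X = dg A + 2" using edge_dg[OF A(2,1,3,4)] by blast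
  then show thesis
  proof cases
    case 1
    show thesis
      by (rule *[of X "shl 1 A"]) (use A 1 in \<open>auto simp: is_lattice_shl hcls_shl dg_shl\<close>)
  next
    case 2 then show thesis using * A by blast
  qed
qed

section \<open>Levels on the star of a vertex\<close>

lemma star_frame:
  assumes f: "frame g m i j k L0 L1 L2" and s: "is_chamber s" "hcls L0 \<in> s"
  obtains g' i' j' k' M N where "frame g' m i' j' k' L0 M N" "s = ch L0 M N"
proof -
  have L0: "g \<in> GA" "L0 = lat g m" "is_lattice L0" using f frame_chain[OF f] unfolding frame_def chain_def by blast+
  obtain M N where M: "chain L0 M N" "s = ch L0 M N" using chamber_chain_at[OF s(1) L0(3) s(2)] .
  then show thesis using frame_exists[OF L0(1), of m M N] L0(2) that by blast
qed

text \<open>A strict maximum at i makes \<open>{i}\<close> an admissible set for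
  \<open>lat_dominant_increment\<close>, so the lattice with only this exponent raised is
  independent of the adapted basis. A strict minimum at k is treated in the same way with the
  complement of \<open>{k}\<close>.\<close>

lemma frame_dominant1:
  assumes f: "frame g m i j k L0 L1 L2" and f': "frame g' m i j' k' L0 M N"
    and d: "m j < m i" "m k < m i"
  shows "M = L1"
proof -
  note f = f[unfolded frame_def] and f' = f'[unfolded frame_def]
  have *: "(\<lambda>x. m x + (if x \<in> {i} then 1 else 0)) = m(i := m i + 1)" by auto
  have "x = j \<or> x = k" if "x \<noteq> i" for x using f that by blast
  then have "lat g (\<lambda>x. m x + (if x \<in> {i} then 1 else 0)) = lat g' (\<lambda>x. m x + (if x \<in> {i} then 1 else 0))"
    using f f' d by (intro lat_dominant_increment) auto
  then show ?thesis using f f' unfolding * by simp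
qed

lemma frame_dominant2:
  assumes f: "frame g m i j k L0 L1 L2" and f': "frame g' m i' j' k L0 M N"
    and d: "m k < m i" "m k < m j"
  shows "N = L2"
proof -
  have u: "UNIV = {i, j, k}" "UNIV = {i', j', k}" using frame_UNIV[OF f] frame_UNIV[OF f'] .
  have ne: "i \<noteq> j" "j \<noteq> k" "i \<noteq> k" "i' \<noteq> j'" "j' \<noteq> k" "i' \<noteq> k" using triple_distinct u by blast+
  have *: "(\<lambda>x. m x + (if x \<in> UNIV - {k} then 1 else 0)) = m(i := m i + 1, j := m j + 1)"
    "(\<lambda>x. m x + (if x \<in> UNIV - {k} then 1 else 0)) = m(i' := m i' + 1, j' := m j' + 1)"
    using u ne by (auto simp: fun_eq_iff)
  have "x = i \<or> x = j" if "x \<noteq> k" for x using u that by blast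
  then have "lat g (\<lambda>x. m x + (if x \<in> UNIV - {k} then 1 else 0)) = lat g' (\<lambda>x. m x + (if x \<in> UNIV - {k} then 1 else 0))"
    using f f' d unfolding frame_def by (intro lat_dominant_increment) auto
  then show ?thesis using f f' *(1) *(2) unfolding frame_def by metis
qed

lemma perm_cases:
  assumes "(UNIV :: 3 set) = {i, j, k}" "(UNIV :: 3 set) = {i', j', k'}"
  shows "(i' = i \<and> j' = j \<and> k' = k) \<or> (i' = i \<and> j' = k \<and> k' = j) \<or> (i' = j \<and> j' = i \<and> k' = k)
    \<or> (i' = j \<and> j' = k \<and> k' = i) \<or> (i' = k \<and> j' = i \<and> k' = j) \<or> (i' = k \<and> j' = j \<and> k' = i)"
proof -
  have "i' \<in> {i, j, k}" "j' \<in> {i, j, k}" "k' \<in> {i, j, k}" using assms(1) by blast+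
  then show ?thesis using triple_distinct[OF assms(2)] by auto
qed

text \<open>With strictly decreasing exponents both steps of the chain are canonical, so this order
  of the indices occurs for one chamber only, and every other order has fewer inversions.\<close>

lemma star_strict:
  assumes f: "frame g m i j k L0 L1 L2" and d: "m j < m i" "m k < m j"
    and s: "is_chamber s" "hcls L0 \<in> s" "s \<noteq> ch L0 L1 L2"
  shows "level s < level (ch L0 L1 L2)"
proof -
  obtain g' i' j' k' M N where f': "frame g' m i' j' k' L0 M N" "s = ch L0 M N" using star_frame[OF f s(1,2)] .
  have u: "UNIV = {i, j, k}" "UNIV = {i', j', k'}" using frame_UNIV[OF f] frame_UNIV[OF f'(1)] .
  have "\<not> (i' = i \<and> j' = j \<and> k' = k)"
  proof
    assume "i' = i \<and> j' = j \<and> k' = k"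
    then have "M = L1" "N = L2" using frame_dominant1[OF f, of g' j' k' M N] frame_dominant2[OF f, of g' i' j' M N] f'(1) d by auto
    then show False using f'(2) s(3) by blast
  qed
  then have "inversions (m i') (m j') (m k') < inversions (m i) (m j) (m k)"
    using perm_cases[OF u] d inversions_swap'[of "m k" "m j" "m i"] inversions_swap[of "m j" "m i" "m k"]
      inversions_swap'[of "m k" "m i" "m j"] inversions_swap[of "m k" "m i" "m j"] inversions_swap[of "m k" "m j" "m i"] by auto
  then show ?thesis using level_eq[OF f] level_eq[OF f'(1)] f'(2) by simp
qed

text \<open>Here \<open>L2\<close> is canonical. The level is maximal exactly when k comes last, and
  such chambers all share the edge from \<open>L0\<close> to \<open>L2\<close>. In
  \<open>star_flat1\<close> the same happens with \<open>L1\<close> and the index i in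
  front.\<close>

lemma star_flat2:
  assumes f: "frame g m i j k L0 L1 L2" and d: "m j = m i" "m k < m i"
    and s: "is_chamber s" "hcls L0 \<in> s"
  shows "level s < level (ch L0 L1 L2) \<or> level s = level (ch L0 L1 L2) \<and> {hcls L0, hcls L2} \<subseteq> s"
proof -
  obtain g' i' j' k' M N where f': "frame g' m i' j' k' L0 M N" "s = ch L0 M N" using star_frame[OF f s(1,2)] .
  have u: "UNIV = {i, j, k}" "UNIV = {i', j', k'}" using frame_UNIV[OF f] frame_UNIV[OF f'(1)] .
  have l: "level (ch L0 L1 L2) = inversions (m i) (m j) (m k)" "level s = inversions (m i') (m j') (m k')"
    using level_eq[OF f] level_eq[OF f'(1)] f'(2) by simp_all
  show ?thesis
  proof (cases "k' = k")
    case True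
    then have "N = L2" using frame_dominant2[OF f, of g' i' j' M N] f'(1) d by auto
    moreover have "inversions (m i') (m j') (m k') = inversions (m i) (m j) (m k)"
      using perm_cases[OF u] d True by auto
    ultimately show ?thesis using l f'(2) by (auto simp: ch_def)
  next
    case False
    then have "inversions (m i') (m j') (m k') < inversions (m i) (m j) (m k)"
      using perm_cases[OF u] d by (auto simp: inversions_def)
    then show ?thesis using l by simp
  qed
qed

lemma star_flat1:
  assumes f: "frame g m i j k L0 L1 L2" and d: "m j < m i" "m k = m j"
    and s: "is_chamber s" "hcls L0 \<in> s"
  shows "level s < level (ch L0 L1 L2) \<or> level s = level (ch L0 L1 L2) \<and> {hcls L0, hcls L1} \<subseteq> s"
proof -
  obtain g' i' j' k' M N where f': "frame g' m i' j' k' L0 M N" "s = ch L0 M N" using star_frame[OF f s(1,2)] .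
  have u: "UNIV = {i, j, k}" "UNIV = {i', j', k'}" using frame_UNIV[OF f] frame_UNIV[OF f'(1)] .
  have l: "level (ch L0 L1 L2) = inversions (m i) (m j) (m k)" "level s = inversions (m i') (m j') (m k')"
    using level_eq[OF f] level_eq[OF f'(1)] f'(2) by simp_all
  show ?thesis
  proof (cases "i' = i")
    case True
    then have "M = L1" using frame_dominant1[OF f, of g' j' k' M N] f'(1) d by auto
    moreover have "inversions (m i') (m j') (m k') = inversions (m i) (m j) (m k)"
      using perm_cases[OF u] d True by auto
    ultimately show ?thesis using l f'(2) by (auto simp: ch_def)
  next
    case False
    then have "inversions (m i') (m j') (m k') < inversions (m i) (m j) (m k)"
      using perm_cases[OF u] d by (auto simp: inversions_def)
    then show ?thesis using l by simp
  qed
qed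

text \<open>If the exponents at i and j differ, one of the two orders gives a peak. If they agree,
  positive level leaves \<open>m k < m i\<close> or \<open>m i + 1 < m k\<close>. In the former case
  the vertex is \<open>L0\<close>; in the latter it is \<open>L2\<close>, where the rotated type has
  a dominant first entry and two equal ones after it.\<close>

lemma edge_cases:
  assumes e: "is_edge e" and s: "s \<in> Cs e" and pos: "level s > 0"
  shows "(\<exists>s'. peak e s') \<or> (\<exists>L. is_lattice L \<and> hcls L \<in> e \<and>
     (\<forall>s'. is_chamber s' \<and> hcls L \<in> s' \<longrightarrow> level s' < level s \<or> level s' = level s \<and> e \<subseteq> s'))"
proof -
  obtain g m i j k L0 L1 L2 where f: "frame g m i j k L0 L1 L2" "s = ch L0 L1 L2" "e = {hcls L0, hcls L2}"
    using edge_frame[OF e s] .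
  have ne: "i \<noteq> j" "j \<noteq> k" "i \<noteq> k" using triple_distinct[OF frame_UNIV[OF f(1)]] by blast+
  note c = frame_chain[OF f(1)]
  note lats = c[unfolded chain_def]
  have l: "inversions (m i) (m j) (m k) > 0" using pos level_eq[OF f(1)] f(2) by simp
  consider "m j < m i" | "m i < m j" | "m i = m j" "m k < m i" | "m i = m j" "m i + 1 < m k"
    using l by (force simp: inversions_def)
  then show ?thesis
  proof cases
    case 1 then show ?thesis using frame_peak[OF f(1)] f(3) by blast
  next
    case 2 then show ?thesis using frame_peak[OF frame_swap(1)[OF f(1)]] f(3) by blast
  next
    case 3
    then have "\<forall>s'. is_chamber s' \<and> hcls L0 \<in> s' \<longrightarrow> level s' < level s \<or> level s' = level s \<and> e \<subseteq> s'"
      using star_flat2[OF f(1)] f(2,3) by simp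
    then show ?thesis using lats f(3) by blast
  next
    case 4
    note f1 = frame_rot[OF f(1)] note f2 = frame_rot[OF f1]
    have s2: "ch L2 (shl 1 L0) (shl 1 L1) = s" using ch_rot[OF chain_rot[OF c]] ch_rot[OF c] f(2) by simp
    have e2: "{hcls L2, hcls (shl 1 L0)} = e" using f(3) hcls_shl lats by (metis insert_commute)
    have "\<forall>s'. is_chamber s' \<and> hcls L2 \<in> s' \<longrightarrow> level s' < level s \<or> level s' = level s \<and> e \<subseteq> s'"
      using star_flat1[OF f2] 4 ne unfolding s2 e2 by simp
    then show ?thesis using lats f(3) by blast
  qed
qed

text \<open>Two peak edges of \<open>s\<close> give two descents of its type. With the chain started
  at their common vertex the type is strictly decreasing, so \<open>star_strict\<close> applies; an
  edge at this vertex other than the two does not lie on \<open>s\<close>.\<close>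

lemma two_peaks:
  assumes e1: "is_edge e1" "peak e1 s" and e2: "is_edge e2" "peak e2 s" and ne: "e1 \<noteq> e2"
  shows "\<exists>L. is_lattice L \<and> hcls L \<in> e1 \<and> hcls L \<in> e2 \<and>
     (\<forall>e. is_edge e \<and> hcls L \<in> e \<and> e \<noteq> e1 \<and> e \<noteq> e2 \<longrightarrow> (\<forall>s'\<in>Cs e. level s' < level s))"
proof -
  have main: ?thesis if f: "frame g m i j k L0 L1 L2" "s = ch L0 L1 L2" and d: "m j < m i" "m k < m j"
    and ee: "{e1, e2} = {{hcls L0, hcls L2}, {hcls L0, hcls L1}}" for g m i j k L0 L1 L2
  proof -
    note c = frame_chain[OF f(1)]
    have L0: "is_lattice L0" using c chain_def by blast
    have "level s' < level s" if h: "is_edge e" "hcls L0 \<in> e" "e \<noteq> e1" "e \<noteq> e2" "s' \<in> Cs e" for e s'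
    proof -
      have "s' \<noteq> s"
      proof
        assume "s' = s"
        then have es: "e \<subseteq> s" using h(5) by (simp add: Cs_def)
        obtain X where X: "is_lattice X" "X \<subset> L0" "shl 1 L0 \<subset> X" "e = {hcls L0, hcls X}" using edge_at[OF h(1) L0 h(2)] .
        have "hcls X \<in> ch L0 L1 L2" using es X(4) f(2) by simp
        then have "X = L1 \<or> X = L2"
          using edge_dg[OF X(1) L0 X(2,3)] chain_mem(2,3)[OF c X(1)] by blast
        then show False using X(4) h(3,4) ee by (metis doubleton_eq_iff)
      qed
      moreover have "is_chamber s'" "hcls L0 \<in> s'" using h(5,2) by (auto simp: Cs_def)
      ultimately show ?thesis using star_strict[OF f(1) d] f(2) by simp
    qed
    moreover have "hcls L0 \<in> e1" "hcls L0 \<in> e2" using ee by (metis doubleton_eq_iff insertI1)+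
    ultimately show ?thesis using L0 by blast
  qed
  obtain g m i j k L0 L1 L2 where f: "frame g m i j k L0 L1 L2" "s = ch L0 L1 L2" "e1 = {hcls L0, hcls L2}"
    using edge_frame[OF e1(1)] e1(2) peak_def by metis
  have nn: "i \<noteq> j" "j \<noteq> k" "i \<noteq> k" using triple_distinct[OF frame_UNIV[OF f(1)]] by blast+
  note f1 = frame_rot[OF f(1)] note f2 = frame_rot[OF f1]
  note c = frame_chain[OF f(1)] note c1 = chain_rot[OF c]
  note lats = c[unfolded chain_def]
  have d1: "m j < m i" using peak_frame[OF f(1)] e1(2) f(2,3) by simp
  have s1: "s = ch L1 L2 (shl 1 L0)" using f(2) ch_rot[OF c] by simp
  have s2: "s = ch L2 (shl 1 L0) (shl 1 L1)" using s1 ch_rot[OF c1] by simp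
  have h: "hcls (shl 1 L0) = hcls L0" "hcls (shl 1 L1) = hcls L1" using lats hcls_shl by blast+
  have e2s: "e2 \<subseteq> s" using e2(2) by (simp add: peak_def Cs_def)
  have "\<exists>A B. e2 = {A, B} \<and> A \<noteq> B"
  proof -
    obtain A where A: "is_lattice A" "hcls A \<in> e2" using e2(1) is_edge_def by blast
    obtain X where X: "is_lattice X" "X \<subset> A" "shl 1 A \<subset> X" "e2 = {hcls A, hcls X}" using edge_at[OF e2(1) A] .
    have "hcls A \<noteq> hcls X"
    proof
      assume "hcls A = hcls X"
      then obtain t where "X = shl t A" using hcls_eq_iff A(1) X(1) by blast
      then have "dg X = dg A + 3 * t" using dg_shl A(1) by blast
      then show False using edge_dg[OF X(1) A(1) X(2,3)] by presburger
    qed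
    then show ?thesis using X(4) by blast
  qed
  then obtain A B where AB: "e2 = {A, B}" "A \<noteq> B" by blast
  have "A \<in> {hcls L0, hcls L1, hcls L2}" "B \<in> {hcls L0, hcls L1, hcls L2}"
    using e2s AB(1) f(2) by (auto simp: ch_def)
  then have "e2 = {hcls L0, hcls L1} \<or> e2 = {hcls L1, hcls L2}"
    using ne AB f(3) by (auto simp: doubleton_eq_iff)
  then consider "e2 = {hcls L0, hcls L1}" | "e2 = {hcls L1, hcls L2}" by blast
  then show ?thesis
  proof cases
    case 1
    then have "peak {hcls L1, hcls (shl 1 L0)} (ch L1 L2 (shl 1 L0))" using e2(2) h s1 by (metis insert_commute)
    then have "m k < m j" using peak_frame[OF f1] nn by simp
    then show ?thesis using main[OF f(1,2) d1] f(3) 1 by blast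
  next
    case 2
    then have "peak {hcls L2, hcls (shl 1 L1)} (ch L2 (shl 1 L0) (shl 1 L1))" using e2(2) h s2 by (metis insert_commute)
    then have d2: "m i + 1 < m k" using peak_frame[OF f2] nn by simp
    have "{e1, e2} = {{hcls L2, hcls (shl 1 L1)}, {hcls L2, hcls (shl 1 L0)}}"
      unfolding f(3) 2 h by (simp only: insert_commute)
    then show ?thesis using main[OF f2 s2] d1 d2 nn by simp
  qed
qed

section \<open>Extension from level zero and uniqueness\<close>

definition harmonic_at :: "('k::field bt_simplex \<Rightarrow> 'v::ab_group_add) \<Rightarrow> 'k bt_simplex \<Rightarrow> bool" where
  "harmonic_at c e \<longleftrightarrow> sum c (Cs e) = 0"

text \<open>The recursion common to chambers of the building and flags at the standard vertex. With
  \<open>D s\<close> the other members of a chosen descending edge, it makes the sum over that edge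
  vanish.\<close>

lemma well_founded_extension:
  fixes lv :: "'s \<Rightarrow> nat" and b :: "'s \<Rightarrow> 'v::ab_group_add" and D :: "'s \<Rightarrow> 's set"
  assumes dec: "\<And>s s'. lv s > 0 \<Longrightarrow> s' \<in> D s \<Longrightarrow> lv s' < lv s"
  shows "\<exists>c. \<forall>s. c s = (if lv s = 0 then b s else - sum c (D s))"
proof -
  define F where "F = (\<lambda>(f :: 's \<Rightarrow> 'v) s. if lv s = 0 then b s else - sum f (D s))"
  define c where "c = wfrec (inv_image less_than lv) F"
  have "c s = F c s" for s
  proof -
    have "c s = F (cut c (inv_image less_than lv) s) s" unfolding c_def by (rule wfrec) simp
    also have "\<dots> = F c s"
      using dec[of s] by (auto simp: F_def cut_def intro!: sum.cong)
    finally show ?thesis .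
  qed
  then show ?thesis unfolding F_def by blast
qed

text \<open>The recursion enforces harmonicity only at the chosen edges \<open>ce s\<close>. In the
  induction on the maximal level of an edge, other peak edges are handled by
  \<open>two_peaks\<close> and edges without a peak by \<open>edge_cases\<close>; each time
  \<open>star_sum\<close> is used at a vertex whose remaining edges are already harmonic.\<close>

theorem harmonic_extension:
  fixes b :: "'k::{field,finite} bt_simplex \<Rightarrow> 'v::ab_group_add"
  assumes base: "\<And>e. is_edge e \<Longrightarrow> (\<forall>s\<in>Cs e. level s = 0) \<Longrightarrow> harmonic_at b e"
    and nch: "\<And>s. \<not> is_chamber s \<Longrightarrow> b s = 0"
  shows "\<exists>c. (\<forall>s. is_chamber s \<and> level s = 0 \<longrightarrow> c s = b s) \<and> (\<forall>s. \<not> is_chamber s \<longrightarrow> c s = 0)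
     \<and> (\<forall>e. is_edge e \<longrightarrow> harmonic_at c e)"
proof -
  define ce where "ce s = (SOME e. is_edge e \<and> peak e s)" for s :: "'k bt_simplex"
  have ce: "is_edge (ce s)" "peak (ce s) s" if "is_chamber s" "level s > 0" for s
    using someI_ex[OF ex_peak[OF that]] unfolding ce_def by blast+
  \<comment> \<open>Level 0 off the chambers lets the recursion return \<open>b\<close> there, which
    vanishes by \<open>nch\<close>.\<close>
  let ?lv = "\<lambda>s. if is_chamber s then level s else 0"
  obtain c where c: "\<And>s. c s = (if ?lv s = 0 then b s else - sum c (Cs (ce s) - {s}))"
  proof -
    have "\<exists>c. \<forall>s. c s = (if ?lv s = 0 then b s else - sum c (Cs (ce s) - {s}))"
    proof (rule well_founded_extension)
      fix s s' :: "'k bt_simplex" assume "?lv s > 0" "s' \<in> Cs (ce s) - {s}"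
      then show "?lv s' < ?lv s" using ce[of s] by (auto simp: peak_def split: if_splits)
    qed
    then show thesis using that by blast
  qed
  have Hce: "harmonic_at c (ce s)" if h: "is_chamber s" "level s > 0" for s
  proof -
    have "s \<in> Cs (ce s)" using ce(2)[OF h] by (simp add: peak_def)
    then have "sum c (Cs (ce s)) = c s + sum c (Cs (ce s) - {s})"
      by (rule sum.remove[OF finite_Cs[OF ce(1)[OF h]]])
    then show ?thesis using c[of s] h by (simp add: harmonic_at_def)
  qed
  have main: "\<forall>e. is_edge e \<and> (\<forall>s\<in>Cs e. level s \<le> n) \<longrightarrow> harmonic_at c e" for n
  proof (induction n)
    case 0
    have "harmonic_at c e" if h: "is_edge e" "\<forall>s\<in>Cs e. level s = 0" for e
    proof -
      have "sum c (Cs e) = sum b (Cs e)" using h(2) c by (intro sum.cong) auto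
      then show ?thesis using base[OF h] by (simp add: harmonic_at_def)
    qed
    then show ?case by simp
  next
    case (Suc n)
    have IH: "harmonic_at c e" if "is_edge e" "\<forall>s\<in>Cs e. level s < Suc n" for e
      using Suc that by (auto simp: less_Suc_eq_le)
    have sp: "harmonic_at c e" if h: "is_edge e" "peak e s" "level s = Suc n" for e s
    proof (cases "e = ce s")
      case True
      have "is_chamber s" using h(2) by (simp add: peak_def Cs_def)
      then show ?thesis using Hce h(3) True by simp
    next
      case False
      have s: "is_chamber s" "level s > 0" using h by (auto simp: peak_def Cs_def)
      obtain L where L: "is_lattice L" "hcls L \<in> e" "hcls L \<in> ce s"
        "\<forall>e'. is_edge e' \<and> hcls L \<in> e' \<and> e' \<noteq> e \<and> e' \<noteq> ce s \<longrightarrow> (\<forall>s'\<in>Cs e'. level s' < level s)"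
        using two_peaks[OF h(1,2) ce[OF s] False] by blast
      have "sum c (Cs e') = 0" if e': "is_edge e'" "hcls L \<in> e'" "e' \<noteq> e" for e'
      proof (cases "e' = ce s")
        case True then show ?thesis using Hce[OF s] by (simp add: harmonic_at_def)
      next
        case False
        then show ?thesis using L(4) e' h(3) IH[OF e'(1)] by (simp add: harmonic_at_def)
      qed
      then show ?thesis using star_sum[OF L(1) h(1) L(2), of c] by (simp add: harmonic_at_def)
    qed
    show ?case
    proof (intro allI impI)
      fix e :: "'k bt_simplex" assume h: "is_edge e \<and> (\<forall>s\<in>Cs e. level s \<le> Suc n)"
      show "harmonic_at c e"
      proof (cases "\<exists>s\<in>Cs e. level s = Suc n")
        case False
        then show ?thesis using h IH by (metis le_neq_implies_less)
      next
        case True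
        then obtain s where s: "s \<in> Cs e" "level s = Suc n" by blast
        consider s' where "peak e s'"
          | L where "is_lattice L" "hcls L \<in> e"
            "\<forall>s'. is_chamber s' \<and> hcls L \<in> s' \<longrightarrow> level s' < level s \<or> level s' = level s \<and> e \<subseteq> s'"
          using edge_cases[of e s] h s by auto
        then show ?thesis
        proof cases
          case 1
          have "level s' = Suc n"
          proof -
            have "level s' \<le> Suc n" using 1 h by (auto simp: peak_def)
            moreover have "Suc n \<le> level s'" using 1 s by (cases "s = s'") (auto simp: peak_def)
            ultimately show ?thesis by simp
          qed
          then show ?thesis using sp 1 h by blast
        next
          case 2
          have "sum c (Cs e') = 0" if e': "is_edge e'" "hcls L \<in> e'" "e' \<noteq> e" for e'
          proof (cases "\<exists>s'\<in>Cs e'. level s' = Suc n")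
            case False
            have "level s' < Suc n" if "s' \<in> Cs e'" for s'
              using that False 2(3) e'(2) s(2) by (auto simp: Cs_def)
            then show ?thesis using IH[OF e'(1)] by (simp add: harmonic_at_def)
          next
            case True
            then obtain s1 where s1: "s1 \<in> Cs e'" "level s1 = Suc n" by blast
            obtain X where X: "is_lattice X" "X \<subset> L" "shl 1 L \<subset> X" "e = {hcls L, hcls X}"
              using edge_at[of e L] h 2 by blast
            obtain Y where Y: "is_lattice Y" "Y \<subset> L" "shl 1 L \<subset> Y" "e' = {hcls L, hcls Y}"
              using edge_at[of e' L] e' 2 by blast
            \<comment> \<open>By the choice of \<open>L\<close>, every chamber of top level at
              \<open>L\<close> contains \<open>e\<close>. Two different edges at \<open>L\<close>
              determine the chamber, so \<open>e'\<close> carries just one chamber of top level and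
              has a peak there.\<close>
            have eq: "s2 = s1" if s2: "s2 \<in> Cs e'" "level s2 = Suc n" for s2
            proof -
              have sub: "e \<subseteq> s1" "e' \<subseteq> s1" "e \<subseteq> s2" "e' \<subseteq> s2" "is_chamber s1" "is_chamber s2"
                using s1 s2 2(3) e'(2) s(2) by (auto simp: Cs_def)
              obtain M N where MN: "chain L M N" "s1 = ch L M N" using chamber_chain_at[OF sub(5) 2(1)] sub(1) 2(2) by blast
              obtain M' N' where MN': "chain L M' N'" "s2 = ch L M' N'" using chamber_chain_at[OF sub(6) 2(1)] sub(3) 2(2) by blast
              have m: "hcls X \<in> ch L M N" "hcls Y \<in> ch L M N" "hcls X \<in> ch L M' N'" "hcls Y \<in> ch L M' N'"
                using sub X(4) Y(4) MN(2) MN'(2) by auto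
              have "X \<noteq> Y" using X(4) Y(4) e'(3) by blast
              then have "M = M' \<and> N = N'"
                using edge_dg[OF X(1) 2(1) X(2,3)] edge_dg[OF Y(1) 2(1) Y(2,3)]
                  chain_mem(2,3)[OF MN(1) X(1) m(1)] chain_mem(2,3)[OF MN(1) Y(1) m(2)]
                  chain_mem(2,3)[OF MN'(1) X(1) m(3)] chain_mem(2,3)[OF MN'(1) Y(1) m(4)] by metis
              then show ?thesis using MN MN' by simp
            qed
            have "level s2 < level s1" if "s2 \<in> Cs e'" "s2 \<noteq> s1" for s2
              using that eq[of s2] 2(3) e'(2) s(2) s1(2) by (auto simp: Cs_def)
            then have "peak e' s1" using s1 by (auto simp: peak_def)
            then show ?thesis using sp[OF e'(1) _ s1(2)] by (simp add: harmonic_at_def)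
          qed
          then show ?thesis using star_sum[of L e c] 2 h by (simp add: harmonic_at_def)
        qed
      qed
    qed
  qed
  have "harmonic_at c e" if e: "is_edge e" for e
  proof -
    have "\<forall>s\<in>Cs e. level s \<le> Max (level ` Cs e)" using finite_Cs[OF e] by auto
    then show ?thesis using main e by blast
  qed
  moreover have "c s = b s" if "is_chamber s \<and> level s = 0" for s using c[of s] that by simp
  moreover have "c s = 0" if "\<not> is_chamber s" for s using c[of s] that nch by simp
  ultimately show ?thesis by blast
qed

theorem harmonic_unique:
  fixes c :: "'k::{field,finite} bt_simplex \<Rightarrow> 'v::ab_group_add"
  assumes c: "harmonic c" and z: "\<And>s. is_chamber s \<Longrightarrow> level s = 0 \<Longrightarrow> c s = 0"
  shows "c = (\<lambda>_. 0)"
proof -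
  have H: "sum c (Cs e) = 0" if "is_edge e" for e using c that by (simp add: harmonic_def Cs_def)
  have "is_chamber s \<longrightarrow> c s = 0" for s
  proof (induction "level s" arbitrary: s rule: less_induct)
    case less
    show ?case
    proof (cases "is_chamber s \<and> level s > 0")
      case True
      then obtain e where e: "is_edge e" "peak e s" using ex_peak by blast
      have "c s' = 0" if "s' \<in> Cs e - {s}" for s'
        using less[of s'] e(2) that by (auto simp: peak_def Cs_def)
      then have "sum c (Cs e - {s}) = 0" by (simp add: sum.neutral)
      moreover have "s \<in> Cs e" using e(2) peak_def by blast
      ultimately show ?thesis using sum.remove[OF finite_Cs[OF e(1)], of s c] H[OF e(1)] by simp
    qed (use z in auto)
  qed
  then show ?thesis using c by (auto simp: harmonic_def fun_eq_iff)
qed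

section \<open>The action of the arithmetic group\<close>

lemma ev_inf_pCons: "ev_inf (pCons a p) = fls_const a + fls_X_inv * ev_inf p"
  by (simp add: ev_inf_def map_poly_pCons)

lemma ev_inf_0 [simp]: "ev_inf 0 = 0"
  by (simp add: ev_inf_def)

lemma ev_inf_nth: "ev_inf p $$ k = (if k \<le> 0 then coeff p (nat (- k)) else 0)"
proof (induction p arbitrary: k)
  case (pCons a p)
  have "ev_inf (pCons a p) $$ k = (if k = 0 then a else 0) + ev_inf p $$ (k + 1)"
    by (simp add: ev_inf_pCons fls_X_inv_times_conv_shift(1))
  also have "\<dots> = (if k \<le> 0 then coeff (pCons a p) (nat (- k)) else 0)"
  proof -
    have "nat (- k) = Suc (nat (- (k + 1)))" if "k < 0" using that by simp
    then show ?thesis by (auto simp: pCons.IH coeff_pCons split: nat.split)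
  qed
  finally show ?case .
qed simp

lemma ev_inf_AA: "ev_inf p \<in> AA"
  by (simp add: AA_def ev_inf_nth)

lemma ev_inf_inj: "ev_inf p = ev_inf q \<longleftrightarrow> p = q"
proof
  assume *: "ev_inf p = ev_inf q"
  have "coeff p n = coeff q n" for n
    using arg_cong[OF *, of "\<lambda>x. x $$ (- int n)"] by (simp add: ev_inf_nth)
  then show "p = q" by (simp add: poly_eq_iff)
qed simp

lemma AA_eq: "AA = range ev_inf"
proof (intro equalityI subsetI)
  fix x :: "'a fls" assume x: "x \<in> AA"
  let ?n = "nat (- fls_subdegree x)"
  define p where "p = (\<Sum>n\<le>?n. monom (x $$ (- int n)) n)"
  have cp: "coeff p n = x $$ (- int n)" for n
  proof -
    have "coeff p n = (if n \<le> ?n then x $$ (- int n) else 0)"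
      by (simp add: p_def coeff_sum)
    also have "\<dots> = x $$ (- int n)"
      by (auto intro!: fls_eq0_below_subdegree[symmetric])
    finally show ?thesis .
  qed
  have "x = ev_inf p"
    using x by (intro fls_eqI) (auto simp: ev_inf_nth cp AA_def)
  then show "x \<in> range ev_inf" by blast
qed (auto simp: ev_inf_AA)

lemma ev_inf_add: "ev_inf (p + q) = ev_inf p + ev_inf q"
  by (rule fls_eqI) (simp add: ev_inf_nth)

lemma ev_inf_smult: "ev_inf (smult a q) = fls_const a * ev_inf q"
  by (rule fls_eqI) (simp add: ev_inf_nth)

lemma ev_inf_mult: "ev_inf (p * q) = ev_inf p * ev_inf q"
proof (induction p)
  case (pCons a p)
  then show ?case by (simp add: ev_inf_add ev_inf_smult ev_inf_pCons algebra_simps)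
qed simp

lemma ev_inf_const [simp]: "ev_inf [:a:] = fls_const a"
  by (simp add: ev_inf_pCons)

lemma ev_inf_1 [simp]: "ev_inf 1 = 1"
  by (simp add: one_pCons)

lemma ev_inf_eq_0 [simp]: "ev_inf p = 0 \<longleftrightarrow> p = 0"
  using ev_inf_inj[of p 0] by simp

text \<open>This justifies the description operator in \<open>emb\<close>: equality of fractions is
  equality of cross products, which \<open>ev_inf\<close> preserves.\<close>

lemma emb_Fract:
  assumes "b \<noteq> 0"
  shows "emb (Fract a b) = ev_inf a / ev_inf b"
proof -
  have "ev_inf a / ev_inf b = ev_inf a' / ev_inf b'" if "b' \<noteq> 0" "Fract a b = Fract a' b'" for a' b'
  proof -
    have "a * b' = a' * b" using that assms by (simp add: eq_fract)
    then have "ev_inf a * ev_inf b' = ev_inf a' * ev_inf b" by (metis ev_inf_mult)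
    then show ?thesis using that assms by (simp add: frac_eq_eq)
  qed
  then have *: "\<forall>a' b'. b' \<noteq> 0 \<longrightarrow> Fract a b = Fract a' b' \<longrightarrow> ev_inf a / ev_inf b = ev_inf a' / ev_inf b'" by blast
  show ?thesis unfolding emb_def
  proof (rule the_equality)
    show "\<forall>a' b'. b' \<noteq> 0 \<longrightarrow> Fract a b = Fract a' b' \<longrightarrow> ev_inf a / ev_inf b = ev_inf a' / ev_inf b'" by (rule *)
    fix y assume "\<forall>a' b'. b' \<noteq> 0 \<longrightarrow> Fract a b = Fract a' b' \<longrightarrow> y = ev_inf a' / ev_inf b'"
    then show "y = ev_inf a / ev_inf b" using assms by blast
  qed
qed

lemma emb_A_of [simp]: "emb (A_of p) = ev_inf p"
  by (simp add: A_of_def emb_Fract)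

lemma emb_0 [simp]: "emb 0 = 0" and emb_1 [simp]: "emb 1 = 1"
  by (simp_all add: Zero_fract_def One_fract_def emb_Fract)

lemma emb_add: "emb (x + y) = emb x + emb y"
proof -
  obtain a b where x: "x = Fract a b" "b \<noteq> 0" by (cases x)
  obtain c d where y: "y = Fract c d" "d \<noteq> 0" by (cases y)
  show ?thesis using x y by (simp add: emb_Fract ev_inf_add ev_inf_mult add_frac_eq)
qed

lemma emb_mult: "emb (x * y) = emb x * emb y"
proof -
  obtain a b where x: "x = Fract a b" "b \<noteq> 0" by (cases x)
  obtain c d where y: "y = Fract c d" "d \<noteq> 0" by (cases y)
  show ?thesis using x y by (simp add: emb_Fract ev_inf_mult)
qed

lemma emb_eq_0: "emb x = 0 \<longleftrightarrow> x = 0"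
proof -
  obtain a b where x: "x = Fract a b" "b \<noteq> 0" by (cases x)
  show ?thesis using x by (simp add: emb_Fract eq_fract Zero_fract_def)
qed

lemma emb_inj: "emb x = emb y \<longleftrightarrow> x = y"
proof
  assume *: "emb x = emb y"
  have "emb (x - y) + emb y = emb x" using emb_add[of "x - y" y] by simp
  then show "x = y" using * emb_eq_0[of "x - y"] by simp
qed simp

lemma emb_sum: "emb (sum f S) = (\<Sum>i\<in>S. emb (f i))"
  by (induction S rule: infinite_finite_induct) (auto simp: emb_add)

lemma emb_mat_nth [simp]: "emb_mat g $ i $ j = emb (g $ i $ j)"
  by (simp add: emb_mat_def)

lemma emb_mat_mult: "emb_mat (g ** h) = emb_mat g ** emb_mat h"
  by (simp add: vec_eq_iff matrix_matrix_mult_def emb_sum emb_mult)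

lemma emb_mat_1 [simp]: "emb_mat (mat 1) = mat 1"
  by (simp add: vec_eq_iff mat_def)

lemma emb_mat_inj: "emb_mat g = emb_mat h \<longleftrightarrow> g = h"
  by (simp add: vec_eq_iff emb_inj)

lemma emb_mat_inv: "invertible g \<Longrightarrow> emb_mat (matrix_inv g) = matrix_inv (emb_mat g)"
  by (rule matrix_inv_unique[symmetric]) (metis emb_mat_1 emb_mat_mult invertible_inv)

lemma emb_mat_invertible: "invertible g \<Longrightarrow> invertible (emb_mat g)"
  unfolding invertible_right_inverse by (metis emb_mat_1 emb_mat_mult)

section \<open>GL_3(A), Gamma(t) and constant matrices\<close>

lemma GA_polys:
  assumes "h \<in> GA"
  obtains P where "h = emb_mat (\<chi> i j. A_of (P i j))"
proof -
  have "\<exists>p. h $ i $ j = ev_inf p" for i j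
  proof -
    have "h $ i $ j \<in> AA" using assms by (simp add: GA_def)
    then show ?thesis unfolding AA_eq by blast
  qed
  then obtain P where "\<And>i j. h $ i $ j = ev_inf (P i j)" by metis
  then show thesis by (intro that[of P]) (simp add: vec_eq_iff)
qed

lemma GL3A_emb:
  assumes "g \<in> GL3A" shows "emb_mat g \<in> GA"
proof -
  have i: "invertible g" using assms by (simp add: GL3A_def)
  have r: "emb x \<in> AA" if "x \<in> range A_of" for x :: "'a Fld" using that ev_inf_AA by auto
  show ?thesis unfolding GA_def
    using assms emb_mat_invertible[OF i] emb_mat_inv[OF i, symmetric] r by (simp add: GL3A_def)
qed

lemma emb_GL3A:
  assumes "emb_mat g \<in> GA" shows "g \<in> GL3A"
proof -
  obtain h where h: "emb_mat h = matrix_inv (emb_mat g)" using GA_polys[OF GA_inv[OF assms]] by metis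
  have "emb_mat (g ** h) = emb_mat (mat 1)"
    using h GA_invertible[OF assms] by (simp add: emb_mat_mult invertible_inv)
  then have gh: "g ** h = mat 1" by (simp only: emb_mat_inj)
  have r: "x \<in> range A_of" if "emb x \<in> AA" for x :: "'a Fld"
    using that emb_A_of emb_inj unfolding AA_eq by (metis rangeE rangeI)
  show ?thesis unfolding GL3A_def
    using matrix_inv_unique[OF gh] gh invertible_right_inverse[of g] r assms h
    by (auto simp: GA_def emb_mat_nth[symmetric] simp del: emb_mat_nth)
qed

lemma GL3A_iff: "g \<in> GL3A \<longleftrightarrow> emb_mat g \<in> GA"
  using GL3A_emb emb_GL3A by blast

lemma GA_emb: "h \<in> GA \<Longrightarrow> \<exists>g\<in>GL3A. emb_mat g = h"
proof -
  assume h: "h \<in> GA"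
  obtain P where "h = emb_mat (\<chi> i j. A_of (P i j))" using GA_polys[OF h] .
  then show ?thesis using h GL3A_iff by metis
qed

lemma GL3A_invertible: "g \<in> GL3A \<Longrightarrow> invertible g"
  by (simp add: GL3A_def)

lemma GL3A_mult: "g \<in> GL3A \<Longrightarrow> h \<in> GL3A \<Longrightarrow> g ** h \<in> GL3A"
  by (simp add: GL3A_iff emb_mat_mult GA_mult)

lemma GL3A_inv: "g \<in> GL3A \<Longrightarrow> matrix_inv g \<in> GL3A"
  using GL3A_invertible[of g] GA_inv[of "emb_mat g"] emb_mat_inv[of g] GL3A_iff by metis

lemma GL3A_one: "mat 1 \<in> GL3A"
  by (simp add: GL3A_iff GA_one)

text \<open>On \<open>AA\<close> the coefficient of exponent 0 is the value at t = 0, whereas on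
  O_inf the same coefficient is reduction modulo pi. This makes \<open>red\<close> reduction modulo
  t.\<close>

lemma AA_mult_nth0:
  assumes "x \<in> AA" "y \<in> AA"
  shows "(x * y) $$ 0 = x $$ 0 * y $$ 0"
proof -
  obtain p q where pq: "x = ev_inf p" "y = ev_inf q" using assms AA_eq by blast
  then have "x * y = ev_inf (p * q)" by (simp add: ev_inf_mult)
  then show ?thesis using pq by (simp add: ev_inf_nth coeff_mult_0)
qed

definition red :: "'k::field fls ^ 3 ^ 3 \<Rightarrow> 'k ^ 3 ^ 3" where
  "red g = (\<chi> i j. g $ i $ j $$ 0)"

lemma red_mult: "g \<in> GA \<Longrightarrow> h \<in> GA \<Longrightarrow> red (g ** h) = red g ** red h"
  by (simp add: red_def vec_eq_iff matrix_matrix_mult_def nth_sum AA_mult_nth0 GA_def)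

lemma red_1 [simp]: "red (mat 1) = mat 1"
  by (simp add: red_def vec_eq_iff mat_def)

lemma Gamma_t_iff: "g \<in> Gamma_t \<longleftrightarrow> g \<in> GL3A \<and> red (emb_mat g) = mat 1"
proof -
  have "(\<exists>p. g $ i $ j = A_of p \<and> poly p 0 = (if i = j then 1 else 0)) \<longleftrightarrow>
      red (emb_mat g) $ i $ j = (if i = j then 1 else 0)" if "g \<in> GL3A" for i j
  proof -
    have "g $ i $ j \<in> range A_of" using \<open>g \<in> GL3A\<close> by (simp add: GL3A_def)
    then obtain p where p: "g $ i $ j = A_of p" by blast
    have "A_of p = A_of q \<longleftrightarrow> p = q" for q using emb_A_of emb_inj ev_inf_inj by metis
    then show ?thesis using p by (simp add: red_def ev_inf_nth poly_0_coeff_0)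
  qed
  then have "(\<forall>i j. \<exists>p. g $ i $ j = A_of p \<and> poly p 0 = (if i = j then 1 else 0)) \<longleftrightarrow>
      red (emb_mat g) = mat 1" if "g \<in> GL3A"
    using that unfolding vec_eq_iff mat_def by (simp only: vec_lambda_beta)
  then show ?thesis unfolding Gamma_t_def by blast
qed

lemma Gamma_t_GL3A: "g \<in> Gamma_t \<Longrightarrow> g \<in> GL3A"
  by (simp add: Gamma_t_def)

lemma Gamma_t_mult: "g \<in> Gamma_t \<Longrightarrow> h \<in> Gamma_t \<Longrightarrow> g ** h \<in> Gamma_t"
  by (simp add: Gamma_t_iff GL3A_mult emb_mat_mult red_mult GL3A_emb)

lemma Gamma_t_one: "mat 1 \<in> Gamma_t"
  by (simp add: Gamma_t_iff GL3A_one)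

lemma red_inv: "g \<in> GA \<Longrightarrow> red g ** red (matrix_inv g) = mat 1"
  using red_mult[of g "matrix_inv g"] by (simp add: GA_inv GA_invertible invertible_inv)

lemma Gamma_t_inv: "g \<in> Gamma_t \<Longrightarrow> matrix_inv g \<in> Gamma_t"
  using red_inv[of "emb_mat g"] by (simp add: Gamma_t_iff GL3A_inv emb_mat_inv GL3A_invertible GL3A_emb)

lemma Gamma_t_conj:
  assumes "g \<in> GL3A" "h \<in> Gamma_t"
  shows "g ** h ** matrix_inv g \<in> Gamma_t"
  using assms red_inv[of "emb_mat g"]
  by (simp add: Gamma_t_iff GL3A_mult GL3A_inv emb_mat_mult emb_mat_inv GL3A_invertible red_mult GL3A_emb GA_mult GA_inv)

definition lift_mat :: "'k::field ^ 3 ^ 3 \<Rightarrow> 'k Fld ^ 3 ^ 3" where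
  "lift_mat k = (\<chi> i j. A_of [:k $ i $ j:])"

lemma emb_lift: "emb_mat (lift_mat k) = (\<chi> i j. fls_const (k $ i $ j))"
  by (simp add: vec_eq_iff lift_mat_def)

lemma fls_const_sum: "fls_const (sum f S) = (\<Sum>i\<in>S. fls_const (f i))"
  by (induction S rule: infinite_finite_induct) (auto simp: fls_plus_const[symmetric])

lemma lift_mat_mult: "lift_mat (k ** l) = lift_mat k ** lift_mat l"
proof -
  have "emb_mat (lift_mat (k ** l)) = emb_mat (lift_mat k ** lift_mat l)"
    unfolding emb_mat_mult emb_lift by (simp add: vec_eq_iff matrix_matrix_mult_def fls_const_sum)
  then show ?thesis by (simp only: emb_mat_inj)
qed

lemma lift_mat_1: "lift_mat (mat 1) = mat 1"
proof -
  have "emb_mat (lift_mat (mat 1 :: 'a ^ 3 ^ 3)) = emb_mat (mat 1)"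
    unfolding emb_lift by (simp add: vec_eq_iff mat_def)
  then show ?thesis by (simp only: emb_mat_inj)
qed

lemma det_lift: "det (emb_mat (lift_mat k)) = fls_const (det k)"
  unfolding emb_lift by (simp add: det_3 fls_plus_const[symmetric] fls_minus_const[symmetric])

lemma lift_GL3A:
  assumes "invertible k"
  shows "lift_mat k \<in> GL3A"
proof -
  have "lift_mat k ** lift_mat (matrix_inv k) = mat 1"
    using assms by (simp add: lift_mat_mult[symmetric] invertible_inv lift_mat_1)
  then have "emb_mat (lift_mat k) ** emb_mat (lift_mat (matrix_inv k)) = mat 1"
    by (metis emb_mat_1 emb_mat_mult)
  then have "emb_mat (lift_mat k) \<in> GA"
    by (rule GA_I) (auto simp: emb_lift AA_def)
  then show ?thesis by (simp add: GL3A_iff)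
qed

lemma GL3Fq_lift:
  assumes "g \<in> GL3Fq"
  obtains k where "invertible k" "g = lift_mat k"
proof -
  have "\<forall>i j. \<exists>a. g $ i $ j = A_of [:a:]" using assms by (simp add: GL3Fq_def)
  then obtain K where "\<And>i j. g $ i $ j = A_of [:K i j:]" by metis
  then have g: "g = lift_mat (\<chi> i j. K i j)" by (simp add: vec_eq_iff lift_mat_def)
  have "invertible (emb_mat g)" using assms by (simp add: GL3Fq_def emb_mat_invertible)
  then have "invertible ((\<chi> i j. K i j) :: 'a ^ 3 ^ 3)"
    unfolding invertible_det_nz g det_lift by simp
  then show thesis using that g by blast
qed

lemma GL3Fq_GL3A: "g \<in> GL3Fq \<Longrightarrow> g \<in> GL3A"
  using GL3Fq_lift lift_GL3A by metis

lemma const_mat_std: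
  assumes "g \<in> GL3Fq"
  shows "app (emb_mat g) std_lattice = std_lattice"
proof -
  obtain k where k: "invertible k" "g = lift_mat k" using GL3Fq_lift[OF assms] .
  have "imat (emb_mat g)" unfolding k(2) emb_lift by (simp add: imat_def)
  moreover have "vdet (emb_mat g) = 0" using GL3A_emb[OF GL3Fq_GL3A[OF assms]] by (rule GA_vdet)
  ultimately show ?thesis using imat_vdet_0 GA_invertible[OF GL3A_emb[OF GL3Fq_GL3A[OF assms]]] by blast
qed

text \<open>Constant matrices split the reduction modulo t, so GL_3(A) is the semidirect product of
  Gamma(t) and GL_3(F_q).\<close>

lemma GL3A_decomp:
  assumes "g \<in> GL3A"
  obtains u k where "u \<in> Gamma_t" "k \<in> GL3Fq" "g = u ** k"
proof -
  have G: "emb_mat g \<in> GA" using assms GL3A_emb by blast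
  let ?r = "red (emb_mat g)"
  have r: "invertible ?r" using red_inv[OF G] invertible_right_inverse by blast
  let ?k = "lift_mat ?r"
  have k: "?k \<in> GL3A" by (rule lift_GL3A[OF r])
  have ki: "invertible ?k" using k GL3A_invertible by blast
  have kF: "?k \<in> GL3Fq" using ki by (auto simp: GL3Fq_def lift_mat_def)
  have rk: "red (emb_mat ?k) = ?r" unfolding emb_lift by (simp add: red_def vec_eq_iff)
  let ?u = "g ** matrix_inv ?k"
  have "red (emb_mat ?u) = ?r ** red (matrix_inv (emb_mat ?k))"
    using k G by (simp add: emb_mat_mult emb_mat_inv ki red_mult GA_inv GL3A_emb)
  also have "\<dots> = mat 1" using red_inv[OF GL3A_emb[OF k]] rk by simp
  finally have "?u \<in> Gamma_t" using assms k by (simp add: Gamma_t_iff GL3A_mult GL3A_inv)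
  moreover have "g = ?u ** ?k" using ki by (simp add: matrix_mul_assoc[symmetric] invertible_inv)
  ultimately show thesis using that kF by blast
qed

section \<open>Action on simplices\<close>

lemma app_scale_lat: "app g (scale_lat c L) = scale_lat c (app g L)"
  by (simp add: scale_lat_def image_image vector_scalar_commute)

lemma act_hcls: "act_vertex g (hcls L) = hcls (app (emb_mat g) L)"
proof -
  have h: "hcls M = (\<lambda>c. scale_lat c M) ` {c. c \<noteq> 0}" for M :: "'a bt_lattice"
    by (auto simp: hcls_def)
  show ?thesis unfolding act_vertex_def h
    by (subst image_image) (rule image_cong[OF refl app_scale_lat])
qed

lemma act_ch: "act_simplex g (ch L0 L1 L2) = ch (app (emb_mat g) L0) (app (emb_mat g) L1) (app (emb_mat g) L2)"
  by (simp add: act_simplex_def ch_def act_hcls)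

lemma act_simplex_mult: "act_simplex (g ** h) s = act_simplex g (act_simplex h s)"
  by (simp add: act_simplex_def act_vertex_def image_image emb_mat_mult matrix_vector_mul_assoc)

lemma act_simplex_1 [simp]: "act_simplex (mat 1) s = s"
  by (simp add: act_simplex_def act_vertex_def)

lemma act_inv:
  assumes "invertible g"
  shows "act_simplex (matrix_inv g) (act_simplex g s) = s" "act_simplex g (act_simplex (matrix_inv g) s) = s"
  using assms by (simp_all add: act_simplex_mult[symmetric] invertible_inv)

lemma app_psubset: "invertible g \<Longrightarrow> app g L \<subset> app g M \<longleftrightarrow> L \<subset> M"
  by (simp add: psubset_eq app_mono_iff app_eq_iff)

lemma chain_app:
  assumes "invertible g" "chain L0 L1 L2"
  shows "chain (app g L0) (app g L1) (app g L2)"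
  using assms unfolding chain_def shl_app by (simp add: app_psubset is_lattice_app)

lemma act_chamber:
  assumes "invertible g" "is_chamber s"
  shows "is_chamber (act_simplex g s)"
  using assms(2) chain_app[OF emb_mat_invertible[OF assms(1)]] unfolding is_chamber_iff by (metis act_ch)

lemma act_chamber_iff: "invertible g \<Longrightarrow> is_chamber (act_simplex g s) \<longleftrightarrow> is_chamber s"
  using act_chamber act_inv(1) invertible_matrix_inv by metis

lemma act_edge:
  assumes "invertible g" "is_edge e"
  shows "is_edge (act_simplex g e)"
proof -
  obtain A B where A: "is_lattice A" "is_lattice B" "B \<subset> A" "shl 1 A \<subset> B" "e = {hcls A, hcls B}"
    using assms(2) unfolding is_edge_def scale_X by blast
  have i: "invertible (emb_mat g)" by (rule emb_mat_invertible[OF assms(1)])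
  have "act_simplex g e = {hcls (app (emb_mat g) A), hcls (app (emb_mat g) B)}"
    by (simp add: A(5) act_simplex_def act_hcls)
  moreover have "app (emb_mat g) B \<subset> app (emb_mat g) A" "shl 1 (app (emb_mat g) A) \<subset> app (emb_mat g) B"
    using A(3,4) by (simp_all add: shl_app app_psubset[OF i])
  ultimately show ?thesis using is_lattice_app[OF i] A(1,2) unfolding is_edge_def scale_X by blast
qed

lemma act_simplex_mono: "s \<subseteq> t \<Longrightarrow> act_simplex g s \<subseteq> act_simplex g t"
  by (auto simp: act_simplex_def)

lemma act_mem: "v \<in> s \<Longrightarrow> act_vertex g v \<in> act_simplex g s"
  by (simp add: act_simplex_def)

lemma act_inj: "invertible g \<Longrightarrow> inj_on (act_simplex g) S"
  by (rule inj_onI) (metis act_inv(1))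

lemma Cs_act:
  assumes "invertible g"
  shows "Cs (act_simplex g e) = act_simplex g ` Cs e"
proof (intro equalityI subsetI)
  fix s assume s: "s \<in> Cs (act_simplex g e)"
  have "act_simplex (matrix_inv g) s \<in> Cs e"
    using s act_chamber[OF invertible_matrix_inv[OF assms]] act_simplex_mono[of "act_simplex g e" s "matrix_inv g"]
    by (simp add: Cs_def act_inv[OF assms])
  then show "s \<in> act_simplex g ` Cs e" using act_inv(2)[OF assms] by (metis imageI)
next
  fix s assume "s \<in> act_simplex g ` Cs e"
  then obtain t where t: "s = act_simplex g t" "is_chamber t" "e \<subseteq> t" by (auto simp: Cs_def)
  then show "s \<in> Cs (act_simplex g e)"
    using act_chamber[OF assms t(2)] act_simplex_mono[OF t(3)] by (simp add: Cs_def)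
qed

text \<open>Left multiplication carries an adapted basis to an adapted basis with the same
  exponents.\<close>

lemma level_act:
  assumes g: "g \<in> GL3A" and s: "is_chamber s"
  shows "level (act_simplex g s) = level s"
proof -
  obtain L0 L1 L2 where c: "chain L0 L1 L2" "s = ch L0 L1 L2" using s is_chamber_iff by blast
  obtain h m i j k where f: "frame h m i j k L0 L1 L2" using chain_frame[OF c(1)] .
  let ?G = "emb_mat g"
  have "frame (?G ** h) m i j k (app ?G L0) (app ?G L1) (app ?G L2)"
    using f GA_mult[OF GL3A_emb[OF g]] unfolding frame_def lat_def by (simp add: app_app)
  then show ?thesis using level_eq f c(2) act_ch by metis
qed

lemma v0_act: "act_vertex g v0 = hcls (app (emb_mat g) std_lattice)"
  by (simp add: v0_def act_hcls)

lemma std_is_lattice: "is_lattice std_lattice"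
  by (simp add: std_eq_box is_lattice_box)

lemma v0_fixed: "g \<in> GL3Fq \<Longrightarrow> act_vertex g v0 = v0"
  unfolding v0_act by (simp add: const_mat_std v0_def)

lemma act_vertex_mult: "act_vertex (g ** h) v = act_vertex g (act_vertex h v)"
  by (simp add: act_vertex_def image_image emb_mat_mult matrix_vector_mul_assoc)

text \<open>The standard lattice has exponents 0, and \<open>frame_exists\<close> keeps them, so the
  type is (0,0,0).\<close>

lemma level_St0:
  assumes "is_chamber s" "v0 \<in> s"
  shows "level s = 0"
proof -
  obtain M N where c: "chain std_lattice M N" "s = ch std_lattice M N"
    using chamber_chain_at[OF assms(1) std_is_lattice] assms(2) v0_def by metis
  have l: "std_lattice = lat (mat 1) (\<lambda>_. 0)" by (simp add: lat_def std_eq_box)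
  obtain g i j k where "frame g (\<lambda>_. 0) i j k std_lattice M N"
    using frame_exists[OF GA_one, of "\<lambda>_. 0" M N] c(1) l by metis
  then have "level s = inversions 0 0 0" using level_eq c(2) by metis
  then show ?thesis by (simp add: inversions_def)
qed

text \<open>Equal exponents make the lattice homothetic to a GL_3(A)-translate of the standard one,
  and the constant factor of \<open>GL3A_decomp\<close> fixes \<open>v0\<close>.\<close>

lemma const_lat_vertex:
  assumes "g \<in> GA"
  shows "\<exists>u\<in>Gamma_t. hcls (lat g (\<lambda>_. n)) = act_vertex u v0"
proof -
  obtain h where h: "h \<in> GL3A" "emb_mat h = g" using GA_emb[OF assms] by blast
  obtain u k where uk: "u \<in> Gamma_t" "k \<in> GL3Fq" "h = u ** k" using GL3A_decomp[OF h(1)] .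
  have "lat g (\<lambda>_. n) = shl n (app g std_lattice)"
    by (simp add: lat_def std_eq_box shl_app shl_box)
  then have "hcls (lat g (\<lambda>_. n)) = hcls (app g std_lattice)"
    using hcls_shl is_lattice_app[OF GA_invertible[OF assms] std_is_lattice] by metis
  also have "\<dots> = act_vertex h v0" by (simp add: v0_act h(2))
  also have "\<dots> = act_vertex u v0" by (simp add: uk(3) act_vertex_mult v0_fixed uk(2))
  finally show ?thesis using uk(1) by blast
qed

text \<open>In each of the three types of level 0 one lattice of the chain has constant exponents:
  \<open>L0\<close> for (0,0,0), \<open>L2\<close> for (0,0,1), \<open>L1\<close> for (0,1,1), up to
  a common shift.\<close>

lemma frame_level0_vertices:
  assumes f: "frame g m i j k L0 L1 L2"
  shows "m i = m j \<Longrightarrow> m k = m i \<Longrightarrow> \<exists>u\<in>Gamma_t. hcls L0 = act_vertex u v0"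
    and "m i = m j \<Longrightarrow> m k = m i + 1 \<Longrightarrow> \<exists>u\<in>Gamma_t. hcls L2 = act_vertex u v0"
    and "m j = m i + 1 \<Longrightarrow> m k = m i + 1 \<Longrightarrow> \<exists>u\<in>Gamma_t. hcls L1 = act_vertex u v0"
proof -
  note f' = f[unfolded frame_def]
  have ex: "l = i \<or> l = j \<or> l = k" for l using frame_UNIV[OF f] by blast
  have ne: "i \<noteq> j" "j \<noteq> k" "i \<noteq> k" using triple_distinct[OF frame_UNIV[OF f]] by blast+
  have g: "g \<in> GA" using f' by blast
  { assume "m i = m j" "m k = m i"
    then have "m = (\<lambda>_. m i)" using ex by (metis ext)
    then show "\<exists>u\<in>Gamma_t. hcls L0 = act_vertex u v0" using const_lat_vertex[OF g] f' by metis }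
  { assume "m i = m j" "m k = m i + 1"
    then have "m(i := m i + 1, j := m j + 1) = (\<lambda>_. m i + 1)" using ex ne by (auto simp: fun_eq_iff)
    then show "\<exists>u\<in>Gamma_t. hcls L2 = act_vertex u v0" using const_lat_vertex[OF g] f' by metis }
  { assume "m j = m i + 1" "m k = m i + 1"
    then have "m(i := m i + 1) = (\<lambda>_. m i + 1)" using ex ne by (auto simp: fun_eq_iff)
    then show "\<exists>u\<in>Gamma_t. hcls L1 = act_vertex u v0" using const_lat_vertex[OF g] f' by metis }
qed

lemma level0_vertex:
  assumes "is_chamber s" "level s = 0"
  shows "\<exists>u\<in>Gamma_t. act_vertex u v0 \<in> s"
proof -
  obtain L0 L1 L2 where c: "chain L0 L1 L2" "s = ch L0 L1 L2" using assms(1) is_chamber_iff by blast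
  obtain g m i j k where f: "frame g m i j k L0 L1 L2" using chain_frame[OF c(1)] .
  have "m i \<le> m j" "m j \<le> m k" "m k \<le> m i + 1" using inversions_0 level_eq[OF f] assms(2) c(2) by auto
  then consider "m i = m j" "m k = m i" | "m i = m j" "m k = m i + 1" | "m j = m i + 1" "m k = m i + 1" by linarith
  then show ?thesis using frame_level0_vertices[OF f] c(2) unfolding ch_def by cases (metis insertI1 insertI2)+
qed

text \<open>The neighbour in the apartment has level 0 as well, which forces
  \<open>m i = m j\<close>. This excludes (0,1,1), the case in which the translate of
  \<open>v0\<close> would be the vertex off the edge.\<close>

lemma level0_edge:
  assumes e: "is_edge e" and z: "\<forall>s\<in>Cs e. level s = 0" and ne: "Cs e \<noteq> {}"
  shows "\<exists>u\<in>Gamma_t. act_vertex u v0 \<in> e"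
proof -
  obtain s where s: "s \<in> Cs e" using ne by blast
  obtain g m i j k L0 L1 L2 where f: "frame g m i j k L0 L1 L2" "s = ch L0 L1 L2" "e = {hcls L0, hcls L2}"
    using edge_frame[OF e s] .
  note sw = frame_swap(1)[OF f(1)]
  have "ch L0 (lat g (m(j := m j + 1))) L2 \<in> Cs e"
    using frame_edge(2)[OF sw] f(3) by (auto simp: Cs_def ch_def)
  then have "inversions (m j) (m i) (m k) = 0" using z level_eq[OF sw] by simp
  moreover have "inversions (m i) (m j) (m k) = 0" using z s f(2) level_eq[OF f(1)] by simp
  ultimately have "m i = m j" "m j \<le> m k" "m k \<le> m i + 1" using inversions_0[of "m j" "m i" "m k"] inversions_0[of "m i" "m j" "m k"] by simp_all
  then consider "m i = m j" "m k = m i" | "m i = m j" "m k = m i + 1" by linarith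
  then show ?thesis using frame_level0_vertices(1,2)[OF f(1)] f(3) by cases (metis insertI1 insertI2)+
qed

text \<open>The two translated lattices have the same colength, so inside one chamber they coincide
  by \<open>chain_mem\<close>. The transition matrix is then polynomial in t and integral in pi,
  hence constant; being the identity modulo t, it is the identity.\<close>

lemma Gamma_t_vertex_unique:
  assumes u: "u \<in> Gamma_t" "u' \<in> Gamma_t" and s: "is_chamber s" "act_vertex u v0 \<in> s" "act_vertex u' v0 \<in> s"
  shows "u = u'"
proof -
  let ?G = "emb_mat u" and ?G' = "emb_mat u'"
  have G: "?G \<in> GA" "?G' \<in> GA" using u Gamma_t_GL3A GL3A_emb by blast+
  have i: "invertible ?G" "invertible ?G'" using G GA_invertible by blast+
  have l: "is_lattice (app ?G std_lattice)" "is_lattice (app ?G' std_lattice)"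
    using i is_lattice_app std_is_lattice by blast+
  have d: "dg (app ?G std_lattice) = dg (app ?G' std_lattice)" using G i by (simp add: dg_app_std GA_vdet)
  obtain M N where c: "chain (app ?G std_lattice) M N" "s = ch (app ?G std_lattice) M N"
    using chamber_chain_at[OF s(1) l(1)] s(2) v0_act by metis
  have eq: "app ?G' std_lattice = app ?G std_lattice"
    using chain_mem(1)[OF c(1) l(2)] s(3) d c(2) v0_act by metis
  let ?H = "matrix_inv ?G ** ?G'"
  have im: "imat ?H" by (rule std_incl(1)) (use i eq in auto)
  have H: "?H \<in> GA" using G by (simp add: GA_mult GA_inv)
  have "red ?H = mat 1"
  proof -
    have "red ?H = red (emb_mat (matrix_inv u ** u'))"
      using GL3A_invertible[OF Gamma_t_GL3A[OF u(1)]] by (simp add: emb_mat_mult emb_mat_inv)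
    then show ?thesis using Gamma_t_mult[OF Gamma_t_inv[OF u(1)] u(2)] Gamma_t_iff by metis
  qed
  then have r: "?H $ a $ b $$ 0 = (if a = b then 1 else 0)" for a b
  proof -
    have "?H $ a $ b $$ 0 = red ?H $ a $ b" unfolding red_def by simp
    then show ?thesis unfolding \<open>red ?H = mat 1\<close> mat_def by simp
  qed
  have "?H $ a $ b $$ n = (mat 1 :: 'a fls ^ 3 ^ 3) $ a $ b $$ n" for a b n
  proof (cases "n = 0")
    case True then show ?thesis using r by (simp add: mat_def)
  next
    case False
    have "?H $ a $ b \<in> AA" "vge 0 (?H $ a $ b)" using H im by (auto simp: GA_def imat_def)
    then have "?H $ a $ b $$ n = 0" using False by (cases "n > 0") (auto simp: AA_def vge_def)
    then show ?thesis using False by (simp add: mat_def)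
  qed
  then have "?H = mat 1" by (simp add: vec_eq_iff fls_eq_iff)
  then have "?G ** ?H = ?G" by simp
  then have "?G' = ?G" using i by (simp add: matrix_mul_assoc invertible_inv)
  then show ?thesis by (simp add: emb_mat_inj)
qed

section \<open>Harmonic functions on the star of the standard vertex\<close>

abbreviation flag :: "'k::field bt_lattice \<Rightarrow> 'k bt_lattice \<Rightarrow> bool" where
  "flag \<equiv> chain std_lattice"

abbreviation ch_flag :: "'k::field bt_lattice \<Rightarrow> 'k bt_lattice \<Rightarrow> 'k bt_simplex" where
  "ch_flag \<equiv> ch std_lattice"

text \<open>Lattices between the standard one and its shift correspond to subspaces of F_q^3. Planes
  are described by a normal vector and lines by a spanning vector.\<close>

abbreviation plane :: "'k::field ^ 3 \<Rightarrow> 'k bt_lattice" where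
  "plane a \<equiv> hyp (\<lambda>_. 0) a"

definition line :: "'k::field ^ 3 \<Rightarrow> 'k bt_lattice" where
  "line b = {x \<in> std_lattice. \<exists>t. \<forall>i. x $ i $$ 0 = t * b $ i}"

definition dot3 :: "'k::field ^ 3 \<Rightarrow> 'k ^ 3 \<Rightarrow> 'k" where
  "dot3 a b = a $ 1 * b $ 1 + a $ 2 * b $ 2 + a $ 3 * b $ 3"

lemma plane_iff: "x \<in> plane a \<longleftrightarrow> x \<in> std_lattice \<and> a $ 1 * (x $ 1 $$ 0) + a $ 2 * (x $ 2 $$ 0) + a $ 3 * (x $ 3 $$ 0) = 0"
  by (simp add: hyp_def std_eq_box sum_3)

lemma std_lat: "std_lattice = lat (mat 1) (\<lambda>_. 0)"
  by (simp add: lat_def std_eq_box)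

lemma dg_std: "dg std_lattice = 0"
  unfolding std_lat dg_lat[OF GA_one] by simp

lemma plane_lattice:
  assumes "a \<noteq> 0"
  shows "is_lattice (plane a)" "dg (plane a) = 1"
  using hyp_lattice[OF GA_one assms, of "\<lambda>_. 0"] dg_std by (simp_all add: std_lat[symmetric])

text \<open>Replacing column p of the identity by \<open>b\<close>, where \<open>b $ p\<close> is
  nonzero, gives a constant invertible matrix. In this basis the lattice has exponent 0 at p and 1
  elsewhere.\<close>

lemma line_lattice:
  fixes b :: "'k::field ^ 3"
  assumes "b \<noteq> 0"
  shows "is_lattice (line b)" "dg (line b) = 2"
proof -
  obtain p where p: "b $ p \<noteq> 0" using assms by (auto simp: vec_eq_iff)
  define col :: "(3 \<Rightarrow> 'k) \<Rightarrow> 'k fls ^ 3 ^ 3" where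
    "col d = (\<chi> i j. if j = p then fls_const (d i) else if i = j then 1 else 0)" for d
  have col: "(col d *v x) $ i = fls_const (d i) * x $ p + (if i = p then 0 else x $ i)" for d x i
  proof -
    have "(col d *v x) $ i = (\<Sum>j\<in>UNIV. (if j = p then fls_const (d i) else if i = j then 1 else 0) * x $ j)"
      by (simp add: col_def matrix_vector_mult_def)
    also have "\<dots> = fls_const (d i) * x $ p + (\<Sum>j\<in>UNIV - {p}. (if j = p then fls_const (d i) else if i = j then 1 else 0) * x $ j)"
      by (subst sum.remove[of _ p]) auto
    also have "(\<Sum>j\<in>UNIV - {p}. (if j = p then fls_const (d i) else if i = j then 1 else 0) * x $ j)
        = (\<Sum>j\<in>UNIV - {p}. if i = j then x $ j else 0)" by (rule sum.cong) auto
    finally show ?thesis by (simp add: sum.delta)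
  qed
  define K K' where "K = col (\<lambda>i. b $ i)" and "K' = col (\<lambda>i. if i = p then 1 / b $ p else - (b $ i / b $ p))"
  have Kx: "(K *v x) $ i = (if i = p then fls_const (b $ p) * x $ p else fls_const (b $ i) * x $ p + x $ i)"
    and Kx': "(K' *v x) $ i = (if i = p then fls_const (1 / b $ p) * x $ p else fls_const (- (b $ i / b $ p)) * x $ p + x $ i)" for x i
    by (simp_all add: K_def K'_def col)
  have KK': "K *v (K' *v x) = x" for x
  proof -
    have "fls_const (b $ i) * (fls_const (1 / b $ p) * x $ p) + (fls_const (- (b $ i / b $ p)) * x $ p + x $ i) = x $ i" for i
      by (simp add: mult.assoc[symmetric] distrib_right[symmetric])
    moreover have "fls_const (b $ p) * (fls_const (1 / b $ p) * x $ p) = x $ p"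
      using p by (simp add: mult.assoc[symmetric])
    ultimately show ?thesis by (simp add: vec_eq_iff Kx Kx')
  qed
  then have KK: "K ** K' = mat 1" by (simp add: matrix_eq matrix_vector_mul_assoc)
  have KG: "K \<in> GA" by (rule GA_I[OF KK]) (auto simp: K_def K'_def col_def AA_def)
  let ?m = "\<lambda>i. if i = p then 0 else (1::int)"
  have v1: "vge 1 y \<longleftrightarrow> vge 0 y \<and> y $$ 0 = 0" for y :: "'k fls" using vge_Suc[of 0 y] by simp
  have "line b = lat K ?m"
  proof (intro equalityI subsetI)
    fix y assume "y \<in> line b"
    then obtain t where y: "\<And>i. vge 0 (y $ i)" "\<And>i. y $ i $$ 0 = t * b $ i"
      by (auto simp: line_def std_eq_box box_def)
    have "K' *v y \<in> box ?m"
      using y p by (auto simp: box_def Kx' v1 intro!: vge_add vge_diff vge_mult0)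
    then show "y \<in> lat K ?m" unfolding lat_def using KK'[of y] by (metis imageI)
  next
    fix y assume "y \<in> lat K ?m"
    then obtain x where x: "y = K *v x" "x \<in> box ?m" unfolding lat_def by blast
    have v: "vge 0 (x $ i)" for i using x(2) by (cases "i = p") (auto simp: box_def v1 split: if_splits)
    have n: "i \<noteq> p \<Longrightarrow> x $ i $$ 0 = 0" for i using x(2) by (auto simp: box_def v1 split: if_splits)
    have "vge 0 (y $ i)" for i unfolding x(1) Kx using v by (auto intro!: vge_add vge_mult0)
    moreover have "y $ i $$ 0 = (x $ p $$ 0) * b $ i" for i unfolding x(1) Kx using n by auto
    ultimately show "y \<in> line b" by (auto simp: line_def std_eq_box box_def)
  qed
  moreover have "?m 1 + ?m 2 + ?m 3 = 2" using exhaust_3[of p] by auto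
  ultimately show "is_lattice (line b)" "dg (line b) = 2" using is_lattice_lat[OF KG] dg_lat[OF KG] by auto
qed

definition const_vec :: "'k::field ^ 3 \<Rightarrow> 'k fls ^ 3" where
  "const_vec b = (\<chi> i. fls_const (b $ i))"

lemma const_vec_line: "const_vec b \<in> line b"
  by (auto simp: line_def const_vec_def std_eq_box box_def intro!: exI[of _ 1])

lemma const_vec_line_iff: "const_vec b' \<in> line b \<longleftrightarrow> (\<exists>t. b' = t *s b)"
  by (auto simp: line_def const_vec_def std_eq_box box_def vec_eq_iff)

lemma line_plane_iff: "line b \<subseteq> plane a \<longleftrightarrow> dot3 a b = 0"
proof
  assume "line b \<subseteq> plane a"
  then have "const_vec b \<in> plane a" using const_vec_line by blast
  then show "dot3 a b = 0" by (simp add: plane_iff const_vec_def dot3_def)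
next
  assume d: "dot3 a b = 0"
  show "line b \<subseteq> plane a"
  proof
    fix x assume "x \<in> line b"
    then obtain t where x: "x \<in> std_lattice" "\<And>i. x $ i $$ 0 = t * b $ i" by (auto simp: line_def)
    have "a $ 1 * (x $ 1 $$ 0) + a $ 2 * (x $ 2 $$ 0) + a $ 3 * (x $ 3 $$ 0) = t * dot3 a b"
      by (simp add: x(2) dot3_def algebra_simps)
    then show "x \<in> plane a" using d x(1) by (simp add: plane_iff)
  qed
qed

lemma plane_scale:
  assumes "r \<noteq> 0" shows "plane (r *s a) = plane a"
proof -
  have "(r *s a) $ 1 * x + (r *s a) $ 2 * y + (r *s a) $ 3 * z = r * (a $ 1 * x + a $ 2 * y + a $ 3 * z)" for x y z
    by (simp add: algebra_simps)
  then show ?thesis using assms by (auto simp: set_eq_iff plane_iff)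
qed

lemma line_scale:
  assumes "r \<noteq> 0" shows "line (r *s b) = line b"
proof -
  have "(\<exists>t. \<forall>i. x i = t * (r * b $ i)) \<longleftrightarrow> (\<exists>t. \<forall>i. x i = t * b $ i)" for x :: "3 \<Rightarrow> 'a"
  proof
    assume "\<exists>t. \<forall>i. x i = t * b $ i"
    then obtain t where "\<forall>i. x i = t * b $ i" by blast
    then have "\<forall>i. x i = (t / r) * (r * b $ i)" using assms by simp
    then show "\<exists>t. \<forall>i. x i = t * (r * b $ i)" by blast
  qed (metis mult.assoc)
  then show ?thesis by (simp add: line_def)
qed

lemma line_eqD:
  assumes "line b = line b'" shows "\<exists>t. b' = t *s b"
  using assms const_vec_line[of b'] const_vec_line_iff[of b' b] by simp

lemma plane_eqD:
  assumes "plane a = plane a'" "dot3 a b = 0" shows "dot3 a' b = 0"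
  using assms line_plane_iff[of b a] line_plane_iff[of b a'] by simp

lemma codim1_std:
  assumes "is_lattice M" "M \<subset> std_lattice" "dg M = 1"
  shows "\<exists>a. a \<noteq> 0 \<and> M = plane a"
  using codim1_hyp[OF GA_one assms(1), of "\<lambda>_. 0"] assms dg_std by (simp add: std_lat[symmetric])

lemma shl_std: "shl 1 std_lattice = box (\<lambda>_. 1)"
  by (simp add: std_eq_box shl_box)

lemma box1_iff: "x \<in> box (\<lambda>_. 1) \<longleftrightarrow> x \<in> std_lattice \<and> (\<forall>i. x $ i $$ 0 = 0)"
  using vge_Suc[of 0] by (auto simp: std_eq_box box_def)

text \<open>A vector of \<open>N\<close> outside the shifted standard lattice has nonzero reduction
  \<open>b\<close>. Its constant multiples and the shifted lattice already give
  \<open>line b\<close>, which has the colength of \<open>N\<close>.\<close>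

lemma codim2_std:
  fixes N :: "'k::field bt_lattice"
  assumes N: "is_lattice N" "N \<subset> std_lattice" "shl 1 std_lattice \<subset> N" "dg N = 2"
  shows "\<exists>b. b \<noteq> 0 \<and> N = line b"
proof -
  obtain x where x: "x \<in> N" "x \<notin> box (\<lambda>_. 1)" using N(3) shl_std by blast
  have xs: "x \<in> std_lattice" using x(1) N(2) by blast
  define b where "b = (\<chi> i. x $ i $$ 0)"
  have b: "b \<noteq> 0" using x(2) xs by (auto simp: b_def vec_eq_iff box1_iff)
  have "line b \<subseteq> N"
  proof
    fix y assume "y \<in> line b"
    then obtain t where y: "y \<in> std_lattice" "\<And>i. y $ i $$ 0 = t * b $ i" by (auto simp: line_def)
    have tx: "fls_const t *s x \<in> N" using lattice_scale[OF N(1) _ x(1)] by simp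
    have "y - fls_const t *s x \<in> box (\<lambda>_. 1)"
      using y xs unfolding box1_iff by (auto simp: std_eq_box box_def b_def intro!: vge_diff vge_mult0)
    then have "y - fls_const t *s x \<in> N" using N(3) shl_std by blast
    then have "(y - fls_const t *s x) + fls_const t *s x \<in> N" using lattice_add[OF N(1) _ tx] by blast
    then show "y \<in> N" by simp
  qed
  then have "line b = N" using dg_eqD[OF line_lattice(1)[OF b] N(1)] line_lattice(2)[OF b] N(4) by simp
  then show ?thesis using b by blast
qed

text \<open>This turns the star of the standard vertex into the incidence geometry of F_q^3: its
  chambers are the complete flags.\<close>

lemma chain_std_iff:
  "flag M N \<longleftrightarrow> (\<exists>a b. a \<noteq> 0 \<and> b \<noteq> 0 \<and> M = plane a \<and> N = line b \<and> dot3 a b = 0)"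
proof
  assume c: "flag M N"
  note c' = c[unfolded chain_def]
  obtain a where a: "a \<noteq> 0" "M = plane a" using codim1_std[of M] c' chain_dg(1)[OF c] by (auto simp: dg_std)
  obtain b where b: "b \<noteq> 0" "N = line b" using codim2_std[of N] c' chain_dg(2)[OF c] dg_std
    by (metis add_0 psubset_trans)
  have "dot3 a b = 0" using line_plane_iff[of b a] a b c' by blast
  then show "\<exists>a b. a \<noteq> 0 \<and> b \<noteq> 0 \<and> M = plane a \<and> N = line b \<and> dot3 a b = 0" using a b by blast
next
  assume "\<exists>a b. a \<noteq> 0 \<and> b \<noteq> 0 \<and> M = plane a \<and> N = line b \<and> dot3 a b = 0"
  then obtain a b where ab: "a \<noteq> 0" "b \<noteq> 0" "M = plane a" "N = line b" "dot3 a b = 0" by blast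
  have l: "is_lattice M" "dg M = 1" "is_lattice N" "dg N = 2" using ab plane_lattice line_lattice by auto
  have "M \<subseteq> std_lattice" using ab(3) plane_iff by blast
  moreover have "N \<subseteq> M" using ab line_plane_iff by blast
  moreover have "shl 1 std_lattice \<subseteq> N" unfolding shl_std ab(4) line_def
    by (auto simp: box1_iff intro!: exI[of _ 0])
  moreover have "M \<noteq> std_lattice" "N \<noteq> M" using l by (auto simp: dg_std)
  moreover have "shl 1 std_lattice \<noteq> N" using l by (auto simp: dg_std dg_shl[OF std_is_lattice])
  ultimately show "flag M N" using l std_is_lattice unfolding chain_def by blast
qed

text \<open>A reference flag. A harmonic function on the star is determined by its values on the flags opposite
  to it, since the remaining flags form a spanning tree of the incidence graph.\<close>
abbreviation M0 :: "'k::field bt_lattice" where "M0 \<equiv> plane (vector [0, 0, 1])"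
abbreviation N0 :: "'k::field bt_lattice" where "N0 \<equiv> line (vector [1, 0, 0])"

lemma vec3_eq_iff: "(a :: 'k ^ 3) = b \<longleftrightarrow> a $ 1 = b $ 1 \<and> a $ 2 = b $ 2 \<and> a $ 3 = b $ 3"
  by (simp add: vec_eq_iff forall_3)

lemma line_M0: "line b \<subseteq> M0 \<longleftrightarrow> b $ 3 = 0"
  by (simp add: line_plane_iff dot3_def)

lemma N0_plane: "N0 \<subseteq> plane a \<longleftrightarrow> a $ 1 = 0"
  by (simp add: line_plane_iff dot3_def)

lemma N0_M0 [simp]: "N0 \<subseteq> M0"
  by (simp add: N0_plane)

lemma plane_eq_M0:
  assumes "a \<noteq> 0" shows "plane a = M0 \<longleftrightarrow> a $ 1 = 0 \<and> a $ 2 = 0"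
proof
  assume *: "plane a = M0"
  have "dot3 a (vector [1, 0, 0]) = 0" "dot3 a (vector [0, 1, 0]) = 0"
    by (rule plane_eqD[OF *[symmetric]], simp add: dot3_def)+
  then show "a $ 1 = 0 \<and> a $ 2 = 0" by (simp add: dot3_def)
next
  assume *: "a $ 1 = 0 \<and> a $ 2 = 0"
  then have "a $ 3 \<noteq> 0" "a = a $ 3 *s vector [0, 0, 1]" using assms by (auto simp: vec3_eq_iff)
  then show "plane a = M0" using plane_scale by metis
qed

lemma line_eq_N0:
  assumes "b \<noteq> 0" shows "line b = N0 \<longleftrightarrow> b $ 2 = 0 \<and> b $ 3 = 0"
proof
  assume "line b = N0"
  then obtain t where "b = t *s vector [1, 0, 0]" using line_eqD[of "vector [1, 0, 0]" b] by auto
  then show "b $ 2 = 0 \<and> b $ 3 = 0" by simp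
next
  assume *: "b $ 2 = 0 \<and> b $ 3 = 0"
  then have "b $ 1 \<noteq> 0" "b = b $ 1 *s vector [1, 0, 0]" using assms by (auto simp: vec3_eq_iff)
  then show "line b = N0" using line_scale by metis
qed

lemma flag_coords:
  assumes "flag M N"
  obtains a b where "a \<noteq> 0" "b \<noteq> 0" "M = plane a" "N = line b" "dot3 a b = 0"
  using assms that unfolding chain_std_iff by blast

text \<open>Two distinct planes meet in one line. The next two lemmas are the other incidence facts
  needed: two distinct lines span one plane, and a plane different from \<open>M0\<close> meets it
  in a single line.\<close>

lemma flag_meet_M0:
  assumes "flag M N" "N0 \<subseteq> M" "M \<noteq> M0" "N \<subseteq> M0"
  shows "N = N0"
proof -
  obtain a b where ab: "a \<noteq> 0" "b \<noteq> 0" "M = plane a" "N = line b" "dot3 a b = 0" using flag_coords[OF assms(1)] .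
  have "a $ 1 = 0" "a $ 2 \<noteq> 0" "b $ 3 = 0" using assms(2-4) plane_eq_M0[OF ab(1)] unfolding ab(3,4) N0_plane line_M0 by blast+
  then have "b $ 2 = 0" using ab(5) by (simp add: dot3_def)
  then show ?thesis using line_eq_N0[OF ab(2)] \<open>b $ 3 = 0\<close> ab(4) by simp
qed

lemma flag_join_N0:
  assumes "flag M N" "\<not> N \<subseteq> M0" "N0 \<subseteq> M" "flag M' N" "N0 \<subseteq> M'"
  shows "M = M'"
proof -
  obtain a b where ab: "a \<noteq> 0" "b \<noteq> 0" "M = plane a" "N = line b" "dot3 a b = 0" using flag_coords[OF assms(1)] .
  obtain a' b' where ab': "a' \<noteq> 0" "b' \<noteq> 0" "M' = plane a'" "N = line b'" "dot3 a' b' = 0" using flag_coords[OF assms(4)] .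
  have d: "dot3 a' b = 0" using assms(4) ab(4) ab'(3) line_plane_iff unfolding chain_def by blast
  have z: "a $ 1 = 0" "a' $ 1 = 0" "b $ 3 \<noteq> 0"
    using assms(3) assms(5) assms(2) unfolding ab(3,4) ab'(3) N0_plane line_M0 .
  then have e: "a $ 3 = - (a $ 2 * b $ 2 / b $ 3)" "a' $ 3 = - (a' $ 2 * b $ 2 / b $ 3)"
    using d ab(5) by (simp_all add: dot3_def field_simps eq_neg_iff_add_eq_0)
  then have n: "a $ 2 \<noteq> 0" "a' $ 2 \<noteq> 0" using z ab(1) ab'(1) by (auto simp: vec3_eq_iff)
  have "a' = (a' $ 2 / a $ 2) *s a" using z e n by (simp add: vec3_eq_iff)
  then show ?thesis using plane_scale[of "a' $ 2 / a $ 2" a] n ab(3) ab'(3) by simp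
qed

lemma flag_meet_unique:
  assumes "flag M N" "N \<subseteq> M0" "\<not> N0 \<subseteq> M" "flag M N'" "N' \<subseteq> M0"
  shows "N = N'"
proof -
  obtain a b where ab: "a \<noteq> 0" "b \<noteq> 0" "M = plane a" "N = line b" "dot3 a b = 0" using flag_coords[OF assms(1)] .
  obtain a' b' where ab': "a' \<noteq> 0" "b' \<noteq> 0" "M = plane a'" "N' = line b'" "dot3 a' b' = 0" using flag_coords[OF assms(4)] .
  have d: "dot3 a b' = 0" using assms(4) ab(3) ab'(4) line_plane_iff unfolding chain_def by blast
  have z: "b $ 3 = 0" "b' $ 3 = 0" "a $ 1 \<noteq> 0"
    using assms(2) assms(5) assms(3) unfolding ab(3,4) ab'(4) N0_plane line_M0 .
  then have e: "b $ 1 = - (a $ 2 * b $ 2 / a $ 1)" "b' $ 1 = - (a $ 2 * b' $ 2 / a $ 1)"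
    using d ab(5) by (simp_all add: dot3_def field_simps eq_neg_iff_add_eq_0)
  then have n: "b $ 2 \<noteq> 0" "b' $ 2 \<noteq> 0" using z ab(2) ab'(2) by (auto simp: vec3_eq_iff)
  have "b' = (b' $ 2 / b $ 2) *s b" using z e n by (simp add: vec3_eq_iff)
  then show ?thesis using line_scale[of "b' $ 2 / b $ 2" b] n ab(4) ab'(4) by simp
qed

lemma flag_join_M0:
  assumes "flag M N" "N \<subseteq> M0" "N \<noteq> N0" "N0 \<subseteq> M"
  shows "M = M0"
  using flag_meet_M0[OF assms(1,4) _ assms(2)] assms(3) by blast

lemma ex_join:
  assumes "b \<noteq> 0" "\<not> line b \<subseteq> M0"
  shows "\<exists>M. flag M (line b) \<and> N0 \<subseteq> M"
proof -
  let ?a = "vector [0, b $ 3, - b $ 2] :: 'a ^ 3"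
  have "?a \<noteq> 0" using assms(2) line_M0 by (auto simp: vec3_eq_iff)
  moreover have "dot3 ?a b = 0" by (simp add: dot3_def)
  ultimately have "flag (plane ?a) (line b)" unfolding chain_std_iff using assms(1) by blast
  then show ?thesis using N0_plane[of ?a] by auto
qed

lemma ex_meet:
  assumes "a \<noteq> 0" "\<not> N0 \<subseteq> plane a"
  shows "\<exists>N. flag (plane a) N \<and> N \<subseteq> M0"
proof -
  let ?b = "vector [- a $ 2, a $ 1, 0] :: 'a ^ 3"
  have "?b \<noteq> 0" using assms(2) N0_plane by (auto simp: vec3_eq_iff)
  moreover have "dot3 a ?b = 0" by (simp add: dot3_def)
  ultimately have "flag (plane a) (line ?b)" unfolding chain_std_iff using assms(1) by blast
  then show ?thesis using line_M0[of ?b] by auto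
qed

section \<open>Opposite flags and the spanning tree\<close>

definition opp_flags :: "('k::field bt_lattice \<times> 'k bt_lattice) set" where
  "opp_flags = {(M, N). flag M N \<and> \<not> N \<subseteq> M0 \<and> \<not> N0 \<subseteq> M}"

text \<open>Coordinates on the open cell: opposition allows the normal vector to be scaled to first
  entry 1 and the spanning vector to last entry 1. Incidence then determines the first entry of the
  latter, and three free parameters remain.\<close>

lemma card_opp_flags: "card (opp_flags :: ('k::{field,finite} bt_lattice \<times> _) set) = CARD('k) ^ 3"
proof -
  let ?f = "\<lambda>(x, y, v). (plane (vector [1, x, y] :: 'k ^ 3), line (vector [- (x * v + y), v, 1] :: 'k ^ 3))"
  have inj: "inj ?f"
  proof (rule injI)
    fix p p' :: "'k \<times> 'k \<times> 'k" assume *: "?f p = ?f p'"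
    obtain x y v x' y' v' where p: "p = (x, y, v)" "p' = (x', y', v')" by (cases p, cases p')
    have h: "plane (vector [1, x, y] :: 'k ^ 3) = plane (vector [1, x', y'])"
      and l: "line (vector [- (x * v + y), v, 1] :: 'k ^ 3) = line (vector [- (x' * v' + y'), v', 1])"
      using * by (simp_all add: p)
    \<comment> \<open>The two test vectors span the first plane; evaluating the second normal vector
      on them compares the parameters.\<close>
    have "dot3 (vector [1, x', y']) (vector [- x, 1, 0] :: 'k ^ 3) = 0"
      by (rule plane_eqD[OF h]) (simp add: dot3_def)
    moreover have "dot3 (vector [1, x', y']) (vector [- y, 0, 1] :: 'k ^ 3) = 0"
      by (rule plane_eqD[OF h]) (simp add: dot3_def)
    ultimately have 1: "x = x'" "y = y'" by (simp_all add: dot3_def)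
    obtain t where "(vector [- (x' * v' + y'), v', 1] :: 'k ^ 3) = t *s vector [- (x * v + y), v, 1]"
      using line_eqD[OF l] by blast
    then have "1 = t" "v' = t * v" by (simp_all add: vec3_eq_iff)
    then show "p = p'" using 1 p by simp
  qed
  have rng: "range ?f = opp_flags"
  proof (intro equalityI subsetI)
    fix z assume "z \<in> range ?f"
    then obtain x y v where z: "z = (plane (vector [1, x, y] :: 'k ^ 3), line (vector [- (x * v + y), v, 1] :: 'k ^ 3))" by auto
    have "(vector [1, x, y] :: 'k ^ 3) \<noteq> 0" "(vector [- (x * v + y), v, 1] :: 'k ^ 3) \<noteq> 0"
      "dot3 (vector [1, x, y]) (vector [- (x * v + y), v, 1] :: 'k ^ 3) = 0" by (simp_all add: vec3_eq_iff dot3_def)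
    then have "flag (plane (vector [1, x, y] :: 'k ^ 3)) (line (vector [- (x * v + y), v, 1] :: 'k ^ 3))"
      unfolding chain_std_iff by blast
    then show "z \<in> opp_flags" by (simp add: z opp_flags_def line_M0 N0_plane)
  next
    fix z assume "z \<in> (opp_flags :: ('k bt_lattice \<times> _) set)"
    then obtain M N where z: "z = (M, N)" "flag M N" "\<not> N \<subseteq> M0" "\<not> N0 \<subseteq> M" by (auto simp: opp_flags_def)
    obtain a b where ab: "a \<noteq> 0" "b \<noteq> 0" "M = plane a" "N = line b" "dot3 a b = 0" using flag_coords[OF z(2)] .
    have n: "a $ 1 \<noteq> 0" "b $ 3 \<noteq> 0" using z ab line_M0 N0_plane by auto
    let ?x = "a $ 2 / a $ 1" and ?y = "a $ 3 / a $ 1" and ?v = "b $ 2 / b $ 3"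
    have A: "a = a $ 1 *s vector [1, ?x, ?y]" using n by (simp add: vec3_eq_iff)
    have "a $ 1 * b $ 1 = - (a $ 2 * b $ 2 + a $ 3 * b $ 3)"
      using ab(5) unfolding eq_neg_iff_add_eq_0 by (simp add: dot3_def add.assoc)
    then have "b $ 1 = - (a $ 2 * b $ 2 + a $ 3 * b $ 3) / a $ 1"
      using n by (metis nonzero_mult_div_cancel_left)
    also have "\<dots> = b $ 3 * (- (?x * ?v + ?y))" using n by (simp add: field_simps)
    finally have "b $ 1 = b $ 3 * (- (?x * ?v + ?y))" .
    then have B: "b = b $ 3 *s vector [- (?x * ?v + ?y), ?v, 1]" using n by (simp add: vec3_eq_iff)
    have "M = plane (vector [1, ?x, ?y])" using A plane_scale[OF n(1)] ab(3) by metis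
    moreover have "N = line (vector [- (?x * ?v + ?y), ?v, 1])" using B line_scale[OF n(2)] ab(4) by metis
    ultimately have "z = ?f (?x, ?y, ?v)" using z(1) by (simp only: prod.case)
    then show "z \<in> range ?f" by blast
  qed
  have "card (opp_flags :: ('k bt_lattice \<times> _) set) = card (UNIV :: ('k \<times> 'k \<times> 'k) set)"
    unfolding rng[symmetric] by (rule card_image[OF inj])
  then show ?thesis by (simp add: power3_eq_cube)
qed

text \<open>Equal to 3 minus the gallery distance from the reference flag; the last summand gives
  the reference flag itself the value 3.\<close>

definition flag_level :: "'k::field bt_lattice \<times> 'k bt_lattice \<Rightarrow> nat" where
  "flag_level = (\<lambda>(M, N). (if N \<subseteq> M0 then 1 else 0) + (if N0 \<subseteq> M then 1 else 0) + (if M = M0 \<and> N = N0 then 1 else 0))"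

text \<open>The non-opposite flags form a spanning tree rooted at \<open>M0\<close>. For such a flag
  the rule keeps the end farther from the root and varies the other one, so every vertex except the
  root is kept by some flag of the tree.\<close>

definition vary_fst :: "'k::field bt_lattice \<times> 'k bt_lattice \<Rightarrow> bool" where
  "vary_fst = (\<lambda>(M, N). M = M0 \<or> \<not> N \<subseteq> M0)"

definition flag_edge :: "'k::field bt_lattice \<times> 'k bt_lattice \<Rightarrow> ('k bt_lattice \<times> 'k bt_lattice) set" where
  "flag_edge = (\<lambda>(M, N). if vary_fst (M, N) then (\<lambda>M'. (M', N)) ` {M'. flag M' N}
      else (\<lambda>N'. (M, N')) ` {N'. flag M N'})"

text \<open>By uniqueness of joins and meets, changing the varied member destroys an incidence with
  the reference flag and creates no new one.\<close>

lemma flag_edge_decreases: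
  assumes c: "flag M N" and p: "flag_level (M, N) > 0" and d: "p \<in> flag_edge (M, N)" "p \<noteq> (M, N)"
  shows "flag_level p < flag_level (M, N)"
proof (cases "vary_fst (M, N)")
  case True
  then obtain M' where M': "p = (M', N)" "flag M' N" "M' \<noteq> M" using d by (auto simp: flag_edge_def)
  show ?thesis
  proof (cases "N \<subseteq> M0")
    case N: True
    then have M: "M = M0" using True by (simp add: vary_fst_def)
    show ?thesis
    proof (cases "N = N0")
      case True
      have "N \<subseteq> M'" using M'(2) unfolding chain_def by blast
      then show ?thesis using M M' N True by (simp add: flag_level_def)
    next
      case False
      then have "\<not> N0 \<subseteq> M'" using flag_join_M0[OF M'(2) N] M'(3) M by blast
      then show ?thesis using M M' N False by (simp add: flag_level_def)
    qed
  next
    case False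
    then have "N0 \<subseteq> M" using p by (auto simp: flag_level_def split: if_splits)
    then have "\<not> N0 \<subseteq> M'" using flag_join_N0[OF c False _ M'(2)] M'(3) by blast
    moreover have "\<not> (M' = M0 \<and> N = N0)" using False by (metis N0_M0)
    ultimately show ?thesis using M' False \<open>N0 \<subseteq> M\<close> by (simp add: flag_level_def)
  qed
next
  case False
  then have N: "N \<subseteq> M0" and M: "M \<noteq> M0" by (auto simp: vary_fst_def)
  obtain N' where N': "p = (M, N')" "flag M N'" "N' \<noteq> N" using d False by (auto simp: flag_edge_def)
  show ?thesis
  proof (cases "N0 \<subseteq> M")
    case True
    then have "N = N0" using flag_meet_M0[OF c _ M N] by blast
    then have "\<not> N' \<subseteq> M0" using flag_meet_M0[OF N'(2) True M] N'(3) by blast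
    then show ?thesis using N' N M True by (simp add: flag_level_def)
  next
    case False
    then have "\<not> N' \<subseteq> M0" using flag_meet_unique[OF c N False N'(2)] N'(3) by blast
    then show ?thesis using N' N M False by (simp add: flag_level_def)
  qed
qed

lemma flag_edge_self: "flag M N \<Longrightarrow> (M, N) \<in> flag_edge (M, N)"
  by (auto simp: flag_edge_def)

lemma finite_flags_std: "finite {(M, N). chain (std_lattice :: 'k::{field,finite} bt_lattice) M N}"
  by (rule finite_flags[OF std_is_lattice])

lemma flag_edge_flags: "flag M N \<Longrightarrow> flag_edge (M, N) \<subseteq> {(M, N). flag M N}"
  by (auto simp: flag_edge_def)

lemma finite_flag_edge: "chain (std_lattice :: 'k::{field,finite} bt_lattice) M N \<Longrightarrow> finite (flag_edge (M, N))"
  using finite_subset[OF flag_edge_flags finite_flags_std] .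

lemma flag_level_pos_or_opp: "flag M N \<Longrightarrow> flag_level (M, N) = 0 \<longleftrightarrow> (M, N) \<in> opp_flags"
  by (cases "M = M0 \<and> N = N0") (simp_all add: flag_level_def opp_flags_def)

lemma Cs_sum1:
  fixes c :: "'k::{field,finite} bt_simplex \<Rightarrow> 'v::ab_group_add"
  assumes "is_lattice M" "dg M = 1"
  shows "sum c (Cs {v0, hcls M}) = (\<Sum>N\<in>{N. flag M N}. c (ch_flag M N))"
proof -
  have "inj_on (ch_flag M) {N. flag M N}" by (rule inj_onI) (metis ch_inj mem_Collect_eq)
  then show ?thesis using Cs_dg1[OF assms(1) std_is_lattice] assms by (simp add: dg_std v0_def sum.reindex)
qed

lemma Cs_sum2:
  fixes c :: "'k::{field,finite} bt_simplex \<Rightarrow> 'v::ab_group_add"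
  assumes "is_lattice N" "dg N = 2"
  shows "sum c (Cs {v0, hcls N}) = (\<Sum>M\<in>{M. flag M N}. c (ch_flag M N))"
proof -
  have "inj_on (\<lambda>M. ch_flag M N) {M. flag M N}" by (rule inj_onI) (metis ch_inj mem_Collect_eq)
  then show ?thesis using Cs_dg2[OF assms(1) std_is_lattice] assms by (simp add: dg_std v0_def sum.reindex)
qed

definition flag_sum :: "('k::field bt_simplex \<Rightarrow> 'v::ab_group_add) \<Rightarrow> 'k bt_lattice \<times> 'k bt_lattice \<Rightarrow> 'v" where
  "flag_sum c p = (\<Sum>(M, N)\<in>flag_edge p. c (ch_flag M N))"

lemma flag_sum_eq:
  fixes c :: "'k::{field,finite} bt_simplex \<Rightarrow> 'v::ab_group_add"
  assumes "flag M N"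
  shows "flag_sum c (M, N) = sum c (Cs (if vary_fst (M, N) then {v0, hcls N} else {v0, hcls M}))"
proof -
  have l: "is_lattice M" "is_lattice N" "dg M = 1" "dg N = 2"
    using assms chain_dg[OF assms] unfolding chain_def by (auto simp: dg_std)
  have i: "inj_on (\<lambda>M'. (M', N)) S" "inj_on (\<lambda>N'. (M, N')) S" for S by (auto intro: inj_onI)
  show ?thesis using Cs_sum1[OF l(1,3), of c] Cs_sum2[OF l(2,4), of c]
    by (simp add: flag_sum_def flag_edge_def sum.reindex i)
qed

text \<open>Each vertex other than the root \<open>M0\<close> is joined to the vertex before it in
  the tree, found as a join with \<open>N0\<close>, a meet with \<open>M0\<close>, or a member of
  the reference flag.\<close>

lemma v0_edge_cases:
  fixes e :: "'k::field bt_simplex"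
  assumes e: "is_edge e" "v0 \<in> e" "e \<noteq> {v0, hcls M0}"
  shows "\<exists>M N. flag M N \<and> flag_level (M, N) > 0 \<and> e = (if vary_fst (M, N) then {v0, hcls N} else {v0, hcls M})"
proof -
  obtain X where X: "is_lattice X" "X \<subset> std_lattice" "shl 1 std_lattice \<subset> X" "e = {v0, hcls X}"
    using edge_at[OF e(1) std_is_lattice] e(2) unfolding v0_def by metis
  consider "dg X = 1" | "dg X = 2" using edge_dg[OF X(1) std_is_lattice X(2,3)] by (auto simp: dg_std)
  then show ?thesis
  proof cases
    case 1
    obtain a where a: "a \<noteq> 0" "X = plane a" using codim1_std[OF X(1,2) 1] by blast
    have ne: "X \<noteq> M0" using e(3) X(4) by blast
    show ?thesis
    proof (cases "N0 \<subseteq> X")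
      case True
      have "dot3 a (vector [1, 0, 0]) = 0" using True a line_plane_iff by blast
      then have "flag X N0" unfolding chain_std_iff using a
        by (intro exI[of _ a] exI[of _ "vector [1, 0, 0]"]) (auto simp: vec3_eq_iff)
      moreover have "N0 \<subseteq> (M0 :: 'k bt_lattice)" by (simp add: N0_plane)
      ultimately show ?thesis using X(4) ne True
        by (intro exI[of _ X] exI[of _ N0]) (simp add: vary_fst_def flag_level_def)
    next
      case False
      then obtain N where N: "flag X N" "N \<subseteq> M0" using ex_meet a by blast
      then show ?thesis using X(4) ne by (intro exI[of _ X] exI[of _ N]) (simp add: vary_fst_def flag_level_def)
    qed
  next
    case 2
    obtain b where b: "b \<noteq> 0" "X = line b" using codim2_std[OF X(1-3) 2] by blast
    show ?thesis
    proof (cases "X \<subseteq> M0")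
      case True
      have "dot3 (vector [0, 0, 1]) b = 0" using True b line_plane_iff by blast
      then have "flag M0 X" unfolding chain_std_iff using b
        by (intro exI[of _ "vector [0, 0, 1]"] exI[of _ b]) (auto simp: vec3_eq_iff)
      then show ?thesis using X(4) True by (intro exI[of _ M0] exI[of _ X]) (simp add: vary_fst_def flag_level_def)
    next
      case False
      then obtain M where M: "flag M X" "N0 \<subseteq> M" using ex_join b by blast
      then show ?thesis using X(4) False by (intro exI[of _ M] exI[of _ X]) (simp add: vary_fst_def flag_level_def)
    qed
  qed
qed

lemma St0_flag: "St0_chamber s \<longleftrightarrow> (\<exists>M N. flag M N \<and> s = ch_flag M N)"
proof
  assume "St0_chamber s"
  then show "\<exists>M N. flag M N \<and> s = ch_flag M N"
    using chamber_chain_at[OF _ std_is_lattice, of s] unfolding St0_chamber_def v0_def by metis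
next
  assume "\<exists>M N. flag M N \<and> s = ch_flag M N"
  then show "St0_chamber s" by (auto simp: St0_chamber_def is_chamber_iff ch_def v0_def)
qed

lemma Cs_v0: "v0 \<in> e \<Longrightarrow> {s. St0_chamber s \<and> e \<subseteq> s} = Cs e"
  by (auto simp: St0_chamber_def Cs_def)

lemma Char_St0_iff:
  "c \<in> Char_St0 \<longleftrightarrow> (\<forall>s. \<not> St0_chamber s \<longrightarrow> c s = 0) \<and> (\<forall>e. is_edge e \<and> v0 \<in> e \<longrightarrow> sum c (Cs e) = 0)"
  unfolding Char_St0_def by (auto simp: Cs_v0)

lemma vary_edge:
  assumes "flag M N"
  shows "is_edge (if vary_fst (M, N) then {v0, hcls N} else {v0, hcls M})"
    "v0 \<in> (if vary_fst (M, N) then {v0, hcls N} else {v0, hcls M})"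
proof -
  have "is_edge {v0, hcls M}" "is_edge {v0, hcls N}"
    using assms unfolding is_edge_def scale_X chain_def v0_def by (metis psubset_trans)+
  then show "is_edge (if vary_fst (M, N) then {v0, hcls N} else {v0, hcls M})" by simp
qed simp

text \<open>The recursion along the tree secures the condition at every edge except the one to the
  root; that last one follows from \<open>star_sum\<close> at the standard vertex.\<close>

lemma St0_extension:
  fixes f :: "'k::{field,finite} bt_simplex \<Rightarrow> 'v::ab_group_add"
  shows "\<exists>c\<in>Char_St0. \<forall>(M, N)\<in>opp_flags. c (ch_flag M N) = f (ch_flag M N)"
proof -
  let ?lv = "\<lambda>p. if flag (fst p) (snd p) then flag_level p else 0"
  have "\<exists>r. \<forall>p. r p = (if ?lv p = 0 then f (ch_flag (fst p) (snd p)) else - sum r (flag_edge p - {p}))"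
  proof (rule well_founded_extension)
    fix p p' :: "'k bt_lattice \<times> 'k bt_lattice"
    assume p: "?lv p > 0" "p' \<in> flag_edge p - {p}"
    obtain M N where MN: "p = (M, N)" by (cases p)
    have c: "flag M N" "flag_level (M, N) > 0" using p(1) MN by (auto split: if_splits)
    have "flag_level p' < flag_level (M, N)" using flag_edge_decreases[OF c] p(2) MN by blast
    then show "?lv p' < ?lv p" using c MN by simp
  qed
  then obtain r where r: "\<And>p. r p = (if ?lv p = 0 then f (ch_flag (fst p) (snd p)) else - sum r (flag_edge p - {p}))" by blast
  define pr :: "'k bt_simplex \<Rightarrow> 'k bt_lattice \<times> 'k bt_lattice" where
    "pr s = (SOME p. flag (fst p) (snd p) \<and> s = ch_flag (fst p) (snd p))" for s
  define c where "c s = (if St0_chamber s then r (pr s) else 0)" for s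
  have pr: "pr (ch_flag M N) = (M, N)" if "flag M N" for M N
  proof -
    have "flag (fst (pr (ch_flag M N))) (snd (pr (ch_flag M N))) \<and>
       ch_flag M N = ch_flag (fst (pr (ch_flag M N))) (snd (pr (ch_flag M N)))"
      unfolding pr_def by (rule someI[of _ "(M, N)"]) (use that in simp)
    then show ?thesis using ch_inj[OF that] by (metis prod.collapse)
  qed
  have cr: "c (ch_flag M N) = r (M, N)" if "flag M N" for M N
    using pr[OF that] that St0_flag by (auto simp: c_def)
  have z: "flag_sum c (M, N) = 0" if h: "flag M N" "flag_level (M, N) > 0" for M N
  proof -
    have "flag_sum c (M, N) = sum r (flag_edge (M, N))"
      unfolding flag_sum_def using flag_edge_flags[OF h(1)] cr by (intro sum.cong) auto
    also have "\<dots> = r (M, N) + sum r (flag_edge (M, N) - {(M, N)})"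
      by (rule sum.remove[OF finite_flag_edge[OF h(1)] flag_edge_self[OF h(1)]])
    also have "\<dots> = 0" using r[of "(M, N)"] h by simp
    finally show ?thesis .
  qed
  have e1: "sum c (Cs e) = 0" if h: "is_edge e" "v0 \<in> e" "e \<noteq> {v0, hcls M0}" for e
  proof -
    obtain M N where MN: "flag M N" "flag_level (M, N) > 0"
      "e = (if vary_fst (M, N) then {v0, hcls N} else {v0, hcls M})"
      using v0_edge_cases[OF h] by blast
    show ?thesis unfolding MN(3) flag_sum_eq[OF MN(1), symmetric] by (rule z[OF MN(1,2)])
  qed
  have "sum c (Cs e) = 0" if h: "is_edge e" "v0 \<in> e" for e
  proof (cases "e = {v0, hcls M0}")
    case True
    then show ?thesis using star_sum[OF std_is_lattice h(1), of c] h(2) e1 unfolding v0_def by blast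
  qed (use e1 h in blast)
  moreover have "c (ch_flag M N) = f (ch_flag M N)" if "(M, N) \<in> opp_flags" for M N
  proof -
    have "flag M N" using that by (simp add: opp_flags_def)
    then show ?thesis using cr r[of "(M, N)"] flag_level_pos_or_opp[of M N] that by simp
  qed
  moreover have "c s = 0" if "\<not> St0_chamber s" for s using that by (simp add: c_def)
  ultimately show ?thesis unfolding Char_St0_iff by (intro bexI[of _ c]) (auto simp: Char_St0_iff)
qed

lemma St0_unique:
  fixes c :: "'k::{field,finite} bt_simplex \<Rightarrow> 'v::ab_group_add"
  assumes c: "c \<in> Char_St0" and z: "\<forall>(M, N)\<in>opp_flags. c (ch_flag M N) = 0"
  shows "c = (\<lambda>_. 0)"
proof -
  note c' = c[unfolded Char_St0_iff]
  have "flag M N \<longrightarrow> c (ch_flag M N) = 0" for M N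
  proof (induction "flag_level (M, N)" arbitrary: M N rule: less_induct)
    case less
    show ?case
    proof
      assume h: "flag M N"
      show "c (ch_flag M N) = 0"
      proof (cases "flag_level (M, N) = 0")
        case True
        then show ?thesis using z flag_level_pos_or_opp[OF h] by auto
      next
        case False
        have "flag_sum c (M, N) = 0" unfolding flag_sum_eq[OF h] using vary_edge[OF h] c' by blast
        moreover have "flag_sum c (M, N) = c (ch_flag M N) + (\<Sum>(M, N)\<in>flag_edge (M, N) - {(M, N)}. c (ch_flag M N))"
          unfolding flag_sum_def by (subst sum.remove[OF finite_flag_edge[OF h] flag_edge_self[OF h]]) simp
        moreover have "(\<Sum>(M, N)\<in>flag_edge (M, N) - {(M, N)}. c (ch_flag M N)) = 0"
        proof (rule sum.neutral, rule ballI)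
          fix p assume p: "p \<in> flag_edge (M, N) - {(M, N)}"
          obtain M' N' where MN: "p = (M', N')" by (cases p)
          have "flag_level (M', N') < flag_level (M, N)" using flag_edge_decreases[OF h _ _] False p MN by blast
          moreover have "flag M' N'" using flag_edge_flags[OF h] p MN by blast
          ultimately show "(case p of (M, N) \<Rightarrow> c (ch_flag M N)) = 0" using less[of M' N'] MN by simp
        qed
        ultimately show ?thesis by simp
      qed
    qed
  qed
  then show ?thesis using c' St0_flag by (metis ext)
qed

section \<open>The restriction isomorphism\<close>

lemma vector_space_fun_scale:
  fixes scale :: "'f::field \<Rightarrow> 'v::ab_group_add \<Rightarrow> 'v"
  assumes "vector_space scale" shows "vector_space (fun_scale scale)"
proof -
  interpret vector_space scale by (rule assms)
  show ?thesis
    by unfold_locales (auto simp: fun_scale_def fun_eq_iff scale_right_distrib scale_left_distrib)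
qed

lemma sum_fun_apply: "sum f S x = (\<Sum>i\<in>S. f i x)" for f :: "'i \<Rightarrow> 's \<Rightarrow> 'v::ab_group_add"
  by (induction S rule: infinite_finite_induct) auto

text \<open>Evaluation on \<open>S\<close> identifies \<open>W\<close> with the functions from
  \<open>S\<close> to V. As the ambient function space need not be finite-dimensional, an explicit
  basis is used: \<open>E (s, b)\<close> has value b at s and 0 at the other points of
  \<open>S\<close>.\<close>

lemma dim_by_evaluation:
  fixes scale :: "'f::field \<Rightarrow> 'v::ab_group_add \<Rightarrow> 'v" and W :: "('s \<Rightarrow> 'v) set"
  assumes V: "vector_space scale" and fin: "\<exists>B. finite_dimensional_vector_space scale B"
    and S: "finite S"
    and sub: "module.subspace (fun_scale scale) W"
    and inj: "\<And>c. c \<in> W \<Longrightarrow> (\<forall>s\<in>S. c s = 0) \<Longrightarrow> c = 0"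
    and surj: "\<And>f. \<exists>c\<in>W. \<forall>s\<in>S. c s = f s"
  shows "vector_space.dim (fun_scale scale) W = card S * vector_space.dim scale UNIV"
proof -
  interpret vs: vector_space scale by (rule V)
  interpret fs: vector_space "fun_scale scale" by (rule vector_space_fun_scale[OF V])
  obtain B where B: "finite_dimensional_vector_space scale B" using fin by blast
  interpret fd: finite_dimensional_vector_space scale B by (rule B)
  have fB: "finite B" and iB: "vs.independent B" and sB: "vs.span B = UNIV"
    using fd.finite_Basis fd.independent_Basis fd.span_Basis by auto
  have dB: "vs.dim UNIV = card B" by (rule vs.dim_unique[OF _ _ iB refl]) (auto simp: sB)
  have ex: "\<exists>c. c \<in> W \<and> (\<forall>s\<in>S. c s = (if s = fst p then snd p else 0))" for p
    using surj[of "\<lambda>s. if s = fst p then snd p else 0"] by blast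
  define E where "E p = (SOME c. c \<in> W \<and> (\<forall>s\<in>S. c s = (if s = fst p then snd p else 0)))" for p
  have E: "E p \<in> W" "s \<in> S \<Longrightarrow> E p s = (if s = fst p then snd p else 0)" for p s
    using someI_ex[OF ex[of p]] unfolding E_def by blast+
  have nz: "b \<noteq> 0" if "b \<in> B" for b using iB that vs.dependent_zero by blast
  have Einj: "inj_on E (S \<times> B)"
  proof (rule inj_onI)
    fix p p' assume p: "p \<in> S \<times> B" "p' \<in> S \<times> B" "E p = E p'"
    have o: "fst p \<in> S" "snd p \<noteq> 0" using p(1) nz by auto
    have "E p (fst p) = E p' (fst p)" using p(3) by simp
    then have *: "snd p = (if fst p = fst p' then snd p' else 0)" using E(2)[OF o(1), of p] E(2)[OF o(1), of p'] by simp
    then have "fst p = fst p'" using o(2) by presburger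
    then show "p = p'" using * by (simp add: prod_eq_iff)
  qed
  have fE: "finite (E ` (S \<times> B))" using S fB by simp
  have ev: "(\<Sum>p\<in>S \<times> B. fun_scale scale (u p) (E p)) s = (\<Sum>b\<in>B. scale (u (s, b)) b)" if s: "s \<in> S" for u s
  proof -
    have "(\<Sum>p\<in>S \<times> B. fun_scale scale (u p) (E p)) s = (\<Sum>p\<in>S \<times> B. scale (u p) (E p s))"
      by (simp add: sum_fun_apply fun_scale_def)
    also have "\<dots> = (\<Sum>o'\<in>S. \<Sum>b\<in>B. scale (u (o', b)) (E (o', b) s))"
      by (simp add: sum.cartesian_product)
    also have "\<dots> = (\<Sum>o'\<in>S. if o' = s then \<Sum>b\<in>B. scale (u (s, b)) b else 0)"
      by (rule sum.cong) (auto simp: E(2)[OF s])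
    also have "\<dots> = (\<Sum>b\<in>B. scale (u (s, b)) b)" using S s by (simp add: sum.delta)
    finally show ?thesis .
  qed
  have ind: "fs.independent (E ` (S \<times> B))"
  proof (rule fs.independent_if_scalars_zero[OF fE])
    fix u x assume z: "(\<Sum>x\<in>E ` (S \<times> B). fun_scale scale (u x) x) = 0" and x: "x \<in> E ` (S \<times> B)"
    obtain s b where sb: "x = E (s, b)" "s \<in> S" "b \<in> B" using x by auto
    have "(\<Sum>p\<in>S \<times> B. fun_scale scale (u (E p)) (E p)) = 0" using z by (simp add: sum.reindex[OF Einj])
    then have "(\<Sum>b\<in>B. scale (u (E (s, b))) b) = 0" using ev[OF sb(2), of "\<lambda>p. u (E p)"] by simp
    then have "u (E (s, b)) = 0"
      using vs.independentD[OF iB fB order_refl, of "\<lambda>b. u (E (s, b))" b] sb(3) by simp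
    then show "u x = 0" using sb(1) by simp
  qed
  have sp: "W \<subseteq> fs.span (E ` (S \<times> B))"
  proof
    fix c assume c: "c \<in> W"
    have "\<forall>s. \<exists>u. c s = (\<Sum>b\<in>B. scale (u b) b)"
    proof
      fix s
      have "c s \<in> vs.span B" using sB by simp
      then show "\<exists>u. c s = (\<Sum>b\<in>B. scale (u b) b)" unfolding vs.span_finite[OF fB] by blast
    qed
    then obtain u where u: "\<And>s. c s = (\<Sum>b\<in>B. scale (u s b) b)" by metis
    define c' where "c' = (\<Sum>p\<in>S \<times> B. fun_scale scale (u (fst p) (snd p)) (E p))"
    have c'W: "c' \<in> W" unfolding c'_def
      by (intro fs.subspace_sum[OF sub] fs.subspace_scale[OF sub] E(1))
    have "c - c' = 0"
    proof (rule inj)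
      show "c - c' \<in> W" using fs.subspace_diff[OF sub c c'W] .
      show "\<forall>s\<in>S. (c - c') s = 0"
        using ev[of _ "\<lambda>p. u (fst p) (snd p)"] u by (simp add: c'_def)
    qed
    then have "c = c'" by simp
    moreover have "c' \<in> fs.span (E ` (S \<times> B))" unfolding c'_def
      by (intro fs.span_sum fs.span_scale fs.span_base imageI)
    ultimately show "c \<in> fs.span (E ` (S \<times> B))" by simp
  qed
  have "fs.dim W = card (E ` (S \<times> B))"
    by (rule fs.dim_unique[OF _ sp ind refl]) (use E(1) in auto)
  then show ?thesis using dB card_image[OF Einj] by (simp add: card_cartesian_product)
qed

section \<open>The slash action and restriction to the star\<close>

locale rep3 = vector_space scale
  for scale :: "'k::{field,finite} Fld \<Rightarrow> 'v::ab_group_add \<Rightarrow> 'v" +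
  fixes rho :: "'k Fld ^ 3 ^ 3 \<Rightarrow> 'v \<Rightarrow> 'v"
  assumes lin: "\<And>g. invertible g \<Longrightarrow> Vector_Spaces.linear scale scale (rho g)"
    and act1: "rho (mat 1) = id"
    and actmul: "\<And>g h. invertible g \<Longrightarrow> invertible h \<Longrightarrow> rho (g ** h) = rho g \<circ> rho h"
begin

lemma rho_hom: "invertible g \<Longrightarrow> module_hom scale scale (rho g)"
  using lin Vector_Spaces.linear.axioms(3) by blast

lemma rho_0 [simp]: "invertible g \<Longrightarrow> rho g 0 = 0"
  using module_hom.zero[OF rho_hom] .

lemma rho_sum: "invertible g \<Longrightarrow> rho g (sum f S) = (\<Sum>x\<in>S. rho g (f x))"
  using module_hom.sum[OF rho_hom] .

lemma rho_inv:
  assumes "invertible g"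
  shows "rho (matrix_inv g) (rho g x) = x" "rho g (rho (matrix_inv g) x) = x"
proof -
  have "rho (matrix_inv g ** g) = rho (matrix_inv g) \<circ> rho g" "rho (g ** matrix_inv g) = rho g \<circ> rho (matrix_inv g)"
    using actmul assms invertible_matrix_inv by blast+
  then show "rho (matrix_inv g) (rho g x) = x" "rho g (rho (matrix_inv g) x) = x"
    using assms act1 by (auto simp: invertible_inv fun_eq_iff)
qed

lemma slash_slash:
  assumes "invertible g" "invertible h"
  shows "slash rho (slash rho c g) h = slash rho c (g ** h)"
proof -
  have "(g ** h) ** (matrix_inv h ** matrix_inv g) = g ** (h ** matrix_inv h) ** matrix_inv g"
    by (simp only: matrix_mul_assoc)
  then have "matrix_inv (g ** h) = matrix_inv h ** matrix_inv g"
    using assms by (intro matrix_inv_unique) (simp add: invertible_inv)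
  then have "rho (matrix_inv (g ** h)) = rho (matrix_inv h) \<circ> rho (matrix_inv g)"
    using assms actmul invertible_matrix_inv by metis
  then show ?thesis by (simp add: slash_def fun_eq_iff act_simplex_mult)
qed

lemma slash_sum:
  assumes "invertible g"
  shows "sum (slash rho c g) (Cs e) = rho (matrix_inv g) (sum c (Cs (act_simplex g e)))"
proof -
  have "sum c (Cs (act_simplex g e)) = (\<Sum>s\<in>Cs e. c (act_simplex g s))"
    unfolding Cs_act[OF assms] by (rule sum.reindex_cong[OF act_inj[OF assms] refl refl])
  then show ?thesis by (simp add: slash_def rho_sum[OF invertible_matrix_inv[OF assms]])
qed

lemma slash_harmonic:
  assumes g: "invertible g" and c: "harmonic c"
  shows "harmonic (slash rho c g)"
proof -
  have "slash rho c g s = 0" if "\<not> is_chamber s" for s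
    using that c act_chamber_iff[OF g, of s] rho_0[OF invertible_matrix_inv[OF g]]
    by (simp add: slash_def harmonic_def)
  moreover have "sum (slash rho c g) (Cs e) = 0" if "is_edge e" for e
  proof -
    have "sum c (Cs (act_simplex g e)) = 0" using c act_edge[OF g that] by (simp add: harmonic_def Cs_def)
    then show ?thesis using slash_sum[OF g] rho_0[OF invertible_matrix_inv[OF g]] by simp
  qed
  ultimately show ?thesis by (simp add: harmonic_def Cs_def)
qed

lemma harmonic_diff:
  assumes "harmonic c" "harmonic c'"
  shows "harmonic (\<lambda>s. c s - c' s :: 'v)"
  using assms by (auto simp: harmonic_def sum_subtractf)

lemma Gamma_invertible: "g \<in> Gamma_t \<Longrightarrow> invertible g"
  using Gamma_t_GL3A GL3A_invertible by blast

lemma act_v0_inv: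
  assumes "u \<in> Gamma_t" "act_vertex u v0 \<in> s"
  shows "v0 \<in> act_simplex (matrix_inv u) s"
proof -
  have "act_vertex (matrix_inv u) (act_vertex u v0) = act_vertex (matrix_inv u ** u) v0"
    by (simp add: act_vertex_mult)
  also have "\<dots> = v0" using Gamma_invertible[OF assms(1)] by (simp add: invertible_inv act_vertex_def)
  finally show ?thesis using act_mem[OF assms(2), of "matrix_inv u"] by simp
qed

lemma level0_translate:
  assumes "u \<in> Gamma_t" "is_chamber s" "act_vertex u v0 \<in> s"
  shows "St0_chamber (act_simplex (matrix_inv u) s)" "level s = 0"
proof -
  have i: "invertible (matrix_inv u)" using Gamma_invertible[OF assms(1)] invertible_matrix_inv by blast
  show s: "St0_chamber (act_simplex (matrix_inv u) s)"
    using act_chamber[OF i assms(2)] act_v0_inv[OF assms(1,3)] by (simp add: St0_chamber_def)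
  then have "level (act_simplex (matrix_inv u) s) = 0" using level_St0[of "act_simplex (matrix_inv u) s"] by (simp add: St0_chamber_def)
  then show "level s = 0" using level_act[OF GL3A_inv[OF Gamma_t_GL3A[OF assms(1)]] assms(2)] by simp
qed

lemma restr_Char:
  assumes "harmonic c" shows "restr_St0 c \<in> Char_St0"
proof -
  have "sum (restr_St0 c) (Cs e) = 0" if e: "is_edge e" "v0 \<in> e" for e
  proof -
    have "sum (restr_St0 c) (Cs e) = sum c (Cs e)"
      using e(2) by (intro sum.cong) (auto simp: restr_St0_def Cs_def St0_chamber_def)
    then show ?thesis using assms e(1) by (simp add: harmonic_def Cs_def)
  qed
  then show ?thesis by (simp add: Char_St0_iff restr_St0_def)
qed

lemma Char_Gamma_translate:
  assumes c: "c \<in> Char_Gamma rho Gamma_t" and u: "u \<in> Gamma_t"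
  shows "c s = rho u (c (act_simplex (matrix_inv u) s))"
proof -
  have i: "invertible u" by (rule Gamma_invertible[OF u])
  have "slash rho c u (act_simplex (matrix_inv u) s) = c (act_simplex (matrix_inv u) s)"
    using c u by (simp add: Char_Gamma_def)
  then have "rho (matrix_inv u) (c s) = c (act_simplex (matrix_inv u) s)"
    by (simp add: slash_def act_inv[OF i])
  then show ?thesis using rho_inv(2)[OF i, of "c s"] by simp
qed

lemma restr_inj: "inj_on restr_St0 (Char_Gamma rho Gamma_t)"
proof (rule inj_onI)
  fix c c' assume c: "c \<in> Char_Gamma rho Gamma_t" "c' \<in> Char_Gamma rho Gamma_t" "restr_St0 c = restr_St0 c'"
  have "(\<lambda>s. c s - c' s) = (\<lambda>_. 0)"
  proof (rule harmonic_unique)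
    show "harmonic (\<lambda>s. c s - c' s)" by (rule harmonic_diff) (use c in \<open>simp_all add: Char_Gamma_def\<close>)
    fix s :: "'k bt_simplex" assume s: "is_chamber s" "level s = 0"
    obtain u where u: "u \<in> Gamma_t" "act_vertex u v0 \<in> s" using level0_vertex[OF s] by blast
    have "St0_chamber (act_simplex (matrix_inv u) s)" using level0_translate[OF u(1) s(1) u(2)] by blast
    then have "c (act_simplex (matrix_inv u) s) = c' (act_simplex (matrix_inv u) s)"
      using fun_cong[OF c(3), of "act_simplex (matrix_inv u) s"] by (simp add: restr_St0_def)
    then have "c s = c' s" using Char_Gamma_translate[OF c(1) u(1), of s] Char_Gamma_translate[OF c(2) u(1), of s] by simp
    then show "c s - c' s = 0" by simp
  qed
  then show "c = c'" by (simp add: fun_eq_iff)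
qed

lemma restr_surj:
  assumes c0: "c0 \<in> Char_St0"
  shows "\<exists>c\<in>Char_Gamma rho Gamma_t. restr_St0 c = c0"
proof -
  \<comment> \<open>Invariance forces the value at a translate by \<open>u\<close> to be
    \<open>rho u\<close> of the value on the star. By \<open>Gamma_t_vertex_unique\<close> the
    choice operator has only one candidate.\<close>
  define b where "b s = (if is_chamber s \<and> level s = 0
     then (let u = (SOME u. u \<in> Gamma_t \<and> act_vertex u v0 \<in> s) in rho u (c0 (act_simplex (matrix_inv u) s))) else 0)" for s
  have bu: "b s = rho u (c0 (act_simplex (matrix_inv u) s))" if h: "is_chamber s" "u \<in> Gamma_t" "act_vertex u v0 \<in> s" for s u
  proof -
    have "(SOME u. u \<in> Gamma_t \<and> act_vertex u v0 \<in> s) = u"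
    proof (rule some_equality)
      show "u \<in> Gamma_t \<and> act_vertex u v0 \<in> s" using h by blast
      fix u' assume "u' \<in> Gamma_t \<and> act_vertex u' v0 \<in> s"
      then show "u' = u" using Gamma_t_vertex_unique[OF _ h(2) h(1) _ h(3)] by blast
    qed
    then show ?thesis using level0_translate(2)[OF h(2,1,3)] h(1) by (simp add: b_def Let_def)
  qed
  have base: "harmonic_at b e" if h: "is_edge e" "\<forall>s\<in>Cs e. level s = 0" for e
  proof (cases "Cs e = {}")
    case False
    obtain u where u: "u \<in> Gamma_t" "act_vertex u v0 \<in> e" using level0_edge[OF h False] by blast
    have i: "invertible u" "invertible (matrix_inv u)" using Gamma_invertible[OF u(1)] invertible_matrix_inv by blast+
    let ?e = "act_simplex (matrix_inv u) e"
    have "sum b (Cs e) = (\<Sum>s\<in>Cs e. rho u (c0 (act_simplex (matrix_inv u) s)))"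
      using u by (intro sum.cong refl bu) (auto simp: Cs_def)
    also have "\<dots> = rho u (\<Sum>s\<in>Cs e. c0 (act_simplex (matrix_inv u) s))" by (rule rho_sum[OF i(1), symmetric])
    also have "(\<Sum>s\<in>Cs e. c0 (act_simplex (matrix_inv u) s)) = sum c0 (Cs ?e)"
      unfolding Cs_act[OF i(2)] by (rule sum.reindex_cong[OF act_inj[OF i(2)] refl refl, symmetric])
    also have "\<dots> = 0" using c0 act_edge[OF i(2) h(1)] act_v0_inv[OF u] unfolding Char_St0_iff by blast
    finally show ?thesis using i(1) by (simp add: harmonic_at_def)
  qed (simp add: harmonic_at_def)
  have "\<exists>c. (\<forall>s. is_chamber s \<and> level s = 0 \<longrightarrow> c s = b s) \<and> (\<forall>s. \<not> is_chamber s \<longrightarrow> c s = 0)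
     \<and> (\<forall>e. is_edge e \<longrightarrow> harmonic_at c e)"
    by (rule harmonic_extension[OF base]) (auto simp: b_def)
  then obtain c where c: "\<And>s. is_chamber s \<Longrightarrow> level s = 0 \<Longrightarrow> c s = b s" "\<And>s. \<not> is_chamber s \<Longrightarrow> c s = 0"
    "\<And>e. is_edge e \<Longrightarrow> harmonic_at c e" by blast
  have hc: "harmonic c" using c(2,3) by (auto simp: harmonic_def harmonic_at_def Cs_def)
  have inv: "slash rho c g = c" if g: "g \<in> Gamma_t" for g
  proof -
    have gi: "invertible g" by (rule Gamma_invertible[OF g])
    have "(\<lambda>s. slash rho c g s - c s) = (\<lambda>_. 0)"
    proof (rule harmonic_unique)
      show "harmonic (\<lambda>s. slash rho c g s - c s)" by (rule harmonic_diff[OF slash_harmonic[OF gi hc] hc])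
      fix s :: "'k bt_simplex" assume s: "is_chamber s" "level s = 0"
      obtain u where u: "u \<in> Gamma_t" "act_vertex u v0 \<in> s" using level0_vertex[OF s] by blast
      have ui: "invertible u" by (rule Gamma_invertible[OF u(1)])
      have gu: "g ** u \<in> Gamma_t" by (rule Gamma_t_mult[OF g u(1)])
      have m: "act_vertex (g ** u) v0 \<in> act_simplex g s" using act_mem[OF u(2), of g] by (simp add: act_vertex_mult)
      have gs: "is_chamber (act_simplex g s)" by (rule act_chamber[OF gi s(1)])
      have "act_simplex (g ** u) (act_simplex (matrix_inv u) s) = act_simplex g s"
        by (simp add: act_simplex_mult act_inv[OF ui])
      \<comment> \<open>The chambers \<open>s\<close> and its image under \<open>g\<close> come from
        the same chamber of the star, through \<open>u\<close> and \<open>g ** u\<close>. So both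
        sides agree at level 0, and uniqueness does the rest.\<close>
      then have a: "act_simplex (matrix_inv (g ** u)) (act_simplex g s) = act_simplex (matrix_inv u) s"
        using act_inv(1)[OF Gamma_invertible[OF gu]] by metis
      have "c (act_simplex g s) = b (act_simplex g s)" using c(1)[OF gs] level0_translate(2)[OF gu gs m] by blast
      also have "\<dots> = rho (g ** u) (c0 (act_simplex (matrix_inv u) s))" using bu[OF gs gu m] a by simp
      also have "\<dots> = rho g (b s)" using actmul[OF gi ui] bu[OF s(1) u] by simp
      also have "b s = c s" using c(1)[OF s] by simp
      finally have "slash rho c g s = c s" using rho_inv(1)[OF gi] by (simp add: slash_def)
      then show "slash rho c g s - c s = 0" by simp
    qed
    then show ?thesis by (simp add: fun_eq_iff)
  qed
  have "restr_St0 c = c0"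
  proof
    fix s
    show "restr_St0 c s = c0 s"
    proof (cases "St0_chamber s")
      case True
      then have s: "is_chamber s" "v0 \<in> s" by (auto simp: St0_chamber_def)
      have o: "matrix_inv (mat 1 :: 'k Fld ^ 3 ^ 3) = mat 1" by (rule matrix_inv_unique) simp
      have "act_vertex (mat 1) v0 \<in> s" using s(2) by (simp add: act_vertex_def)
      then have "b s = c0 s" using bu[OF s(1) Gamma_t_one] by (simp add: o act1)
      then show ?thesis using c(1)[OF s(1) level_St0[OF s]] True by (simp add: restr_St0_def)
    next
      case False
      then show ?thesis using c0 by (simp add: restr_St0_def Char_St0_def)
    qed
  qed
  then show ?thesis using hc inv by (auto simp: Char_Gamma_def)
qed

lemma restr_bij: "bij_betw restr_St0 (Char_Gamma rho Gamma_t) Char_St0"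
proof -
  have "restr_St0 ` Char_Gamma rho Gamma_t = Char_St0"
    using restr_Char restr_surj by (auto simp: Char_Gamma_def)
  then show ?thesis using restr_inj by (simp add: bij_betw_def)
qed

lemma act_St0_iff:
  fixes s :: "'k bt_simplex"
  assumes "g \<in> GL3Fq"
  shows "St0_chamber (act_simplex g s) \<longleftrightarrow> St0_chamber s"
proof -
  have i: "invertible g" using GL3A_invertible[OF GL3Fq_GL3A[OF assms]] .
  have 1: "v0 \<in> s \<Longrightarrow> v0 \<in> act_simplex g s" for s :: "'k bt_simplex" using act_mem[of v0 s g] v0_fixed[OF assms] by simp
  have "act_vertex (matrix_inv g) v0 = act_vertex (matrix_inv g) (act_vertex g v0)" using v0_fixed[OF assms] by simp
  also have "\<dots> = v0" unfolding act_vertex_mult[symmetric] using i by (simp add: invertible_inv act_vertex_def)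
  finally have "v0 \<in> act_simplex g s \<Longrightarrow> v0 \<in> act_simplex (matrix_inv g) (act_simplex g s)"
    using act_mem[of v0 "act_simplex g s" "matrix_inv g"] by simp
  then have "v0 \<in> act_simplex g s \<longleftrightarrow> v0 \<in> s" using 1 act_inv(1)[OF i] by metis
  then show ?thesis using act_chamber_iff[OF i] by (simp add: St0_chamber_def)
qed

text \<open>Normality of Gamma(t): acting by \<open>h\<close> after \<open>g\<close> is acting by a
  conjugate of \<open>h\<close>, again in Gamma(t), before \<open>g\<close>.\<close>

lemma slash_Char_Gamma:
  assumes c: "c \<in> Char_Gamma rho Gamma_t" and g: "g \<in> GL3Fq"
  shows "slash rho c g \<in> Char_Gamma rho Gamma_t"
proof -
  have gA: "g \<in> GL3A" by (rule GL3Fq_GL3A[OF g])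
  have gi: "invertible g" by (rule GL3A_invertible[OF gA])
  have "slash rho (slash rho c g) h = slash rho c g" if h: "h \<in> Gamma_t" for h
  proof -
    let ?h = "g ** h ** matrix_inv g"
    have h': "?h \<in> Gamma_t" by (rule Gamma_t_conj[OF gA h])
    have "?h ** g = g ** h ** (matrix_inv g ** g)" by (simp only: matrix_mul_assoc)
    then have eq: "g ** h = ?h ** g" using gi by (simp add: invertible_inv)
    have "slash rho (slash rho c g) h = slash rho c (?h ** g)"
      using slash_slash[OF gi Gamma_invertible[OF h]] eq by simp
    also have "\<dots> = slash rho (slash rho c ?h) g" using slash_slash[OF Gamma_invertible[OF h'] gi] by simp
    also have "slash rho c ?h = c" using c h' by (simp add: Char_Gamma_def)
    finally show ?thesis .
  qed
  then show ?thesis using c slash_harmonic[OF gi] by (simp add: Char_Gamma_def)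
qed

lemma restr_slash:
  assumes g: "g \<in> GL3Fq"
  shows "restr_St0 (slash rho c g) = slash rho (restr_St0 c) g"
proof
  fix s
  have gi: "invertible (matrix_inv g)" using invertible_matrix_inv[OF GL3A_invertible[OF GL3Fq_GL3A[OF g]]] .
  show "restr_St0 (slash rho c g) s = slash rho (restr_St0 c) g s"
    using act_St0_iff[OF g, of s] rho_0[OF gi] by (simp add: restr_St0_def slash_def)
qed

text \<open>Surjectivity transfers stability from the building: lift \<open>c\<close>, act on the
  lift, and restrict.\<close>

lemma slash_Char_St0:
  assumes c: "c \<in> Char_St0" and g: "g \<in> GL3Fq"
  shows "slash rho c g \<in> Char_St0"
proof -
  obtain c' where c': "c' \<in> Char_Gamma rho Gamma_t" "restr_St0 c' = c" using restr_surj[OF c] by blast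
  have "restr_St0 (slash rho c' g) \<in> Char_St0"
    by (rule restr_Char) (use slash_Char_Gamma[OF c'(1) g] in \<open>simp add: Char_Gamma_def\<close>)
  then show ?thesis using restr_slash[OF g, of c'] c'(2) by simp
qed

lemma restr_linear: "Vector_Spaces.linear (fun_scale scale) (fun_scale scale) (restr_St0 :: ('k bt_simplex \<Rightarrow> 'v) \<Rightarrow> _)"
proof -
  interpret fs: vector_space "fun_scale scale :: _ \<Rightarrow> ('k bt_simplex \<Rightarrow> 'v) \<Rightarrow> _"
    by (rule vector_space_fun_scale) unfold_locales
  show ?thesis
    by unfold_locales (auto simp: restr_St0_def fun_scale_def fun_eq_iff)
qed

lemma Char_Gamma_subspace: "module.subspace (fun_scale scale) (Char_Gamma rho Gamma_t)"
proof -
  interpret fs: vector_space "fun_scale scale :: _ \<Rightarrow> ('k bt_simplex \<Rightarrow> 'v) \<Rightarrow> _"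
    by (rule vector_space_fun_scale) unfold_locales
  have i: "module_hom scale scale (rho (matrix_inv g))" if "g \<in> Gamma_t" for g
    using rho_hom invertible_matrix_inv[OF Gamma_invertible[OF that]] by blast
  show ?thesis
  proof (rule fs.subspaceI)
    show "0 \<in> Char_Gamma rho Gamma_t"
      using module_hom.zero[OF i] by (auto simp: Char_Gamma_def harmonic_def slash_def fun_eq_iff)
    fix x y :: "'k bt_simplex \<Rightarrow> 'v" assume xy: "x \<in> Char_Gamma rho Gamma_t"
    { assume y: "y \<in> Char_Gamma rho Gamma_t"
      show "x + y \<in> Char_Gamma rho Gamma_t"
        using xy y module_hom.add[OF i] by (auto simp: Char_Gamma_def harmonic_def slash_def fun_eq_iff sum.distrib) }
    fix r
    show "fun_scale scale r x \<in> Char_Gamma rho Gamma_t"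
      using xy module_hom.scale[OF i]
      by (auto simp: Char_Gamma_def harmonic_def slash_def fun_eq_iff fun_scale_def scale_sum_right[symmetric])
  qed
qed

text \<open>Evaluation on the chambers of opposite flags is injective by \<open>restr_inj\<close>
  and \<open>St0_unique\<close>, and onto by \<open>St0_extension\<close> followed by
  \<open>restr_surj\<close>.\<close>

lemma dim_Char_Gamma:
  assumes fin: "\<exists>B. finite_dimensional_vector_space scale B"
  shows "vector_space.dim (fun_scale scale) (Char_Gamma rho Gamma_t) = CARD('k) ^ 3 * dim (UNIV :: 'v set)"
proof -
  let ?S = "(\<lambda>(M, N). ch_flag M N) ` (opp_flags :: ('k bt_lattice \<times> _) set)"
  have inj: "inj_on (\<lambda>(M, N). ch_flag M N) (opp_flags :: ('k bt_lattice \<times> _) set)"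
  proof (rule inj_onI)
    fix p p' assume p: "p \<in> opp_flags" "p' \<in> opp_flags"
      "(case p of (M, N) \<Rightarrow> ch_flag M N) = (case p' of (M, N) \<Rightarrow> ch (std_lattice :: 'k bt_lattice) M N)"
    obtain M N M' N' where MN: "p = (M, N)" "p' = (M', N')" by (cases p, cases p')
    have "flag M N" "flag M' N'" "ch_flag M N = ch_flag M' N'"
      using p MN by (simp_all add: opp_flags_def)
    then have "M = M' \<and> N = N'" by (rule ch_inj)
    then show "p = p'" using MN by simp
  qed
  have cO: "card ?S = CARD('k) ^ 3" using card_image[OF inj] card_opp_flags by simp
  have "opp_flags \<subseteq> {(M, N). chain (std_lattice :: 'k bt_lattice) M N}" by (auto simp: opp_flags_def)
  then have fO: "finite ?S" using finite_flags_std finite_subset by blast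
  have St: "St0_chamber s" if "s \<in> ?S" for s using that St0_flag by (auto simp: opp_flags_def)
  have "vector_space.dim (fun_scale scale) (Char_Gamma rho Gamma_t) = card ?S * dim (UNIV :: 'v set)"
  proof (rule dim_by_evaluation[OF vector_space_axioms fin fO Char_Gamma_subspace])
    fix c assume c: "c \<in> Char_Gamma rho Gamma_t" "\<forall>s\<in>?S. c s = 0"
    have r: "restr_St0 c \<in> Char_St0" by (rule restr_Char) (use c(1) in \<open>simp add: Char_Gamma_def\<close>)
    have "restr_St0 c = (\<lambda>_. 0)"
      by (rule St0_unique[OF r]) (use c(2) St in \<open>auto simp: restr_St0_def\<close>)
    moreover have "restr_St0 (0 :: 'k bt_simplex \<Rightarrow> 'v) = (\<lambda>_. 0)" by (simp add: restr_St0_def fun_eq_iff)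
    moreover have "0 \<in> Char_Gamma rho Gamma_t"
      using Char_Gamma_subspace module.subspace_0 vector_space_fun_scale[OF vector_space_axioms] module_iff_vector_space by blast
    ultimately show "c = 0" using restr_inj c(1) by (metis inj_onD)
  next
    fix f :: "'k bt_simplex \<Rightarrow> 'v"
    obtain c0 where c0: "c0 \<in> Char_St0" "\<forall>(M, N)\<in>opp_flags. c0 (ch_flag M N) = f (ch_flag M N)"
      using St0_extension[of f] by blast
    obtain c where c: "c \<in> Char_Gamma rho Gamma_t" "restr_St0 c = c0" using restr_surj[OF c0(1)] by blast
    have "c s = f s" if "s \<in> ?S" for s
    proof -
      have "c s = c0 s" using St[OF that] fun_cong[OF c(2), of s] by (simp add: restr_St0_def)
      then show ?thesis using that c0(2) by auto
    qed
    then show "\<exists>c\<in>Char_Gamma rho Gamma_t. \<forall>s\<in>?S. c s = f s" using c(1) by blast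
  qed
  then show ?thesis using cO by simp
qed

end

theorem theorem3p12:
  fixes scale :: "'k::{field,finite} Fld \<Rightarrow> 'v::ab_group_add \<Rightarrow> 'v"
    and rho :: "'k Fld ^ 3 ^ 3 \<Rightarrow> 'v \<Rightarrow> 'v"
  assumes V: "vector_space scale"
    and fin: "\<exists>B. finite_dimensional_vector_space scale B"
    and lin: "\<And>g. invertible g \<Longrightarrow> Vector_Spaces.linear scale scale (rho g)"
    and act1: "rho (mat 1) = id"
    and actmul: "\<And>g h. invertible g \<Longrightarrow> invertible h \<Longrightarrow> rho (g ** h) = rho g \<circ> rho h"
  shows "Vector_Spaces.linear (fun_scale scale) (fun_scale scale)
           (restr_St0 :: ('k bt_simplex \<Rightarrow> 'v) \<Rightarrow> _)
       \<and> bij_betw restr_St0 (Char_Gamma rho Gamma_t) Char_St0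
       \<and> (\<forall>c\<in>Char_Gamma rho Gamma_t. \<forall>g\<in>GL3Fq.
             slash rho c g \<in> Char_Gamma rho Gamma_t
           \<and> restr_St0 (slash rho c g) = slash rho (restr_St0 c) g)
       \<and> (\<forall>c\<in>Char_St0. \<forall>g\<in>GL3Fq. slash rho c g \<in> Char_St0)
       \<and> vector_space.dim (fun_scale scale) (Char_Gamma rho Gamma_t)
           = CARD('k) ^ 3 * vector_space.dim scale (UNIV :: 'v set)"
proof -
  interpret rep3 scale rho
    by (intro rep3.intro rep3_axioms.intro V lin act1 actmul)
  show ?thesis
    using restr_linear restr_bij slash_Char_Gamma restr_slash slash_Char_St0 dim_Char_Gamma[OF fin] by blast
qed

end
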